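(* A conjugacy class of a closed subgroup of $\mathrm{O}(3)$ is the symmetry class of some tensor $\mathbf{P}\in\mathbb{P}\mathrm{iez}$ if and only if it belongs to the following set of 16 conjugacy classes: $$\{[\mathbb{1}],[\mathbb{Z}_2],[\mathbb{Z}_3],[\mathbb{D}_2^{v}],[\mathbb{D}_3^{v}],[\mathbb{Z}_2^{-}],[\mathbb{Z}_4^{-}],[\mathbb{D}_2],[\mathbb{D}_3],[\mathbb{D}_4^{h}],[\mathbb{D}_6^{h}],[\mathrm{SO}(2)],[\mathrm{O}(2)],[\mathrm{O}(2)^{-}],[\mathbb{O}^{-}],[\mathrm{O}(3)]\}.$$
   Context: $\mathbb{P}\mathrm{iez}$ is the 18-dimensional real vector space of piezoelectricity tensors $\{\mathbf{P}\in\otimes^3(\mathbb{R}^3): P_{ijk}=P_{ikj}\}$ (components in an orthonormal basis). The group $\mathrm{O}(3)$ acts on it by $(g\star\mathbf{P})_{ijk}=g_{ip}g_{jq}g_{kr}P_{pqr}$ (summation over repeated indices). The symmetry group of $\mathbf{P}$ is $G_{\mathbf{P}}=\{g\in\mathrm{O}(3): g\star\mathbf{P}=\mathbf{P}\}$, and its symmetry class is the conjugacy class $[G_{\mathbf{P}}]=\{gG_{\mathbf{P}}g^{-1}: g\in\mathrm{O}(3)\}$. For a subgroup $H$, $[H]$ denotes its conjugacy class in $\mathrm{O}(3)$. Let $(\mathbf{e}_1,\mathbf{e}_2,\mathbf{e}_3)$ be the canonical basis of $\mathbb{R}^3$. For a nonzero vector $\mathbf{n}$, $\mathbf{r}(\mathbf{n},\theta)$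 is the rotation of angle $\theta$ about the axis generated by $\mathbf{n}$, and $\mathbf{s}(\mathbf{n})=-\mathbf{r}(\mathbf{n},\pi)$ is the reflection through the plane orthogonal to $\mathbf{n}$. The subgroups are: - $\mathbb{1}$: the trivial group. - $\mathbb{Z}_n$ ($n\ge 2$): generated by $\mathbf{r}(\mathbf{e}_3,2\pi/n)$. - $\mathbb{D}_n$ ($n\ge2$): generated by $\mathbf{r}(\mathbf{e}_3,2\pi/n)$ and $\mathbf{r}(\mathbf{e}_1,\pi)$. - $\mathbb{D}_n^{v}$ ($n\ge2$): generated by $\mathbf{r}(\mathbf{e}_3,2\pi/n)$ and $\mathbf{s}(\mathbf{e}_1)$. - $\mathbb{Z}_2^{-}$: generated by $\mathbf{s}(\mathbf{e}_3)$. - $\mathbb{Z}_{2n}^{-}$ ($n\ge2$): generated by $-\mathbf{r}(\mathbf{e}_3,\pi/n)$. - $\mathbb{D}_{2n}^{h}$ ($n\ge2$): generated by $-\mathbf{r}(\mathbf{e}_3,\pi/n)$ and $\mathbf{r}(\mathbf{e}_1,\pi)$. - $\mathbb{O}^{-}$ (order 24): generated by $-\mathbf{r}(\mathbf{e}_3,\pi/2)$ and $\mathbf{s}(\mathbf{e}_2-\mathbf{e}_3)$. - $\mathrm{SO}(2)$: all rotations about $\mathbf{e}_3$. - $\mathrm{O}(2)$: generated by $\mathrm{SO}(2)$ and $\mathbf{r}(\mathbf{e}_1,\pi)$. - $\mathrm{O}(2)^{-}$: generated by $\mathrm{SO}(2)$ and $\mathbf{s}(\mathbf{e}_1)$. 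*)

theory Defs
  imports "HOL-Analysis.Analysis" "HOL-Algebra.Group_Action" "HOL-Algebra.Generated_Groups"
begin

abbreviation e1 :: "real^3" where "e1 \<equiv> axis 1 1"
abbreviation e2 :: "real^3" where "e2 \<equiv> axis 2 1"
abbreviation e3 :: "real^3" where "e3 \<equiv> axis 3 1"

definition O3 :: "(real^3^3) monoid" where
  "O3 = \<lparr>carrier = {g. orthogonal_matrix g}, mult = (**), one = mat 1\<rparr>"

lemma group_O3: "group O3"
proof (rule groupI)
  fix x assume "x \<in> carrier O3"
  then show "\<exists>y\<in>carrier O3. y \<otimes>\<^bsub>O3\<^esub> x = \<one>\<^bsub>O3\<^esub>"
    by (intro bexI[of _ "transpose x"]) (simp_all add: O3_def orthogonal_matrix_def)
qed (auto simp: O3_def orthogonal_matrix_mul orthogonal_matrix_id matrix_mul_assoc)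

lemma inv_O3: "g \<in> carrier O3 \<Longrightarrow> inv\<^bsub>O3\<^esub> g = transpose g"
  by (rule group.inv_equality[OF group_O3])
     (auto simp: O3_def orthogonal_matrix_def)

definition conj_class :: "(real^3^3) set \<Rightarrow> (real^3^3) set set" where
  "conj_class H = {g <#\<^bsub>O3\<^esub> H #>\<^bsub>O3\<^esub> (inv\<^bsub>O3\<^esub> g) | g. g \<in> carrier O3}"

lemma conj_class_altdef:
  "conj_class H = {(\<lambda>h. g ** h ** transpose g) ` H | g. orthogonal_matrix g}"
proof -
  have "g <#\<^bsub>O3\<^esub> H #>\<^bsub>O3\<^esub> (inv\<^bsub>O3\<^esub> g) = (\<lambda>h. g ** h ** transpose g) ` H"
    if "orthogonal_matrix g" for g
    using inv_O3[of g] that by (auto simp: O3_def l_coset_def r_coset_def)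
  then show ?thesis
    by (auto simp: conj_class_def O3_def)
qed

(* The component P_ijk is P $ i $ j $ k. *)
definition Piez :: "(real^3^3^3) set" where
  "Piez = {P. \<forall>i j k. P $ i $ j $ k = P $ i $ k $ j}"

definition tensor_act :: "real^3^3 \<Rightarrow> real^3^3^3 \<Rightarrow> real^3^3^3" where
  "tensor_act g P = (\<chi> i j k. \<Sum>p\<in>UNIV. \<Sum>q\<in>UNIV. \<Sum>r\<in>UNIV.
     g $ i $ p * g $ j $ q * g $ k $ r * P $ p $ q $ r)"

definition symmetry_group :: "real^3^3^3 \<Rightarrow> (real^3^3) set" where
  "symmetry_group P = stabilizer O3 tensor_act P"

definition symmetry_class :: "real^3^3^3 \<Rightarrow> (real^3^3) set set" where
  "symmetry_class P = conj_class (symmetry_group P)"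

(* Rodrigues' formula for the right-handed rotation about the axis spanned by n;
   meaningful for n \<noteq> 0 only. *)
definition rot :: "real^3 \<Rightarrow> real \<Rightarrow> real^3^3" where
  "rot n \<theta> = (let u = n /\<^sub>R norm n in
     matrix (\<lambda>x. cos \<theta> *\<^sub>R x + sin \<theta> *\<^sub>R cross3 u x + ((1 - cos \<theta>) * (u \<bullet> x)) *\<^sub>R u))"

definition reflection :: "real^3 \<Rightarrow> real^3^3" where
  "reflection n = - rot n pi"

definition Triv :: "(real^3^3) set" where
  "Triv = {\<one>\<^bsub>O3\<^esub>}"

definition Z :: "nat \<Rightarrow> (real^3^3) set" where
  "Z n = generate O3 {rot e3 (2 * pi / real n)}"

definition D :: "nat \<Rightarrow> (real^3^3) set" where
  "D n = generate O3 {rot e3 (2 * pi / real n), rot e1 pi}"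

definition Dv :: "nat \<Rightarrow> (real^3^3) set" where
  "Dv n = generate O3 {rot e3 (2 * pi / real n), reflection e1}"

definition Z2_minus :: "(real^3^3) set" where
  "Z2_minus = generate O3 {reflection e3}"

(* Below, the argument n \<ge> 2 is half of the usual subscript 2n:
   Z2n_minus 2 is the group written Z_4^-, and D2n_h 2, D2n_h 3 are D_4^h, D_6^h. *)
definition Z2n_minus :: "nat \<Rightarrow> (real^3^3) set" where
  "Z2n_minus n = generate O3 {- rot e3 (pi / real n)}"

definition D2n_h :: "nat \<Rightarrow> (real^3^3) set" where
  "D2n_h n = generate O3 {- rot e3 (pi / real n), rot e1 pi}"

definition O_minus :: "(real^3^3) set" where
  "O_minus = generate O3 {- rot e3 (pi / 2), reflection (e2 - e3)}"

definition SO2 :: "(real^3^3) set" where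
  "SO2 = range (rot e3)"

definition O2 :: "(real^3^3) set" where
  "O2 = generate O3 (SO2 \<union> {rot e1 pi})"

definition O2_minus :: "(real^3^3) set" where
  "O2_minus = generate O3 (SO2 \<union> {reflection e1})"

end

theory Submission
  imports Defs
begin

text \<open>
  The sixteen classes are pairwise distinct because the determinants and traces of their elements,
  or the number of their half turns, differ.

  For a nonzero tensor \<open>P\<close> with symmetry group \<open>G\<close> there are three cases. If \<open>G\<close> contains a rotation that
  is not an involution, then, after a rotation of the coordinates, \<open>P\<close> has only components of weight \<open>0\<close>
  and \<open>\<plusminus>3\<close> with respect to rotations about \<open>e3\<close>. Otherwise, an element of \<open>G\<close> that is not an
  involution is a rotoreflection by a quarter turn, and \<open>P\<close> has only components of weight \<open>\<plusminus>2\<close>. Finally,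
  \<open>G\<close> may consist of commuting involutions.
  In the first two cases the vectors and quadratic forms obtained by contracting \<open>P\<close> and \<open>P \<otimes> P\<close> force
  \<open>G\<close> to preserve the axis of \<open>e3\<close>, unless \<open>P\<close> is a rotated multiple of the octupole \<open>xyz\<close>, whose group
  is \<open>O_minus\<close>. A group preserving this axis is determined up to conjugation by its elements that act as
  \<open>\<plusminus>\<close> rotations about \<open>e3\<close> and the sign of one of its further elements.
\<close>

text \<open>A rotation by \<open>z\<close> about \<open>e3\<close> multiplies weight k by z^k, where
  k runs from -3 to 3, and since the rank is odd, the inversion -1 acts on tensors as -1. So a
  rotation with z different from 1 and -1 kills the weights k with |k| = 1 or 2. In the
  rotoreflection case, the square is a rotation of the group, hence a half turn; so z^2 = -1, and
  -z^k = 1 leaves only k = 2 and k = -2. In the remaining case the absence of the inversion leaves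
  few groups of commuting involutions. The obstacle is to bound the group from above: one known
  element gives the shape of P, but other symmetries might move its axis. The covariants exclude
  this, because an eigenline of multiplicity one of an invariant quadratic form is an invariant
  axis, and the nonzero parameters for which both vectors vanish and both forms are multiples of the
  norm are exactly those of the octupoles. In this way no classification of the closed subgroups of
  O(3) enters. For the converse, the sample tensors have parameters each of which imposes its own
  separate condition on a symmetry.\<close>

text \<open>The rotation by \<open>\<theta>\<close> about \<open>e3\<close> is \<open>rot_z (cis \<theta>)\<close>. The matrices \<open>axial s z f\<close> with \<open>s = \<plusminus>1\<close> and
  \<open>cmod z = 1\<close> form the stabilizer of the axis of \<open>e3\<close> in \<open>O3\<close>; here \<open>s\<close> is the determinant, and \<open>f\<close> tells
  whether the rotation \<open>s *\<^sub>R axial s z f\<close> reverses \<open>e3\<close>.\<close>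

definition rot_z :: "complex \<Rightarrow> real^3^3" where
  "rot_z z = vector [vector [Re z, - Im z, 0], vector [Im z, Re z, 0], vector [0, 0, 1]]"

definition flip_x :: "real^3^3" where
  "flip_x = vector [vector [1, 0, 0], vector [0, -1, 0], vector [0, 0, -1]]"

definition axial :: "real \<Rightarrow> complex \<Rightarrow> bool \<Rightarrow> real^3^3" where
  "axial s z f = s *\<^sub>R (rot_z z ** (if f then flip_x else mat 1))"

definition axial_index :: "real \<Rightarrow> complex \<Rightarrow> bool" where
  "axial_index s z \<longleftrightarrow> s \<in> {1, -1} \<and> cmod z = 1"

section \<open>Calculus of the matrices that preserve the axis of \<open>e3\<close>\<close>

lemma cmod_1_Re_Im: "cmod z = 1 \<longleftrightarrow> (Re z)\<^sup>2 + (Im z)\<^sup>2 = 1"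
  by (simp add: cmod_def)

lemma mat_eq_3:
  fixes A B :: "'a^3^3"
  shows "A = B \<longleftrightarrow>
    A$1$1 = B$1$1 \<and> A$1$2 = B$1$2 \<and> A$1$3 = B$1$3 \<and>
    A$2$1 = B$2$1 \<and> A$2$2 = B$2$2 \<and> A$2$3 = B$2$3 \<and>
    A$3$1 = B$3$1 \<and> A$3$2 = B$3$2 \<and> A$3$3 = B$3$3"
  by (auto simp: vec_eq_iff forall_3)

lemma mult_3:
  fixes A B :: "real^3^3"
  shows "(A ** B) $ i $ j = A$i$1 * B$1$j + A$i$2 * B$2$j + A$i$3 * B$3$j"
  by (simp add: matrix_matrix_mult_def sum_3)

lemma axial_nth:
  "axial s z f $ 1 $ 1 = s * Re z" "axial s z f $ 1 $ 2 = (if f then s * Im z else - s * Im z)"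
  "axial s z f $ 1 $ 3 = 0"
  "axial s z f $ 2 $ 1 = s * Im z" "axial s z f $ 2 $ 2 = (if f then - s * Re z else s * Re z)"
  "axial s z f $ 2 $ 3 = 0"
  "axial s z f $ 3 $ 1 = 0" "axial s z f $ 3 $ 2 = 0" "axial s z f $ 3 $ 3 = (if f then - s else s)"
  by (simp_all add: axial_def rot_z_def flip_x_def mult_3 mat_def)

lemma axial_one: "axial 1 1 False = mat 1"
  by (simp add: mat_eq_3 axial_nth mat_def)

lemma axial_mult:
  "axial s z f ** axial t w g = axial (s * t) (z * (if f then cnj w else w)) (f \<noteq> g)"
  by (simp add: mat_eq_3 axial_nth mult_3 algebra_simps)

lemma axial_transpose:
  "transpose (axial s z f) = axial s (if f then z else cnj z) f"
  by (simp add: mat_eq_3 axial_nth transpose_def)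

lemma axial_index_mult:
  "axial_index s z \<Longrightarrow> axial_index t w \<Longrightarrow> axial_index (s * t) (z * (if f then cnj w else w))"
  by (auto simp: axial_index_def norm_mult)

lemma axial_index_cnj: "axial_index s z \<Longrightarrow> axial_index s (cnj z)"
  by (simp add: axial_index_def)

lemma cnj_mult_unit: "cmod z = 1 \<Longrightarrow> cnj z * z = 1" "cmod z = 1 \<Longrightarrow> z * cnj z = 1"
  by (simp_all add: complex_norm_square[symmetric] mult.commute)

lemma orthogonal_axial:
  assumes "axial_index s z"
  shows "orthogonal_matrix (axial s z f)"
proof -
  have s: "s * s = 1" and z: "cnj z * z = 1" "z * cnj z = 1"
    using assms by (auto simp: axial_index_def cnj_mult_unit)
  show ?thesis
    unfolding orthogonal_matrix
    by (simp add: axial_transpose axial_mult axial_one s z)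
qed

lemma axial_minus: "- axial s z f = axial (- s) z f"
  by (simp add: mat_eq_3 axial_nth)

lemma trace_axial: "trace (axial s z f) = (if f then - s else s * (1 + 2 * Re z))"
  by (simp add: trace_def sum_3 axial_nth algebra_simps)

lemma det_axial:
  assumes "axial_index s z"
  shows "det (axial s z f) = s"
proof -
  have "det (axial s z f) = s^3 * ((Re z)\<^sup>2 + (Im z)\<^sup>2)"
    by (simp add: det_3 axial_nth power2_eq_square power3_eq_cube algebra_simps)
  then show ?thesis
    using assms by (auto simp: axial_index_def cmod_1_Re_Im)
qed

lemma axial_eq_iff:
  assumes "axial_index s z" "axial_index t w"
  shows "axial s z f = axial t w g \<longleftrightarrow> s = t \<and> z = w \<and> f = g"
proof
  assume eq: "axial s z f = axial t w g"
  have "s = t"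
    using det_axial[OF assms(1)] det_axial[OF assms(2)] eq by metis
  moreover have "f = g"
    using arg_cong[OF eq, of "\<lambda>A. A$3$3"] assms \<open>s = t\<close>
    by (auto simp: axial_nth axial_index_def split: if_splits)
  ultimately show "s = t \<and> z = w \<and> f = g"
    using arg_cong[OF eq, of "\<lambda>A. A$1$1"] arg_cong[OF eq, of "\<lambda>A. A$2$1"] assms
    by (auto simp: axial_nth axial_index_def complex_eq_iff)
qed simp

lemma matrix_nth: "matrix f $ i $ j = f (axis j 1) $ i"
  by (simp add: matrix_def)

lemma rot_e3: "rot e3 \<theta> = axial 1 (cis \<theta>) False"
  by (simp add: mat_eq_3 axial_nth rot_def Let_def matrix_nth cross3_def norm_axis_1)
     (simp add: axis_def inner_vec_def sum_3)

lemma rot_e1_pi: "rot e1 pi = axial 1 1 True"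
  by (simp add: mat_eq_3 axial_nth rot_def Let_def matrix_nth cross3_def norm_axis_1)
     (simp add: axis_def inner_vec_def sum_3)

lemma minus_rot_e3: "- rot e3 \<theta> = axial (-1) (cis \<theta>) False"
  by (simp add: rot_e3 axial_minus)

lemma reflection_e1: "reflection e1 = axial (-1) 1 True"
  by (simp add: reflection_def rot_e1_pi axial_minus)

lemma reflection_e3: "reflection e3 = axial (-1) (-1) False"
  by (simp add: reflection_def rot_e3 axial_minus)

text \<open>The basis vectors show that the third row is \<open>e3\<close> up to sign; orthogonality
  gives the same for the third column. The remaining block is orthogonal, and its distance from the
  rotations or from the reflections of the plane is a sum of two squares equal to 2 - 2 * det or 2 +
  2 * det. The sign of \<open>g$3$3\<close> and the kind of block then determine \<open>s\<close> as
  the determinant of the whole matrix.\<close>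

lemma axial_if_preserves_axis:
  assumes g: "orthogonal_matrix g" and ax: "\<And>u. ((g *v u) $ 3)\<^sup>2 = (u $ 3)\<^sup>2"
  obtains s z f where "g = axial s z f" "axial_index s z"
proof -
  have row: "((g *v u) $ 3) = g$3$1 * u$1 + g$3$2 * u$2 + g$3$3 * u$3" for u
    by (simp add: matrix_vector_mult_def sum_3)
  have "g$3$1 = 0" "g$3$2 = 0" and e: "(g$3$3)\<^sup>2 = 1"
    using ax[of "axis 1 1"] ax[of "axis 2 1"] ax[of "axis 3 1"] by (simp_all add: row axis_def)
  note z3 = this(1,2)
  have o: "transpose g ** g = mat 1" "g ** transpose g = mat 1"
    using g by (auto simp: orthogonal_matrix_def)
  have "(g$3$3) * g$1$3 = 0" "(g$3$3) * g$2$3 = 0"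
    using o(2) z3 by (auto simp: mat_eq_3 mult_3 transpose_def mat_def)
  with e have z3': "g$1$3 = 0" "g$2$3 = 0" by auto
  define p q r t where d: "p = g$1$1" "q = g$1$2" "r = g$2$1" "t = g$2$2"
  have eqs: "p*p + r*r = 1" "q*q+t*t = 1" "p*q+r*t = 0" "p*p+q*q=1" "r*r+t*t=1" "p*r+q*t=0"
    using o z3 z3' by (auto simp: mat_eq_3 mult_3 transpose_def mat_def d)
  have "(p - t) * (p + t) = 0" "(q-r)*(q+r) = 0"
    using eqs by (auto simp: algebra_simps)
  have "(p = t \<and> q = - r) \<or> (p = - t \<and> q = r)"
  proof -
    have "(p*t - q*r)\<^sup>2 = (p*p+q*q)*(r*r+t*t) - (p*r+q*t)\<^sup>2" by algebra
    then have "(p*t - q*r)\<^sup>2 = 1" using eqs by simp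
    then consider "p*t - q*r = 1" | "p*t-q*r = -1" by (auto simp: power2_eq_1_iff)
    then show ?thesis
    proof cases
      case 1
      have "(p-t)\<^sup>2 + (q+r)\<^sup>2 = (p*p+q*q) + (r*r+t*t) - 2*(p*t-q*r)" by algebra
      then have "(p-t)\<^sup>2 + (q+r)\<^sup>2 = 0" using 1 eqs by simp
      then have "p = t" "q = -r" by (auto simp: sum_power2_eq_zero_iff)
      then show ?thesis by blast
    next
      case 2
      have "(p+t)\<^sup>2 + (q-r)\<^sup>2 = (p*p+q*q) + (r*r+t*t) + 2*(p*t-q*r)" by algebra
      then have "(p+t)\<^sup>2 + (q-r)\<^sup>2 = 0" using 2 eqs by simp
      then have "p = -t" "q = r" by (auto simp: sum_power2_eq_zero_iff)
      then show ?thesis by blast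
    qed
  qed
  moreover have e: "g$3$3 = 1 \<or> g$3$3 = -1" using e by (simp add: power2_eq_1_iff)
  ultimately consider "p = t" "q = - r" "g$3$3 = 1" | "p = t" "q = - r" "g$3$3 = -1"
    | "p = - t" "q = r" "g$3$3 = 1" | "p = - t" "q = r" "g$3$3 = -1" by blast
  then show ?thesis
  proof cases
    case 1 then show ?thesis
      by (intro that[of 1 "Complex p r" False])
         (use eqs in \<open>auto simp: mat_eq_3 axial_nth z3 z3' d axial_index_def cmod_1_Re_Im power2_eq_square\<close>)
  next
    case 2 then show ?thesis
      by (intro that[of "-1" "Complex (-p) (-r)" False])
         (use eqs in \<open>auto simp: mat_eq_3 axial_nth z3 z3' d axial_index_def cmod_1_Re_Im power2_eq_square\<close>)
  next
    case 3 then show ?thesis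
      by (intro that[of "-1" "Complex (-p) (-r)" True])
         (use eqs in \<open>auto simp: mat_eq_3 axial_nth z3 z3' d axial_index_def cmod_1_Re_Im power2_eq_square\<close>)
  next
    case 4 then show ?thesis
      by (intro that[of "1" "Complex p r" True])
         (use eqs in \<open>auto simp: mat_eq_3 axial_nth z3 z3' d axial_index_def cmod_1_Re_Im power2_eq_square\<close>)
  qed
qed

text \<open>Euler's argument: det (g - 1) = det g * det (1 - transpose g) = det (1 - g), which is -
  det (g - 1) because the dimension is odd.\<close>

lemma rotation_fixes_vector:
  fixes g :: "real^3^3"
  assumes "orthogonal_matrix g" "det g = 1"
  obtains v where "v \<noteq> 0" "g *v v = v"
proof -
  have "det (g - mat 1) = det (g ** (mat 1 - transpose g))"
  proof -
    have "g ** (mat 1 - transpose g) = g - g ** transpose g"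
      by (simp add: mat_eq_3 mult_3 mat_def algebra_simps)
    then show ?thesis using assms by (simp add: orthogonal_matrix_def)
  qed
  also have "\<dots> = det (transpose (mat 1 - g))"
  proof -
    have "transpose (mat 1 - g) = mat 1 - transpose g"
      by (simp add: mat_eq_3 transpose_def mat_def)
    then show ?thesis using assms by (simp add: det_mul)
  qed
  also have "\<dots> = det (- (g - mat 1))" by (simp add: det_transpose)
  also have "\<dots> = - det (g - mat 1)" by (simp add: det_3 algebra_simps)
  finally have "det (g - mat 1) = 0" by simp
  then have "\<not> invertible (g - mat 1)" by (simp add: invertible_det_nz)
  then obtain v where "v \<noteq> 0" "(g - mat 1) *v v = 0"
    by (metis invertible_left_inverse matrix_left_invertible_ker)
  then show ?thesis by (intro that[of v]) (auto simp: matrix_vector_mult_diff_rdistrib)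
qed

lemma orthogonal_matrix_with_axis:
  fixes v :: "real^3"
  assumes "norm v = 1"
  obtains q where "orthogonal_matrix q" "q *v e3 = v"
proof -
  obtain f where f: "orthogonal_transformation f" "f e3 = v"
    using orthogonal_transformation_exists[of e3 v] assms by auto
  then show ?thesis
    by (intro that[of "matrix f"])
       (auto simp: orthogonal_transformation_matrix matrix_works orthogonal_transformation_linear)
qed

lemma rotation_conj_axial:
  assumes g: "orthogonal_matrix g" "det g = 1"
  obtains q z where "orthogonal_matrix q" "cmod z = 1" "transpose q ** g ** q = axial 1 z False"
proof -
  obtain v where v: "v \<noteq> 0" "g *v v = v" using rotation_fixes_vector[OF g] .
  define w where "w = v /\<^sub>R norm v"
  have w: "norm w = 1" "g *v w = w"
    using v by (auto simp: w_def matrix_vector_mult_scaleR)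
  obtain q where q: "orthogonal_matrix q" "q *v e3 = w"
    using orthogonal_matrix_with_axis[OF w(1)] .
  define k where "k = transpose q ** g ** q"
  have ok: "orthogonal_matrix k"
    using q g by (simp add: k_def orthogonal_matrix_mul orthogonal_matrix_transpose)
  have "k *v e3 = transpose q *v (g *v (q *v e3))"
    by (simp add: k_def matrix_vector_mul_assoc matrix_mul_assoc)
  also have "\<dots> = transpose q *v (q *v e3)" using q w by simp
  also have "\<dots> = e3" using q(1) by (simp add: matrix_vector_mul_assoc orthogonal_matrix del: transpose_matrix_vector)
  finally have ke: "k *v e3 = e3" .
  have tk: "transpose k *v e3 = e3"
    using ok arg_cong[OF ke, of "\<lambda>x. transpose k *v x"]
    by (simp add: matrix_vector_mul_assoc orthogonal_matrix del: transpose_matrix_vector)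
  have "(k *v u) $ 3 = u $ 3" for u
  proof -
    have "(k *v u) $ 3 = e3 \<bullet> (k *v u)" by (simp add: inner_axis')
    also have "\<dots> = (transpose k *v e3) \<bullet> u" by (simp add: dot_lmul_matrix)
    finally show ?thesis using tk by (simp add: inner_axis')
  qed
  then obtain s z f where k: "k = axial s z f" "axial_index s z"
    using axial_if_preserves_axis[OF ok] by metis
  have "det k = 1"
    using g q det_orthogonal_matrix[OF q(1)] by (auto simp: k_def det_mul det_transpose)
  then have "s = 1" using det_axial k by metis
  moreover have "\<not> f"
    using arg_cong[OF ke, of "\<lambda>x. x $ 3"] \<open>s = 1\<close> by (auto simp: k matrix_vector_mult_def sum_3 axial_nth axis_def split: if_splits)
  ultimately show ?thesis using k q by (intro that[of q z]) (auto simp: k_def axial_index_def)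
qed

section \<open>Conjugate subgroups and their classes\<close>

lemma O3_simps [simp]:
  "carrier O3 = {g. orthogonal_matrix g}" "x \<otimes>\<^bsub>O3\<^esub> y = x ** y" "\<one>\<^bsub>O3\<^esub> = mat 1"
  by (simp_all add: O3_def)

definition conj_set :: "real^3^3 \<Rightarrow> (real^3^3) set \<Rightarrow> (real^3^3) set" where
  "conj_set q H = (\<lambda>h. q ** h ** transpose q) ` H"

lemma orthogonal_cancel [simp]:
  fixes q :: "real^3^3"
  assumes "orthogonal_matrix q"
  shows "q ** transpose q = mat 1" "transpose q ** q = mat 1"
    "q ** (transpose q ** A) = A" "transpose q ** (q ** A) = A"
  using assms by (simp_all add: orthogonal_matrix_def matrix_mul_assoc)

lemma conj_class_eq: "conj_class H = {conj_set q H | q. orthogonal_matrix q}"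
  by (simp add: conj_class_altdef conj_set_def)

lemma conj_set_conj_set: "conj_set q (conj_set r H) = conj_set (q ** r) H"
  by (simp add: conj_set_def image_image matrix_transpose_mul matrix_mul_assoc)

lemma conj_set_one: "conj_set (mat 1) H = H"
  by (simp add: conj_set_def transpose_mat)

lemma self_in_conj_class: "H \<in> conj_class H"
  unfolding conj_class_eq using conj_set_one[of H, symmetric] orthogonal_matrix_id by blast

lemma conj_class_conj_set:
  assumes "orthogonal_matrix q"
  shows "conj_class (conj_set q H) = conj_class H"
proof -
  have "conj_set r H = conj_set (r ** transpose q) (conj_set q H)" for r
    using assms by (simp add: conj_set_conj_set matrix_mul_assoc[symmetric])
  then show ?thesis
    using assms unfolding conj_class_eq conj_set_conj_set
    by (fastforce intro: orthogonal_matrix_mul orthogonal_matrix_transpose[THEN iffD2])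
qed

lemma conj_class_eqD:
  assumes "conj_class H = conj_class H'"
  obtains q where "orthogonal_matrix q" "H' = conj_set q H"
proof -
  have "H' \<in> conj_class H" using self_in_conj_class assms by simp
  then show ?thesis using that by (auto simp: conj_class_eq)
qed

subsection \<open>The trilinear form of a tensor\<close>

text \<open>The scalars are left open: real vectors serve the covariants, complex ones the
  eigenvectors of a rotation in \<open>tensor3_if_rotation\<close>.\<close>

definition form :: "real^3^3^3 \<Rightarrow> ('a::{real_algebra_1,comm_ring_1})^3 \<Rightarrow> 'a^3 \<Rightarrow> 'a^3 \<Rightarrow> 'a" where
  "form P x y w = (\<Sum>i\<in>UNIV. x$i * (\<Sum>j\<in>UNIV. y$j * (\<Sum>k\<in>UNIV. w$k * of_real (P$i$j$k))))"

definition pull :: "real^3^3 \<Rightarrow> ('a::{real_algebra_1,comm_ring_1})^3 \<Rightarrow> 'a^3" where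
  "pull g x = (\<chi> p. \<Sum>i\<in>UNIV. x$i * of_real (g$i$p))"

lemma pull_real: "pull g x = transpose g *v (x :: real^3)"
  by (simp add: pull_def matrix_vector_mult_def transpose_def vec_eq_iff mult.commute)

lemma pull_pull: "pull h (pull g x) = pull (g ** h) x"
proof -
  have "(\<Sum>i\<in>UNIV. (\<Sum>j\<in>UNIV. x$j * of_real (g$j$i)) * of_real (h$i$p))
      = (\<Sum>j\<in>UNIV. x$j * (\<Sum>i\<in>UNIV. of_real (g$j$i) * of_real (h$i$p)))" for p
    unfolding sum_distrib_left sum_distrib_right
    by (subst sum.swap) (simp add: mult.assoc)
  then show ?thesis by (simp add: pull_def matrix_matrix_mult_def vec_eq_iff)
qed

lemma tensor_act_nth: "tensor_act g P $ i $ j $ k = form P (g$i) (g$j) (g$k)"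
  by (simp add: tensor_act_def form_def sum_distrib_left mult.assoc)

lemma sum_mult_swap:
  fixes u v :: "'a::finite \<Rightarrow> 'b::comm_semiring_0"
  shows "(\<Sum>a\<in>UNIV. u a * (\<Sum>b\<in>UNIV. v b * X a b)) = (\<Sum>b\<in>UNIV. v b * (\<Sum>a\<in>UNIV. u a * X a b))"
  unfolding sum_distrib_left by (subst sum.swap) (simp add: mult.left_commute)

lemma form_tensor_act: "form (tensor_act g P) x y w = form P (pull g x) (pull g y) (pull g w)"
proof -
  have contract: "(\<Sum>p\<in>UNIV. pull g u $ p * X p) = (\<Sum>i\<in>UNIV. u$i * (\<Sum>p\<in>UNIV. of_real (g$i$p) * X p))"
    for u :: "'a^3" and X
    unfolding pull_def sum_distrib_left vec_lambda_beta sum_distrib_right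
    by (subst sum.swap) (simp add: mult.assoc)
  have "form P (pull g x) (pull g y) (pull g w) =
    (\<Sum>i\<in>UNIV. x$i * (\<Sum>p\<in>UNIV. of_real (g$i$p) * (\<Sum>j\<in>UNIV. y$j * (\<Sum>q\<in>UNIV. of_real (g$j$q) *
      (\<Sum>k\<in>UNIV. w$k * (\<Sum>r\<in>UNIV. of_real (g$k$r) * of_real (P$p$q$r)))))))"
    by (simp only: form_def contract)
  \<comment> \<open>The sums now run over i, p, j, q, k, r in this order; three exchanges of
    neighbours bring them into the order i, j, k, p, q, r of the right-hand side.\<close>
  also have "\<dots> = (\<Sum>i\<in>UNIV. x$i * (\<Sum>j\<in>UNIV. y$j * (\<Sum>p\<in>UNIV. of_real (g$i$p) * 
      (\<Sum>q\<in>UNIV. of_real (g$j$q) *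
      (\<Sum>k\<in>UNIV. w$k * (\<Sum>r\<in>UNIV. of_real (g$k$r) * of_real (P$p$q$r)))))))"
    by (subst (2) sum_mult_swap) (rule refl)
  also have "\<dots> = (\<Sum>i\<in>UNIV. x$i * (\<Sum>j\<in>UNIV. y$j * (\<Sum>p\<in>UNIV. of_real (g$i$p) * 
      (\<Sum>k\<in>UNIV. w$k * (\<Sum>q\<in>UNIV. of_real (g$j$q) * 
      (\<Sum>r\<in>UNIV. of_real (g$k$r) * of_real (P$p$q$r)))))))"
    by (subst (4) sum_mult_swap) (rule refl)
  also have "\<dots> = (\<Sum>i\<in>UNIV. x$i * (\<Sum>j\<in>UNIV. y$j * (\<Sum>k\<in>UNIV. w$k * (\<Sum>p\<in>UNIV. of_real (g$i$p) * 
      (\<Sum>q\<in>UNIV. of_real (g$j$q) * (\<Sum>r\<in>UNIV. of_real (g$k$r) * of_real (P$p$q$r)))))))"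
    by (subst (3) sum_mult_swap) (rule refl)
  also have "\<dots> = form (tensor_act g P) x y w"
    by (simp add: form_def tensor_act_nth)
  finally show ?thesis ..
qed

lemma form_axis: "form P (axis i 1) (axis j 1) (axis k 1) = of_real (P$i$j$k)"
proof -
  have *: "(\<Sum>i\<in>UNIV. axis k 1 $ i * X i) = X k" for X :: "3 \<Rightarrow> 'a" and k
  proof -
    have "(\<Sum>i\<in>UNIV. axis k 1 $ i * X i) = (\<Sum>i\<in>UNIV. if i = k then X i else 0)"
      by (intro sum.cong) (auto simp: axis_def)
    then show ?thesis by simp
  qed
  show ?thesis by (simp add: form_def *)
qed

lemma tensor_eqI:
  assumes "\<And>x y w :: real^3. form P x y w = form Q x y w"
  shows "P = Q"
  using assms[of "axis _ 1" "axis _ 1" "axis _ 1"] by (simp add: form_axis vec_eq_iff)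

lemma tensor_act_mult: "tensor_act g (tensor_act h P) = tensor_act (g ** h) P"
  by (rule tensor_eqI) (simp add: form_tensor_act pull_pull)

lemma tensor_act_one: "tensor_act (mat 1) P = P"
  by (rule tensor_eqI) (simp add: form_tensor_act pull_real transpose_mat)

lemma tensor_act_scaleR_left: "tensor_act (c *\<^sub>R g) P = c^3 *\<^sub>R tensor_act g P"
  by (simp add: tensor_act_def vec_eq_iff sum_distrib_left power3_eq_cube algebra_simps)

lemma tensor_act_scaleR: "tensor_act g (c *\<^sub>R P) = c *\<^sub>R tensor_act g P"
  by (simp add: tensor_act_def vec_eq_iff sum_distrib_left algebra_simps)

lemma form_scale: "form P (a *s x) (b *s y) (c *s w) = a * b * c * form P x y w"
  by (simp add: form_def sum_distrib_left mult_ac)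

lemma form_sym:
  assumes "P \<in> Piez" shows "form P x y w = form P x w y"
proof -
  have "form P x y w = (\<Sum>i\<in>UNIV. x$i * (\<Sum>k\<in>UNIV. w$k * (\<Sum>j\<in>UNIV. y$j * of_real (P$i$j$k))))"
    unfolding form_def by (subst (2) sum_mult_swap) (rule refl)
  then show ?thesis using assms by (simp add: form_def Piez_def)
qed

lemma tensor_act_Piez: "P \<in> Piez \<Longrightarrow> tensor_act g P \<in> Piez"
  using form_sym[of P] by (auto simp: Piez_def tensor_act_nth)

lemma symmetry_group_eq: "symmetry_group P = {g. orthogonal_matrix g \<and> tensor_act g P = P}"
  by (simp add: symmetry_group_def stabilizer_def)

lemma subgroup_O3I:
  assumes "\<And>g. g \<in> H \<Longrightarrow> orthogonal_matrix g" "mat 1 \<in> H"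
    "\<And>g h. g \<in> H \<Longrightarrow> h \<in> H \<Longrightarrow> g ** h \<in> H" "\<And>g. g \<in> H \<Longrightarrow> transpose g \<in> H"
  shows "subgroup H O3"
  using assms by (intro group.subgroupI[OF group_O3]) (auto simp: inv_O3)

lemma subgroup_O3D:
  assumes "subgroup H O3"
  shows "\<And>g. g \<in> H \<Longrightarrow> orthogonal_matrix g" "mat 1 \<in> H"
    "\<And>g h. g \<in> H \<Longrightarrow> h \<in> H \<Longrightarrow> g ** h \<in> H" "\<And>g. g \<in> H \<Longrightarrow> transpose g \<in> H"
proof -
  show o: "orthogonal_matrix g" if "g \<in> H" for g
    using subgroup.subset[OF assms] that by auto
  show "mat 1 \<in> H" "\<And>g h. g \<in> H \<Longrightarrow> h \<in> H \<Longrightarrow> g ** h \<in> H"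
    using subgroup.one_closed[OF assms] subgroup.m_closed[OF assms] by auto
  show "transpose g \<in> H" if "g \<in> H" for g
    using subgroup.m_inv_closed[OF assms that] inv_O3[of g] o[OF that] by simp
qed

lemma tensor_act_transpose:
  assumes "orthogonal_matrix g" "tensor_act g P = P"
  shows "tensor_act (transpose g) P = P"
proof -
  have "tensor_act (transpose g) (tensor_act g P) = P"
    using assms(1) by (simp add: tensor_act_mult tensor_act_one)
  then show ?thesis using assms(2) by simp
qed

lemma subgroup_symmetry_group: "subgroup (symmetry_group P) O3"
  by (rule subgroup_O3I)
     (auto simp: symmetry_group_eq orthogonal_matrix_id tensor_act_one orthogonal_matrix_mul
        tensor_act_transpose simp flip: tensor_act_mult)

lemma symmetry_group_tensor_act:
  assumes q: "orthogonal_matrix q"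
  shows "symmetry_group (tensor_act q P) = conj_set q (symmetry_group P)"
proof -
  have sub: "conj_set r (symmetry_group R) \<subseteq> symmetry_group (tensor_act r R)"
    if "orthogonal_matrix r" for r R
  proof -
    have "tensor_act (r ** h ** transpose r) (tensor_act r R) = tensor_act r R"
      if "h \<in> symmetry_group R" for h
    proof -
      have "tensor_act (r ** h ** transpose r) (tensor_act r R) = tensor_act r (tensor_act h R)"
        using \<open>orthogonal_matrix r\<close> by (simp add: tensor_act_mult matrix_mul_assoc[symmetric])
      then show ?thesis using that by (simp add: symmetry_group_eq)
    qed
    then show ?thesis using that
      by (auto simp: conj_set_def symmetry_group_eq orthogonal_matrix_mul orthogonal_matrix_transpose)
  qed
  have "conj_set (transpose q) (symmetry_group (tensor_act q P)) \<subseteq> symmetry_group P"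
    using sub[of "transpose q" "tensor_act q P"] q
    by (simp add: tensor_act_mult tensor_act_one orthogonal_matrix_transpose)
  then have "conj_set q (conj_set (transpose q) (symmetry_group (tensor_act q P)))
      \<subseteq> conj_set q (symmetry_group P)"
    by (auto simp: conj_set_def)
  then show ?thesis
    using sub[OF q, of P] q by (simp add: conj_set_conj_set conj_set_one)
qed

lemma symmetry_class_tensor_act:
  "orthogonal_matrix q \<Longrightarrow> symmetry_class (tensor_act q P) = symmetry_class P"
  by (simp add: symmetry_class_def symmetry_group_tensor_act conj_class_conj_set)

lemma symmetry_class_scaleR: "c \<noteq> 0 \<Longrightarrow> symmetry_class (c *\<^sub>R P) = symmetry_class P"
  by (simp add: symmetry_class_def symmetry_group_eq tensor_act_scaleR)

subsection \<open>Covariants\<close>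

text \<open>The trace of a bilinear form is the same in every orthonormal basis. The rows of
  \<open>g\<close> are such a basis, and they are also the vectors \<open>pull g (axis k 1)\<close>;
  this is why contractions of a tensor commute with the action.\<close>

lemma sum_rows_orthogonal:
  fixes g :: "real^3^3"
  assumes g: "orthogonal_matrix g" and B: "bilinear B"
  shows "(\<Sum>k\<in>UNIV. B (g$k) (g$k)) = (\<Sum>k\<in>UNIV. B (axis k 1) (axis k 1 :: real^3) :: real)"
proof -
  have expand: "g$k = (\<Sum>a\<in>UNIV. g$k$a *\<^sub>R axis a 1)" for k
    by (simp add: vec_eq_iff axis_def if_distrib cong: if_cong)
  have "B (g$k) (g$k) = (\<Sum>a\<in>UNIV. \<Sum>b\<in>UNIV. g$k$a * g$k$b * B (axis a 1) (axis b 1))" for k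
  proof -
    have "B (g$k) (g$k) = B (\<Sum>a\<in>UNIV. g$k$a *\<^sub>R axis a 1) (\<Sum>a\<in>UNIV. g$k$a *\<^sub>R axis a 1)"
      using expand[of k] by simp
    also have "\<dots> = (\<Sum>a\<in>UNIV. \<Sum>b\<in>UNIV. B (g$k$a *\<^sub>R axis a 1) (g$k$b *\<^sub>R axis b 1))"
      by (simp add: bilinear_sum[OF B] sum.cartesian_product)
    finally show ?thesis
      by (simp add: bilinear_lmul[OF B] bilinear_rmul[OF B] mult_ac)
  qed
  then have "(\<Sum>k\<in>UNIV. B (g$k) (g$k))
      = (\<Sum>k\<in>UNIV. \<Sum>a\<in>UNIV. \<Sum>b\<in>UNIV. g$k$a * g$k$b * B (axis a 1) (axis b 1))"
    by simp
  also have "\<dots> = (\<Sum>a\<in>UNIV. \<Sum>k\<in>UNIV. \<Sum>b\<in>UNIV. g$k$a * g$k$b * B (axis a 1) (axis b 1))"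
    by (rule sum.swap)
  also have "\<dots> = (\<Sum>a\<in>UNIV. \<Sum>b\<in>UNIV. \<Sum>k\<in>UNIV. g$k$a * g$k$b * B (axis a 1) (axis b 1))"
    by (rule sum.cong[OF refl], rule sum.swap)
  also have "\<dots> = (\<Sum>a\<in>UNIV. \<Sum>b\<in>UNIV. (transpose g ** g)$a$b * B (axis a 1) (axis b 1))"
    by (simp only: matrix_matrix_mult_def transpose_def sum_distrib_right vec_lambda_beta)
  also have "\<dots> = (\<Sum>a\<in>UNIV. \<Sum>b\<in>UNIV. if a = b then B (axis a 1) (axis b 1) else 0)"
    by (rule sum.cong[OF refl], rule sum.cong[OF refl])
       (simp add: orthogonal_cancel(2)[OF g] mat_def)
  finally show ?thesis by simp
qed

lemma linear_form:
  fixes x y w :: "real^3"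
  shows "linear (\<lambda>x. form P x y w)" "linear (\<lambda>y. form P x y w)" "linear (\<lambda>w. form P x y w)"
  by (rule linearI; simp add: form_def sum_distrib_left sum.distrib algebra_simps)+

lemma bilinear_mult_linear:
  fixes f f' :: "real^3 \<Rightarrow> real"
  assumes "linear f" "linear f'"
  shows "bilinear (\<lambda>x y. f x * f' y)"
  using assms by (auto simp: bilinear_def linear_iff algebra_simps)

lemma bilinear_form:
  fixes u :: "real^3"
  shows "bilinear (\<lambda>x y. form P u x y)" "bilinear (\<lambda>x y. form P x u y)" "bilinear (\<lambda>x y. form P x y u)"
  unfolding bilinear_def using linear_form by blast+

lemma pull_axis: "pull g (axis k 1) = (g$k :: real^3)"
proof -
  have "(\<Sum>i\<in>UNIV. axis k 1 $ i * g$i$p) = (\<Sum>i\<in>UNIV. if i = k then g$i$p else 0)" for p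
    by (intro sum.cong) (auto simp: axis_def)
  then show ?thesis by (simp add: pull_def vec_eq_iff)
qed

lemma form_pull:
  assumes "tensor_act g P = P"
  shows "form P (pull g x) (pull g y) (pull g w) = form P x y w"
  using form_tensor_act[of g P x y w] assms by simp

text \<open>The sums are the vectors P_ikk and P_kik, which by the symmetry of P in its last two
  indices are all its contractions to a vector when P is in \<open>Piez\<close>. After the passage
  to the rows of \<open>g\<close>, all three arguments carry \<open>pull g\<close>, and
  \<open>form_pull\<close> removes it.\<close>

lemma trace_form_invariant:
  assumes g: "orthogonal_matrix g" "tensor_act g P = P"
  shows "(\<Sum>k\<in>UNIV. form P (pull g u) (axis k 1) (axis k 1)) = (\<Sum>k\<in>UNIV. form P u (axis k 1) (axis k (1::real)))"
    "(\<Sum>k\<in>UNIV. form P (axis k 1) (pull g u) (axis k 1)) = (\<Sum>k\<in>UNIV. form P (axis k 1) u (axis k (1::real)))"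
proof -
  have "(\<Sum>k\<in>UNIV. form P (pull g u) (axis k 1) (axis k 1)) = (\<Sum>k\<in>UNIV. form P (pull g u) (g$k) (g$k))"
    by (rule sum_rows_orthogonal[OF g(1) bilinear_form(1), symmetric])
  then show "(\<Sum>k\<in>UNIV. form P (pull g u) (axis k 1) (axis k 1)) = (\<Sum>k\<in>UNIV. form P u (axis k 1) (axis k (1::real)))"
    by (simp only: pull_axis[of g, symmetric] form_pull[OF g(2)])
  have "(\<Sum>k\<in>UNIV. form P (axis k 1) (pull g u) (axis k 1)) = (\<Sum>k\<in>UNIV. form P (g$k) (pull g u) (g$k))"
    by (rule sum_rows_orthogonal[OF g(1) bilinear_form(2), symmetric])
  then show "(\<Sum>k\<in>UNIV. form P (axis k 1) (pull g u) (axis k 1)) = (\<Sum>k\<in>UNIV. form P (axis k 1) u (axis k (1::real)))"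
    by (simp only: pull_axis[of g, symmetric] form_pull[OF g(2)])
qed

text \<open>The quadratic forms \<open>P\<^sub>i\<^sub>k\<^sub>l P\<^sub>j\<^sub>k\<^sub>l\<close> and \<open>P\<^sub>i\<^sub>k\<^sub>l P\<^sub>k\<^sub>j\<^sub>l\<close> (summed over \<open>k\<close> and \<open>l\<close>); being covariant,
  they distinguish directions that every symmetry of \<open>P\<close> must respect.\<close>

definition gram :: "real^3^3^3 \<Rightarrow> real^3 \<Rightarrow> real" where
  "gram P u = (\<Sum>k\<in>UNIV. \<Sum>l\<in>UNIV. form P u (axis k 1) (axis l 1) * form P u (axis k 1) (axis l 1))"

definition gram' :: "real^3^3^3 \<Rightarrow> real^3 \<Rightarrow> real" where
  "gram' P u = (\<Sum>k\<in>UNIV. \<Sum>l\<in>UNIV. form P u (axis k 1) (axis l 1) * form P (axis k 1) u (axis l 1))"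

lemma gram_invariant:
  assumes g: "orthogonal_matrix g" "tensor_act g P = P"
  shows "gram P (pull g u) = gram P u" "gram' P (pull g u) = gram' P u"
proof -
  let ?v = "pull g u"
  note rows = sum_rows_orthogonal[OF g(1) bilinear_mult_linear, of "\<lambda>x. form P ?v _ x" "\<lambda>x. form P _ _ x",
      OF linear_form(3) linear_form(3)]
    sum_rows_orthogonal[OF g(1) bilinear_mult_linear, of "\<lambda>x. form P ?v x _" "\<lambda>x. form P ?v x _",
      OF linear_form(2) linear_form(2)]
    sum_rows_orthogonal[OF g(1) bilinear_mult_linear, of "\<lambda>x. form P ?v x _" "\<lambda>x. form P x ?v _",
      OF linear_form(2) linear_form(1)]
  \<comment> \<open>The basis is replaced in one summation index at a time, since
    \<open>rows\<close> rewrites only the inner sum; \<open>sum.swap\<close> makes the other index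
    the inner one.\<close>
  have "gram P ?v = (\<Sum>k\<in>UNIV. \<Sum>l\<in>UNIV. form P ?v (axis k 1) (g$l) * form P ?v (axis k 1) (g$l))"
    by (simp only: gram_def rows)
  also have "\<dots> = (\<Sum>l\<in>UNIV. \<Sum>k\<in>UNIV. form P ?v (axis k 1) (g$l) * form P ?v (axis k 1) (g$l))"
    by (rule sum.swap)
  also have "\<dots> = (\<Sum>l\<in>UNIV. \<Sum>k\<in>UNIV. form P ?v (g$k) (g$l) * form P ?v (g$k) (g$l))"
    by (simp only: rows)
  also have "\<dots> = (\<Sum>l\<in>UNIV. \<Sum>k\<in>UNIV. form P u (axis k 1) (axis l 1) * form P u (axis k 1) (axis l 1))"
    by (simp only: pull_axis[of g, symmetric] form_pull[OF g(2)])
  also have "\<dots> = gram P u"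
    unfolding gram_def by (rule sum.swap)
  finally show "gram P ?v = gram P u" .
  have "gram' P ?v = (\<Sum>k\<in>UNIV. \<Sum>l\<in>UNIV. form P ?v (axis k 1) (g$l) * form P (axis k 1) ?v (g$l))"
    by (simp only: gram'_def rows)
  also have "\<dots> = (\<Sum>l\<in>UNIV. \<Sum>k\<in>UNIV. form P ?v (axis k 1) (g$l) * form P (axis k 1) ?v (g$l))"
    by (rule sum.swap)
  also have "\<dots> = (\<Sum>l\<in>UNIV. \<Sum>k\<in>UNIV. form P ?v (g$k) (g$l) * form P (g$k) ?v (g$l))"
    by (simp only: rows)
  also have "\<dots> = (\<Sum>l\<in>UNIV. \<Sum>k\<in>UNIV. form P u (axis k 1) (axis l 1) * form P (axis k 1) u (axis l 1))"
    by (simp only: pull_axis[of g, symmetric] form_pull[OF g(2)])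
  also have "\<dots> = gram' P u"
    unfolding gram'_def by (rule sum.swap)
  finally show "gram' P ?v = gram' P u" .
qed

lemma norm_pull:
  fixes u :: "real^3"
  assumes "orthogonal_matrix g"
  shows "(pull g u $ 1)\<^sup>2 + (pull g u $ 2)\<^sup>2 + (pull g u $ 3)\<^sup>2 = (u$1)\<^sup>2 + (u$2)\<^sup>2 + (u$3)\<^sup>2"
proof -
  have "orthogonal_transformation (\<lambda>u. transpose g *v u)"
    using assms orthogonal_transformation_matrix orthogonal_matrix_transpose
    by (metis matrix_of_matrix_vector_mul matrix_vector_mul_linear)
  then have "norm (pull g u) = norm u"
    by (simp add: pull_real orthogonal_transformation_norm del: transpose_matrix_vector)
  then have "(norm (pull g u))\<^sup>2 = (norm u)\<^sup>2" by simp
  then show ?thesis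
    by (simp only: power2_norm_eq_inner) (simp add: inner_vec_def sum_3 power2_eq_square)
qed

lemma axial_if_pull_preserves:
  assumes g: "orthogonal_matrix g" and ax: "\<And>u :: real^3. (pull g u $ 3)\<^sup>2 = (u $ 3)\<^sup>2"
  obtains s z f where "g = axial s z f" "axial_index s z"
proof -
  obtain s z f where *: "transpose g = axial s z f" "axial_index s z"
    using axial_if_preserves_axis[of "transpose g"] g ax
    by (auto simp: pull_real orthogonal_matrix_transpose)
  then have "g = transpose (axial s z f)" by (metis transpose_transpose)
  then show ?thesis
    using *(2) by (intro that[of s "if f then z else cnj z" f]) (auto simp: axial_transpose axial_index_def)
qed

subsection \<open>Subgroups consisting of axial matrices\<close>

lemma subgroup_conj_set:
  assumes q: "orthogonal_matrix q" and H: "subgroup H O3"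
  shows "subgroup (conj_set q H) O3"
proof (rule subgroup_O3I)
  note D = subgroup_O3D[OF H]
  show "orthogonal_matrix g" if "g \<in> conj_set q H" for g
    using that q D(1) by (auto simp: conj_set_def orthogonal_matrix_mul orthogonal_matrix_transpose)
  show "mat 1 \<in> conj_set q H"
    using D(2) q by (auto simp: conj_set_def intro!: image_eqI[of _ _ "mat 1"])
  show "transpose g \<in> conj_set q H" if "g \<in> conj_set q H" for g
    using that D(4) by (auto simp: conj_set_def matrix_transpose_mul matrix_mul_assoc)
  show "g ** h \<in> conj_set q H" if gh: "g \<in> conj_set q H" "h \<in> conj_set q H" for g h
  proof -
    obtain a where a: "a \<in> H" "g = q ** a ** transpose q" using gh(1) by (auto simp: conj_set_def)
    obtain b where b: "b \<in> H" "h = q ** b ** transpose q" using gh(2) by (auto simp: conj_set_def)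
    note * = a b
    have "g ** h = q ** (a ** b) ** transpose q"
      using q by (simp add: * matrix_mul_assoc[symmetric])
    then show ?thesis using D(3) * by (auto simp: conj_set_def)
  qed
qed

lemma generate_subset: "subgroup H O3 \<Longrightarrow> S \<subseteq> H \<Longrightarrow> generate O3 S \<subseteq> H"
  using group.generate_subgroup_incl[OF group_O3] by blast

lemma subgroup_generate: "(\<And>g. g \<in> S \<Longrightarrow> orthogonal_matrix g) \<Longrightarrow> subgroup (generate O3 S) O3"
  by (intro group.generate_is_subgroup[OF group_O3]) auto

text \<open>Conjugation by a rotation about \<open>e3\<close> fixes the unflipped matrices and can
  bring the phase of one flipped matrix to 1. Every other flipped element is an unflipped one times
  this flip, so the unflipped part and the sign \<open>s\<close> determine the group up to
  conjugation.\<close>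

lemma axial_subgroup_with_flip:
  assumes G: "subgroup G O3"
    and ax: "\<And>g. g \<in> G \<Longrightarrow> \<exists>s z f. axial_index s z \<and> g = axial s z f"
    and S: "S \<subseteq> G"
    and S0: "\<And>g. g \<in> S \<Longrightarrow> \<exists>s z. axial_index s z \<and> g = axial s z False"
    and G0: "\<And>s z. axial_index s z \<Longrightarrow> axial s z False \<in> G \<Longrightarrow> axial s z False \<in> generate O3 S"
    and m: "axial_index s z" "axial s z True \<in> G"
  shows "conj_class G = conj_class (generate O3 (insert (axial s 1 True) S))"
proof -
  \<comment> \<open>Conjugation by \<open>axial 1 w False\<close> multiplies the phase of a flipped
    matrix by w^2, so w^2 has to be the inverse of z.\<close>
  define w where "w = csqrt (cnj z)"
  have w: "w * w = cnj z" by (simp add: w_def flip: power2_eq_square)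
  have "cmod w = 1"
    using m(1) arg_cong[OF w, of cmod] norm_ge_zero[of w]
    by (auto simp: axial_index_def norm_mult square_eq_1_iff simp del: norm_ge_zero)
  then have iw: "axial_index 1 w" by (simp add: axial_index_def)
  define q where "q = axial 1 w False"
  have q: "orthogonal_matrix q" using orthogonal_axial iw by (simp add: q_def)
  have ww: "w * cnj w = 1" using \<open>cmod w = 1\<close> by (simp add: cnj_mult_unit)
  have qf: "q ** axial t u False ** transpose q = axial t u False" for t u
  proof -
    have "w * u * cnj w = u" using ww by (metis mult.assoc mult.commute mult.right_neutral)
    then show ?thesis unfolding q_def axial_transpose axial_mult
      by (simp only: if_False simp_thms mult_1_left mult_1_right)
  qed
  have qt: "q ** axial t u True ** transpose q = axial t (w * u * w) True" for t u
    by (simp add: q_def axial_mult axial_transpose)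
  have "w * z * w = 1"
  proof -
    have "w * z * w = (w * w) * z" by (simp only: mult_ac)
    also have "\<dots> = cnj z * z" by (simp only: w)
    also have "\<dots> = 1" using m(1) by (simp add: axial_index_def cnj_mult_unit)
    finally show ?thesis .
  qed
  define G' where "G' = conj_set q G"
  define m' where "m' = axial s 1 True"
  have G': "subgroup G' O3" unfolding G'_def by (rule subgroup_conj_set[OF q G])
  have mG: "m' \<in> G'"
    using m(2) qt[of s z] \<open>w * z * w = 1\<close> by (auto simp: G'_def m'_def conj_set_def intro!: image_eqI)
  have SG: "S \<subseteq> G'"
  proof
    fix g assume g: "g \<in> S"
    then have "g = q ** g ** transpose q" using S0[OF g] qf by auto
    then show "g \<in> G'" using g S unfolding G'_def conj_set_def by blast
  qed
  have s2: "s * s = 1" using m(1) by (auto simp: axial_index_def)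
  have mm: "m' ** m' = mat 1" by (simp add: m'_def axial_mult s2 axial_one)
  have ax': "\<exists>s z f. axial_index s z \<and> g = axial s z f" if gG: "g \<in> G'" for g
  proof -
    obtain h where h: "h \<in> G" "g = q ** h ** transpose q" using gG by (auto simp: G'_def conj_set_def)
    obtain t u f where tu: "axial_index t u" "h = axial t u f" using ax[OF h(1)] by blast
    show ?thesis
    proof (cases f)
      case True
      then have "g = axial t (w * u * w) True" using h tu qt by simp
      moreover have "axial_index t (w * u * w)" using tu iw by (simp add: axial_index_def norm_mult)
      ultimately show ?thesis by blast
    next
      case False
      then show ?thesis using h tu qf by auto
    qed
  qed
  have f0: "axial t u False \<in> generate O3 S" if tu: "axial_index t u" "axial t u False \<in> G'" for t u
  proof -
    obtain h where h: "h \<in> G" "axial t u False = q ** h ** transpose q"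
      using tu(2) by (auto simp: G'_def conj_set_def)
    have "axial t u False = q ** axial t u False ** transpose q" by (simp add: qf)
    then have "transpose q ** (q ** h ** transpose q) ** q = transpose q ** (q ** axial t u False ** transpose q) ** q"
      using h by simp
    then have "h = axial t u False" using q by (simp add: matrix_mul_assoc[symmetric])
    then show ?thesis using G0[OF tu(1)] h(1) by simp
  qed
  have sub: "generate O3 S \<subseteq> generate O3 (insert m' S)"
    by (rule group.mono_generate[OF group_O3]) auto
  have om: "orthogonal_matrix g" if "g \<in> insert m' S" for g
    using that mG SG subgroup_O3D(1)[OF G'] by auto
  have "subgroup (generate O3 (insert m' S)) O3" by (rule subgroup_generate) (rule om)
  note D = subgroup_O3D[OF this]
  have "G' = generate O3 (insert m' S)"
  proof
    show "generate O3 (insert m' S) \<subseteq> G'"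
      by (rule generate_subset[OF G']) (use mG SG in auto)
    show "G' \<subseteq> generate O3 (insert m' S)"
    proof
      fix g assume gG: "g \<in> G'"
      obtain t u f where tu: "axial_index t u" "g = axial t u f" using ax'[OF gG] by blast
      show "g \<in> generate O3 (insert m' S)"
      proof (cases f)
        case False
        then show ?thesis using f0 tu sub gG by auto
      next
        case True
        have gm: "g ** m' = axial (t * s) u False"
          using True by (simp add: tu m'_def axial_mult)
        have "axial_index (t * s) u" using tu m(1) by (auto simp: axial_index_def)
        then have "g ** m' \<in> generate O3 (insert m' S)"
          using f0 sub gm subgroup_O3D(3)[OF G' gG mG] by auto
        moreover have "m' \<in> generate O3 (insert m' S)" by (rule generate.incl) simp
        ultimately have "(g ** m') ** m' \<in> generate O3 (insert m' S)" by (rule D(3))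
        then show ?thesis by (simp add: matrix_mul_assoc[symmetric] mm)
      qed
    qed
  qed
  then show ?thesis
    using conj_class_conj_set[OF q, of G] by (simp add: G'_def m'_def)
qed

text \<open>An induction rule for generated groups, in terms of indices. The conjugation of
  \<open>w\<close> in the product rule is the semidirect product law of \<open>axial_mult\<close>: a
  flip inverts the rotation to its right.\<close>

lemma generate_axial:
  assumes S: "\<And>g. g \<in> S \<Longrightarrow> \<exists>s z f. axial_index s z \<and> C s z f \<and> g = axial s z f"
    and one: "C 1 1 False"
    and mult: "\<And>s z f t w g. axial_index s z \<Longrightarrow> axial_index t w \<Longrightarrow> C s z f \<Longrightarrow> C t w g \<Longrightarrow>
        C (s * t) (z * (if f then cnj w else w)) (f \<noteq> g)"
    and inv: "\<And>s z f. axial_index s z \<Longrightarrow> C s z f \<Longrightarrow> C s (if f then z else cnj z) f"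
    and g: "g \<in> generate O3 S"
  shows "\<exists>s z f. axial_index s z \<and> C s z f \<and> g = axial s z f"
proof -
  let ?W = "{g. \<exists>s z f. axial_index s z \<and> C s z f \<and> g = axial s z f}"
  have "subgroup ?W O3"
  proof (rule subgroup_O3I)
    show "orthogonal_matrix g" if "g \<in> ?W" for g using that orthogonal_axial by blast
    show "mat 1 \<in> ?W"
      using one by (auto intro!: exI[of _ 1] exI[of _ False] simp: axial_one axial_index_def)
    show "g ** h \<in> ?W" if gh: "g \<in> ?W" "h \<in> ?W" for g h
    proof -
      obtain s z f where 1: "axial_index s z" "C s z f" "g = axial s z f" using gh(1) by blast
      obtain t w f' where 2: "axial_index t w" "C t w f'" "h = axial t w f'" using gh(2) by blast
      note * = 1 2
      have "g ** h = axial (s * t) (z * (if f then cnj w else w)) (f \<noteq> f')" by (simp add: * axial_mult)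
      moreover have "C (s * t) (z * (if f then cnj w else w)) (f \<noteq> f')" using * by (intro mult)
      moreover have "axial_index (s * t) (z * (if f then cnj w else w))" using * by (intro axial_index_mult)
      ultimately show ?thesis by blast
    qed
    show "transpose g \<in> ?W" if gW: "g \<in> ?W" for g
    proof -
      obtain s z f where *: "axial_index s z" "C s z f" "g = axial s z f" using gW by blast
      have "transpose g = axial s (if f then z else cnj z) f" by (simp add: * axial_transpose)
      moreover have "C s (if f then z else cnj z) f" using * by (intro inv)
      moreover have "axial_index s (if f then z else cnj z)" using * axial_index_cnj by simp
      ultimately show ?thesis by blast
    qed
  qed
  then have "generate O3 S \<subseteq> ?W" by (rule generate_subset) (use S in blast)
  then show ?thesis using g by blast
qed

subsection \<open>Separating the conjugacy classes\<close>

text \<open>Which pairs (determinant, trace) occur in a group is invariant under conjugation and separates the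
  sixteen classes, except that \<open>Z 2\<close> from \<open>D 2\<close> and \<open>SO2\<close> from \<open>O2\<close> differ only in the number of half turns.\<close>

definition has_det_trace :: "(real^3^3) set \<Rightarrow> real \<Rightarrow> real \<Rightarrow> bool" where
  "has_det_trace H d t \<longleftrightarrow> (\<exists>h\<in>H. det h = d \<and> trace h = t)"

definition two_half_turns :: "(real^3^3) set \<Rightarrow> bool" where
  "two_half_turns H \<longleftrightarrow> (\<exists>g\<in>H. \<exists>h\<in>H. g \<noteq> h \<and> det g = 1 \<and> det h = 1 \<and> trace g = -1 \<and> trace h = -1)"

text \<open>The entries test for a third turn, a half turn, a reflection, a rotoreflection by a
  quarter turn, a sixth turn, and two half turns. Within the list a sixth turn marks the infinite
  groups.\<close>

definition profile :: "(real^3^3) set \<Rightarrow> bool \<times> bool \<times> bool \<times> bool \<times> bool \<times> bool" where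
  "profile H = (has_det_trace H 1 0, has_det_trace H 1 (-1), has_det_trace H (-1) 1,
     has_det_trace H (-1) (-1), has_det_trace H 1 2, two_half_turns H)"

lemma det_trace_conj:
  fixes q :: "real^3^3"
  assumes "orthogonal_matrix q"
  shows "det (q ** h ** transpose q) = det h" "trace (q ** h ** transpose q) = trace h"
proof -
  have "det q * det q = 1" using det_orthogonal_matrix[OF assms] by auto
  then show "det (q ** h ** transpose q) = det h" by (simp add: det_mul)
  show "trace (q ** h ** transpose q) = trace h"
    using assms trace_mul_sym[of "q ** h" "transpose q"] by simp
qed

lemma profile_conj_set:
  assumes q: "orthogonal_matrix q"
  shows "profile (conj_set q H) = profile H"
proof -
  have inj: "q ** g ** transpose q = q ** h ** transpose q \<longleftrightarrow> g = h" for g h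
  proof
    assume "q ** g ** transpose q = q ** h ** transpose q"
    then have "transpose q ** (q ** g ** transpose q) ** q = transpose q ** (q ** h ** transpose q) ** q"
      by simp
    then show "g = h" using q by (simp add: matrix_mul_assoc[symmetric])
  qed simp
  show ?thesis
    by (simp add: profile_def has_det_trace_def two_half_turns_def conj_set_def det_trace_conj[OF q] inj)
qed

lemma profile_eq_if_conj_class_eq: "conj_class H = conj_class H' \<Longrightarrow> profile H = profile H'"
  by (metis conj_class_eqD profile_conj_set)

lemma has_det_traceI:
  assumes "axial s z f \<in> H" "axial_index s z" "d = s" "t = (if f then - s else s * (1 + 2 * Re z))"
  shows "has_det_trace H d t"
  using assms det_axial trace_axial unfolding has_det_trace_def by metis

lemma two_half_turnsI:
  assumes "axial 1 z f \<in> H" "axial_index 1 z" "f \<or> z = -1" "axial 1 w True \<in> H" "axial_index 1 w" "f \<noteq> True \<or> z \<noteq> w"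
  shows "two_half_turns H"
proof -
  have "axial 1 z f \<noteq> axial 1 w True" using assms by (auto simp: axial_eq_iff)
  moreover have "trace (axial 1 z f) = -1" using assms by (auto simp: trace_axial)
  moreover have "trace (axial 1 w True) = -1" by (simp add: trace_axial)
  ultimately show ?thesis
    using assms det_axial unfolding two_half_turns_def by blast
qed

text \<open>The traces in \<open>profile\<close> prescribe Re z as -1, -1/2, 0 or 1/2, that is, z as
  a primitive root of unity of order 2, 3, 4 or 6. These are compared with the equations that
  describe the listed groups.\<close>

lemma unit_Re_cases:
  assumes "cmod z = 1"
  shows "Re z = -1 \<Longrightarrow> z = -1"
    "Re z = 0 \<Longrightarrow> z\<^sup>2 = -1" "Re z = 0 \<Longrightarrow> z^3 \<noteq> 1" "Re z = 0 \<Longrightarrow> z^3 \<noteq> -1"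
    "Re z = -1/2 \<Longrightarrow> z^3 = 1" "Re z = -1/2 \<Longrightarrow> z\<^sup>2 \<noteq> 1" "Re z = -1/2 \<Longrightarrow> z\<^sup>2 \<noteq> -1"
    "Re z = 1/2 \<Longrightarrow> z^3 = -1" "Re z = 1/2 \<Longrightarrow> z\<^sup>2 \<noteq> 1" "Re z = 1/2 \<Longrightarrow> z\<^sup>2 \<noteq> -1"
proof -
  have n: "(Re z)\<^sup>2 + (Im z)\<^sup>2 = 1" using assms by (simp add: cmod_1_Re_Im)
  have e: "Re (z\<^sup>2) = (Re z)\<^sup>2 - (Im z)\<^sup>2" "Im (z\<^sup>2) = 2 * Re z * Im z"
    "Re (z^3) = (Re z)^3 - 3 * Re z * (Im z)\<^sup>2" "Im (z^3) = Im z * (3 * (Re z)\<^sup>2 - (Im z)\<^sup>2)"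
    by (simp_all add: power2_eq_square power3_eq_cube algebra_simps)
  show "Re z = -1 \<Longrightarrow> z = -1" using n by (simp add: complex_eq_iff)
  show "Re z = 0 \<Longrightarrow> z\<^sup>2 = -1" using n by (simp add: complex_eq_iff e)
  show "Re z = 0 \<Longrightarrow> z^3 \<noteq> 1" "Re z = 0 \<Longrightarrow> z^3 \<noteq> -1" using n by (auto simp: complex_eq_iff e)
  have "(Im z)\<^sup>2 = 3/4" if "Re z = -1/2 \<or> Re z = 1/2"
  proof -
    have "(Re z)\<^sup>2 = 1/4" using that by (auto simp only: power2_eq_square)
    then show ?thesis using n by simp
  qed
  note i = this
  show "z^3 = 1" if r: "Re z = -1/2" 
    unfolding complex_eq_iff e r i[OF disjI1[OF r]] by (simp add: power3_eq_cube power2_eq_square)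
  show "z^3 = -1" if r: "Re z = 1/2"
    unfolding complex_eq_iff e r i[OF disjI2[OF r]] by (simp add: power3_eq_cube power2_eq_square)
  have "Re (z\<^sup>2) = -1/2" if "Re z = -1/2 \<or> Re z = 1/2"
    using n i[OF that] unfolding e by simp
  then show "Re z = -1/2 \<Longrightarrow> z\<^sup>2 \<noteq> 1" "Re z = -1/2 \<Longrightarrow> z\<^sup>2 \<noteq> -1"
     "Re z = 1/2 \<Longrightarrow> z\<^sup>2 \<noteq> 1" "Re z = 1/2 \<Longrightarrow> z\<^sup>2 \<noteq> -1"
    by fastforce+
qed

text \<open>A group of axial matrices is described by the pairs \<open>(s, z)\<close> of its elements \<open>axial s z False\<close>;
  in \<open>dihedral_axial C \<sigma>\<close> these are joined by their products with \<open>axial \<sigma> 1 True\<close>.\<close>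

definition cyclic_axial :: "(real \<Rightarrow> complex \<Rightarrow> bool) \<Rightarrow> (real^3^3) set" where
  "cyclic_axial C = {axial s z False | s z. axial_index s z \<and> C s z}"

definition dihedral_axial :: "(real \<Rightarrow> complex \<Rightarrow> bool) \<Rightarrow> real \<Rightarrow> (real^3^3) set" where
  "dihedral_axial C \<sigma> = cyclic_axial C \<union> {axial (\<sigma> * s) z True | s z. axial_index s z \<and> C s z}"

text \<open>On the unit circle \<open>cnj z\<close> is the inverse of \<open>z\<close>, and a sign
  is its own inverse. Closure under \<open>cnj\<close> is also what lets a flip normalize the
  group.\<close>

definition index_group :: "(real \<Rightarrow> complex \<Rightarrow> bool) \<Rightarrow> bool" where
  "index_group C \<longleftrightarrow> C 1 1 \<and>
    (\<forall>s z t w. axial_index s z \<longrightarrow> axial_index t w \<longrightarrow> C s z \<longrightarrow> C t w \<longrightarrow> C (s * t) (z * w)) \<and>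
    (\<forall>s z. axial_index s z \<longrightarrow> C s z \<longrightarrow> C s (cnj z))"

lemma index_groupD:
  assumes "index_group C"
  shows "C 1 1"
    "axial_index s z \<Longrightarrow> axial_index t w \<Longrightarrow> C s z \<Longrightarrow> C t w \<Longrightarrow> C (s * t) (z * w)"
    "axial_index s z \<Longrightarrow> C s z \<Longrightarrow> C s (cnj z)"
  using assms unfolding index_group_def by blast+

lemma generate_cyclic_axial:
  assumes C: "index_group C" and S: "S \<subseteq> cyclic_axial C"
    and gen: "\<And>s z. axial_index s z \<Longrightarrow> C s z \<Longrightarrow> axial s z False \<in> generate O3 S"
  shows "generate O3 S = cyclic_axial C"
proof
  show "cyclic_axial C \<subseteq> generate O3 S" using gen by (auto simp: cyclic_axial_def)
  have up: "\<exists>s z f. axial_index s z \<and> (\<not> f \<and> C s z) \<and> g = axial s z f" if "g \<in> generate O3 S" for g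
  proof (rule generate_axial[where C = "\<lambda>s z f. \<not> f \<and> C s z", OF _ _ _ _ that])
    show "\<exists>s z f. axial_index s z \<and> (\<not> f \<and> C s z) \<and> g = axial s z f" if "g \<in> S" for g
      using S that unfolding cyclic_axial_def by blast
  qed (use index_groupD[OF C] in auto)
  show "generate O3 S \<subseteq> cyclic_axial C"
  proof
    fix g assume "g \<in> generate O3 S"
    from up[OF this] obtain s z where "axial_index s z" "C s z" "g = axial s z False" by auto
    then show "g \<in> cyclic_axial C" unfolding cyclic_axial_def by blast
  qed
qed

lemma generate_dihedral_axial:
  assumes C: "index_group C" and S: "S \<subseteq> cyclic_axial C" and \<sigma>: "\<sigma> = 1 \<or> \<sigma> = -1"
    and gen: "\<And>s z. axial_index s z \<Longrightarrow> C s z \<Longrightarrow> axial s z False \<in> generate O3 S"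
  shows "generate O3 (insert (axial \<sigma> 1 True) S) = dihedral_axial C \<sigma>"
proof
  \<comment> \<open>A flipped element is an unflipped one times
    \<open>axial \<sigma> 1 True\<close>; its sign must be corrected by \<sigma> before it is tested
    with \<open>C\<close>.\<close>
  let ?C = "\<lambda>s z f. C (if f then \<sigma> * s else s) z"
  have ss: "\<sigma> * \<sigma> = 1" "\<And>x. \<sigma> * (\<sigma> * x) = x" using \<sigma> by auto
  have ai: "axial_index (\<sigma> * s) z \<longleftrightarrow> axial_index s z" for s z using \<sigma> by (auto simp: axial_index_def)
  have "\<exists>s z f. axial_index s z \<and> ?C s z f \<and> g = axial s z f"
    if "g \<in> generate O3 (insert (axial \<sigma> 1 True) S)" for g
  proof (rule generate_axial[where C = ?C, OF _ _ _ _ that])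
    show "\<exists>s z f. axial_index s z \<and> ?C s z f \<and> g = axial s z f" if "g \<in> insert (axial \<sigma> 1 True) S" for g
    proof (cases "g = axial \<sigma> 1 True")
      case True
      then show ?thesis using \<sigma> index_groupD(1)[OF C] ss
        by (intro exI[of _ \<sigma>] exI[of _ 1] exI[of _ True]) (auto simp: axial_index_def)
    next
      case False
      then have "g \<in> cyclic_axial C" using that S by auto
      then obtain s z where "g = axial s z False" "axial_index s z" "C s z" by (auto simp: cyclic_axial_def)
      then show ?thesis by (intro exI[of _ s] exI[of _ z] exI[of _ False]) simp
    qed
    show "?C 1 1 False" using index_groupD(1)[OF C] by simp
    show "?C (s * t) (z * (if f then cnj w else w)) (f \<noteq> g)"
      if "axial_index s z" "axial_index t w" "?C s z f" "?C t w g" for s z f t w g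
    proof -
      have "C ((if f then \<sigma> * s else s) * (if g then \<sigma> * t else t)) (z * (if f then cnj w else w))"
        using that ai by (intro index_groupD(2)[OF C]) (auto intro: index_groupD(3)[OF C] axial_index_cnj)
      moreover have "\<sigma> * s * (\<sigma> * t) = s * t" "\<sigma> * s * t = \<sigma> * (s * t)" "s * (\<sigma> * t) = \<sigma> * (s * t)"
        using ss(1) by (auto simp: algebra_simps)
      ultimately show ?thesis by (cases f; cases g) (simp_all only: if_True if_False simp_thms)
    qed
    show "?C s (if f then z else cnj z) f" if "axial_index s z" "?C s z f" for s z f
      using that index_groupD(3)[OF C] by (cases f) simp_all
  qed
  then show "generate O3 (insert (axial \<sigma> 1 True) S) \<subseteq> dihedral_axial C \<sigma>"
  proof (intro subsetI)
    fix g assume "g \<in> generate O3 (insert (axial \<sigma> 1 True) S)"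
    then obtain s z f where *: "axial_index s z" "?C s z f" "g = axial s z f"
      using \<open>\<And>g. g \<in> generate O3 (insert (axial \<sigma> 1 True) S) \<Longrightarrow> _ g\<close> by blast
    show "g \<in> dihedral_axial C \<sigma>"
    proof (cases f)
      case True
      then have "g = axial (\<sigma> * (\<sigma> * s)) z True" "axial_index (\<sigma> * s) z" "C (\<sigma> * s) z"
        using * by (simp_all add: ss ai)
      then show ?thesis unfolding dihedral_axial_def by blast
    next
      case False
      then have "g = axial s z False" "C s z" using * by simp_all
      then show ?thesis using * unfolding dihedral_axial_def cyclic_axial_def by blast
    qed
  qed
  have "subgroup (generate O3 (insert (axial \<sigma> 1 True) S)) O3"
  proof (rule subgroup_generate)
    fix g assume "g \<in> insert (axial \<sigma> 1 True) S"
    then show "orthogonal_matrix g"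
      using S \<sigma> by (auto simp: cyclic_axial_def axial_index_def intro!: orthogonal_axial)
  qed
  note D = subgroup_O3D[OF this]
  have sub: "generate O3 S \<subseteq> generate O3 (insert (axial \<sigma> 1 True) S)"
    by (rule group.mono_generate[OF group_O3]) auto
  have "axial (\<sigma> * s) z True \<in> generate O3 (insert (axial \<sigma> 1 True) S)" if "axial_index s z" "C s z" for s z
  proof -
    have "axial s z False ** axial \<sigma> 1 True \<in> generate O3 (insert (axial \<sigma> 1 True) S)"
      using gen[OF that] sub by (intro D(3)) (auto intro: generate.incl)
    then show ?thesis by (simp add: axial_mult mult.commute)
  qed
  then show "dihedral_axial C \<sigma> \<subseteq> generate O3 (insert (axial \<sigma> 1 True) S)"
    using gen sub by (auto simp: dihedral_axial_def cyclic_axial_def)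
qed

lemma profile_cyclic_axial:
  "profile (cyclic_axial C) =
    (\<exists>z. cmod z = 1 \<and> Re z = -1/2 \<and> C 1 z, C 1 (-1), C (-1) (-1),
     \<exists>z. cmod z = 1 \<and> Re z = 0 \<and> C (-1) z, \<exists>z. cmod z = 1 \<and> Re z = 1/2 \<and> C 1 z, False)"
proof -
  have H: "has_det_trace (cyclic_axial C) d t \<longleftrightarrow> (\<exists>z. axial_index d z \<and> C d z \<and> d * (1 + 2 * Re z) = t)" for d t
  proof -
    have "has_det_trace (cyclic_axial C) d t \<longleftrightarrow>
      (\<exists>s z. axial_index s z \<and> C s z \<and> det (axial s z False) = d \<and> trace (axial s z False) = t)"
      by (auto simp: has_det_trace_def cyclic_axial_def)
    also have "\<dots> \<longleftrightarrow> (\<exists>z. axial_index d z \<and> C d z \<and> d * (1 + 2 * Re z) = t)"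
      by (auto simp: det_axial trace_axial intro!: exI[of _ d])
    finally show ?thesis .
  qed
  have "\<not> two_half_turns (cyclic_axial C)"
  proof
    assume "two_half_turns (cyclic_axial C)"
    then obtain s z t w where *: "axial_index s z" "axial_index t w" "axial s z False \<noteq> axial t w False"
      "det (axial s z False) = 1" "det (axial t w False) = 1"
      "trace (axial s z False) = -1" "trace (axial t w False) = -1"
      unfolding two_half_turns_def cyclic_axial_def by auto
    then show False
      using unit_Re_cases(1)[of z] unit_Re_cases(1)[of w]
      by (auto simp: det_axial trace_axial axial_index_def)
  qed
  moreover have "(\<exists>z. axial_index 1 z \<and> C 1 z \<and> 1 + 2 * Re z = -1) = C 1 (-1)"
    using unit_Re_cases(1) by (force simp: axial_index_def)
  moreover have "(\<exists>z. axial_index (-1) z \<and> C (-1) z \<and> -1 - 2 * Re z = 1) = C (-1) (-1)"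
    using unit_Re_cases(1) by (force simp: axial_index_def)
  moreover have "1 + 2 * Re z = 0 \<longleftrightarrow> Re z = -1/2" "-1 - 2 * Re z = -1 \<longleftrightarrow> Re z = 0" "1 + 2 * Re z = 2 \<longleftrightarrow> Re z = 1/2"
    for z by auto
  ultimately show ?thesis
    by (simp add: profile_def H axial_index_def conj_ac cong: conj_cong)
qed

text \<open>A flipped matrix of determinant t has trace -t: it is a half turn about a horizontal
  axis or a reflection in a vertical plane. By \<open>tw\<close> all flipped elements are
  reflections when \<sigma> = -1, so that only the half turn about \<open>e3\<close> can
  remain.\<close>

lemma profile_dihedral_axial:
  assumes \<sigma>: "\<sigma> = 1 \<or> \<sigma> = -1" and C: "C 1 1"
    and tw: "\<sigma> = 1 \<or> (\<forall>z. \<not> C (-1) z)"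
  shows "profile (dihedral_axial C \<sigma>) =
    (\<exists>z. cmod z = 1 \<and> Re z = -1/2 \<and> C 1 z, \<sigma> = 1 \<or> C 1 (-1),
     \<sigma> = -1 \<or> (\<exists>z. cmod z = 1 \<and> C (-1) z),
     \<exists>z. cmod z = 1 \<and> Re z = 0 \<and> C (-1) z, \<exists>z. cmod z = 1 \<and> Re z = 1/2 \<and> C 1 z,
     \<sigma> = 1 \<and> (\<exists>z. cmod z = 1 \<and> z \<noteq> 1 \<and> C 1 z))"
proof -
  let ?H = "dihedral_axial C \<sigma>"
  have ai: "axial_index (\<sigma> * s) z \<longleftrightarrow> axial_index s z" for s z using \<sigma> by (auto simp: axial_index_def)
  have H: "has_det_trace ?H d t \<longleftrightarrow> has_det_trace (cyclic_axial C) d t \<or>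
      (\<exists>s z. axial_index s z \<and> C s z \<and> \<sigma> * s = d \<and> - (\<sigma> * s) = t)" for d t
  proof -
    have "has_det_trace ?H d t \<longleftrightarrow> has_det_trace (cyclic_axial C) d t \<or>
      (\<exists>s z. axial_index s z \<and> C s z \<and> det (axial (\<sigma> * s) z True) = d \<and> trace (axial (\<sigma> * s) z True) = t)"
      by (auto simp: has_det_trace_def dihedral_axial_def)
    then show ?thesis using ai by (simp add: det_axial trace_axial cong: conj_cong)
  qed
  have two: "two_half_turns ?H \<longleftrightarrow> \<sigma> = 1 \<and> (\<exists>z. cmod z = 1 \<and> z \<noteq> 1 \<and> C 1 z)"
  proof
    assume "\<sigma> = 1 \<and> (\<exists>z. cmod z = 1 \<and> z \<noteq> 1 \<and> C 1 z)"
    then obtain z where z: "\<sigma> = 1" "cmod z = 1" "z \<noteq> 1" "C 1 z" by blast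
    then have "axial 1 1 True \<in> ?H" "axial 1 z True \<in> ?H"
      using C unfolding dihedral_axial_def axial_index_def by force+
    then show "two_half_turns ?H"
      using z by (intro two_half_turnsI[of z True _ 1]) (auto simp: axial_index_def)
  next
    assume "two_half_turns ?H"
    then obtain g h where gh: "g \<in> ?H" "h \<in> ?H" "g \<noteq> h" "det g = 1" "det h = 1" "trace g = -1" "trace h = -1"
      unfolding two_half_turns_def by blast
    have cases: "k = axial 1 (-1) False \<and> C 1 (-1) \<or> (\<exists>z. cmod z = 1 \<and> k = axial 1 z True \<and> C \<sigma> z)"
      if k: "k \<in> ?H" "det k = 1" "trace k = -1" for k
    proof (cases "k \<in> cyclic_axial C")
      case True
      then show ?thesis using k(2,3) unit_Re_cases(1)
        by (auto simp: cyclic_axial_def det_axial trace_axial axial_index_def)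
    next
      case False
      then obtain s z where *: "axial_index s z" "C s z" "k = axial (\<sigma> * s) z True"
        using k by (auto simp: dihedral_axial_def)
      then have "\<sigma> * s = 1" using k(2) ai det_axial by metis
      moreover then have "s = \<sigma>" using \<sigma> * by (auto simp: axial_index_def)
      ultimately show ?thesis using * by (auto simp: axial_index_def)
    qed
    note cg = cases[OF gh(1,4,6)] and ch = cases[OF gh(2,5,7)]
    have "\<sigma> = 1"
    proof (rule ccontr)
      assume "\<sigma> \<noteq> 1"
      then have "\<not> C \<sigma> z" for z using \<sigma> tw by auto
      then show False using cg ch gh(3) by auto
    qed
    moreover have "\<exists>z. cmod z = 1 \<and> z \<noteq> 1 \<and> C 1 z"
    proof (cases "C 1 (-1)")
      case True
      then show ?thesis by (intro exI[of _ "-1"]) auto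
    next
      case False
      then show ?thesis using cg ch gh(3) \<open>\<sigma> = 1\<close> by auto
    qed
    ultimately show "\<sigma> = 1 \<and> (\<exists>z. cmod z = 1 \<and> z \<noteq> 1 \<and> C 1 z)" by blast
  qed
  have p: "(has_det_trace (cyclic_axial C) 1 0) = (\<exists>z. cmod z = 1 \<and> Re z = -1/2 \<and> C 1 z)"
    "has_det_trace (cyclic_axial C) 1 (-1) = C 1 (-1)" "has_det_trace (cyclic_axial C) (-1) 1 = C (-1) (-1)"
    "has_det_trace (cyclic_axial C) (-1) (-1) = (\<exists>z. cmod z = 1 \<and> Re z = 0 \<and> C (-1) z)"
    "has_det_trace (cyclic_axial C) 1 2 = (\<exists>z. cmod z = 1 \<and> Re z = 1/2 \<and> C 1 z)"
    using profile_cyclic_axial[of C] by (simp_all add: profile_def)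
  have E: "(\<exists>s z. axial_index s z \<and> C s z \<and> \<sigma> * s = d \<and> - (\<sigma> * s) = t) \<longleftrightarrow>
      t = - d \<and> (d = 1 \<or> d = -1) \<and> (\<exists>z. cmod z = 1 \<and> C (\<sigma> * d) z)" for d t
    using \<sigma> unfolding axial_index_def by (elim disjE) (auto intro!: exI[of _ "\<sigma> * d"])
  have ex: "\<exists>z. cmod z = 1 \<and> C 1 z" using C by (intro exI[of _ 1]) simp
  have absorb: "C (-1) (-1) \<Longrightarrow> \<exists>z. cmod z = 1 \<and> C (-1) z" by (intro exI[of _ "-1"]) simp
  show ?thesis
    using \<sigma>
  proof
    assume "\<sigma> = 1"
    then show ?thesis
      unfolding profile_def H two p E prod.inject using ex absorb by simp blast
  next
    assume s: "\<sigma> = -1"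
    then have "\<not> C (-1) z" for z using tw by auto
    then show ?thesis unfolding profile_def H two p E prod.inject using ex s by simp
  qed
qed

section \<open>The listed groups in terms of indices\<close>

lemma index_groups:
  "index_group (\<lambda>s z. s = 1 \<and> z = 1)"
  "index_group (\<lambda>s z. s = 1 \<and> z ^ n = 1)"
  "index_group (\<lambda>s z. z = of_real s)"
  "index_group (\<lambda>s z. z ^ n = of_real s)"
  "index_group (\<lambda>s z. s = 1)"
  by (auto simp: index_group_def power_mult_distrib simp flip: complex_cnj_power)

lemma square_eq_cases:
  fixes z :: complex
  shows "z\<^sup>2 = 1 \<longleftrightarrow> z = 1 \<or> z = -1" "z\<^sup>2 = -1 \<longleftrightarrow> z = \<i> \<or> z = - \<i>"
proof -
  show "z\<^sup>2 = 1 \<longleftrightarrow> z = 1 \<or> z = -1" by (rule power2_eq_1_iff)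
  have "z\<^sup>2 = -1 \<longleftrightarrow> (z - \<i>) * (z + \<i>) = 0" by (simp add: algebra_simps power2_eq_square) (metis add_eq_0_iff add.commute)
  then show "z\<^sup>2 = -1 \<longleftrightarrow> z = \<i> \<or> z = - \<i>" by (simp add: add_eq_0_iff2)
qed

definition \<omega> :: complex where "\<omega> = cis (2 * pi / 3)"

lemma Re_Im_\<omega>: "Re \<omega> = -1/2" "Im \<omega> = sqrt 3 / 2"
  by (simp_all add: \<omega>_def cos_120 sin_120)

lemma \<omega>_power: "\<omega> ^ 3 = 1" "\<omega> * \<omega> = - 1 - \<omega>" "cmod \<omega> = 1"
proof -
  show "cmod \<omega> = 1" by (simp add: \<omega>_def)
  then show "\<omega> ^ 3 = 1" by (rule unit_Re_cases) (simp add: Re_Im_\<omega>)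
  show "\<omega> * \<omega> = - 1 - \<omega>" by (simp add: complex_eq_iff Re_Im_\<omega>)
qed

lemma cube_eq_cases:
  fixes z :: complex
  shows "z^3 = 1 \<longleftrightarrow> z = 1 \<or> z = \<omega> \<or> z = \<omega>\<^sup>2" "z^3 = -1 \<longleftrightarrow> z = -1 \<or> z = -\<omega> \<or> z = -\<omega>\<^sup>2"
proof -
  have *: "z^3 = 1 \<longleftrightarrow> z = 1 \<or> z = \<omega> \<or> z = \<omega>\<^sup>2" for z
  proof -
    have "z^3 - 1 = (z - 1) * (z - \<omega>) * (z - \<omega>\<^sup>2)"
      using \<omega>_power(1,2) unfolding power2_eq_square power3_eq_cube by algebra
    then have "z^3 = 1 \<longleftrightarrow> (z - 1) * (z - \<omega>) * (z - \<omega>\<^sup>2) = 0" by (metis eq_iff_diff_eq_0)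
    then show ?thesis by simp
  qed
  show "z^3 = 1 \<longleftrightarrow> z = 1 \<or> z = \<omega> \<or> z = \<omega>\<^sup>2" by (rule *)
  have "z^3 = -1 \<longleftrightarrow> (-z)^3 = 1" by (simp add: power3_eq_cube) (metis minus_equation_iff)
  then show "z^3 = -1 \<longleftrightarrow> z = -1 \<or> z = -\<omega> \<or> z = -\<omega>\<^sup>2"
    unfolding * by (metis minus_minus)
qed

lemma cis_pi_3: "cis (pi / 3) = - \<omega>\<^sup>2"
  by (simp add: complex_eq_iff power2_eq_square Re_Im_\<omega> cos_60 sin_60)

lemma generate_axial_closed:
  assumes "S \<subseteq> {g. orthogonal_matrix g}"
  shows "axial 1 1 False \<in> generate O3 S"
    "axial s z f \<in> generate O3 S \<Longrightarrow> axial t w g \<in> generate O3 S \<Longrightarrow>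
      axial (s * t) (z * (if f then cnj w else w)) (f \<noteq> g) \<in> generate O3 S"
proof -
  have "subgroup (generate O3 S) O3" by (rule subgroup_generate) (use assms in auto)
  note D = subgroup_O3D[OF this]
  show "axial 1 1 False \<in> generate O3 S" using D(2) by (simp add: axial_one)
  show "axial s z f \<in> generate O3 S \<Longrightarrow> axial t w g \<in> generate O3 S \<Longrightarrow>
      axial (s * t) (z * (if f then cnj w else w)) (f \<noteq> g) \<in> generate O3 S"
    using D(3) axial_mult by metis
qed

lemma generate_half_turn:
  assumes "axial_index s z" "s = 1 \<and> z^2 = 1"
  shows "axial s z False \<in> generate O3 {axial 1 (-1) False}"
proof -
  have o: "{axial 1 (-1) False} \<subseteq> {g. orthogonal_matrix g}"
    by (auto intro!: orthogonal_axial simp: axial_index_def)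
  then show ?thesis
    using assms generate_axial_closed(1)[OF o] by (auto simp: square_eq_cases intro: generate.incl)
qed

lemma generate_third_turn:
  assumes "axial_index s z" "s = 1 \<and> z^3 = 1"
  shows "axial s z False \<in> generate O3 {axial 1 \<omega> False}"
proof -
  let ?S = "{axial 1 \<omega> False}"
  have o: "?S \<subseteq> {g. orthogonal_matrix g}"
    using \<omega>_power by (auto intro!: orthogonal_axial simp: axial_index_def)
  have 1: "axial 1 \<omega> False \<in> generate O3 ?S" by (auto intro: generate.incl)
  have "axial 1 (\<omega>\<^sup>2) False \<in> generate O3 ?S"
    using generate_axial_closed(2)[OF o 1 1] by (simp add: power2_eq_square)
  then show ?thesis
    using assms 1 generate_axial_closed(1)[OF o] by (auto simp: cube_eq_cases)
qed

lemma generate_rotoreflection_4: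
  assumes "axial_index s z" "z^2 = of_real s"
  shows "axial s z False \<in> generate O3 {axial (-1) \<i> False}"
proof -
  let ?S = "{axial (-1) \<i> False}"
  have o: "?S \<subseteq> {g. orthogonal_matrix g}"
    by (auto intro!: orthogonal_axial simp: axial_index_def)
  note cl = generate_axial_closed[OF o]
  have 1: "axial (-1) \<i> False \<in> generate O3 ?S" by (auto intro: generate.incl)
  have 2: "axial 1 (-1) False \<in> generate O3 ?S" using cl(2)[OF 1 1] by simp
  have 3: "axial (-1) (-\<i>) False \<in> generate O3 ?S" using cl(2)[OF 1 2] by simp
  show ?thesis
    using assms 1 2 3 cl(1) by (auto simp: square_eq_cases axial_index_def)
qed

lemma generate_rotoreflection_6:
  assumes "axial_index s z" "z^3 = of_real s"
  shows "axial s z False \<in> generate O3 {axial (-1) (-\<omega>\<^sup>2) False}"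
proof -
  let ?S = "{axial (-1) (-\<omega>\<^sup>2) False}"
  have o: "?S \<subseteq> {g. orthogonal_matrix g}"
    using \<omega>_power(3) by (auto intro!: orthogonal_axial simp: axial_index_def norm_power)
  note cl = generate_axial_closed[OF o]
  have w3: "\<omega> * \<omega> * \<omega> = 1" using \<omega>_power(1) by (simp add: power3_eq_cube)
  then have w4: "\<omega> * \<omega> * (\<omega> * \<omega>) = \<omega>" by (simp flip: mult.assoc)
  have 1: "axial (-1) (-(\<omega> * \<omega>)) False \<in> generate O3 ?S" by (auto intro: generate.incl simp: power2_eq_square)
  \<comment> \<open>The generator has order 6. Facts 2, 3, 4 and 5 are its powers with these
    exponents; the square is a third turn, and the cube is the reflection
    \<open>reflection e3\<close>.\<close>
  have 2: "axial 1 \<omega> False \<in> generate O3 ?S" using cl(2)[OF 1 1] w4 by simp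
  have 3: "axial (-1) (-1) False \<in> generate O3 ?S" using cl(2)[OF 1 2] w3 by simp
  have 4: "axial 1 (\<omega> * \<omega>) False \<in> generate O3 ?S" using cl(2)[OF 2 2] by simp
  have 5: "axial (-1) (-\<omega>) False \<in> generate O3 ?S" using cl(2)[OF 3 2] by simp
  show ?thesis
    using assms 1 2 3 4 5 cl(1) by (auto simp: cube_eq_cases axial_index_def power2_eq_square)
qed

lemma generators:
  "rot e3 (2 * pi / real 2) = axial 1 (-1) False" "rot e3 (2 * pi / real 3) = axial 1 \<omega> False"
  "- rot e3 (pi / real 2) = axial (-1) \<i> False" "- rot e3 (pi / real 3) = axial (-1) (-\<omega>\<^sup>2) False"
  unfolding minus_rot_e3 by (simp_all add: rot_e3 \<omega>_def[symmetric] cis_pi_3)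

lemma SO2_eq: "SO2 = cyclic_axial (\<lambda>s z. s = 1)"
proof -
  have "\<exists>\<theta>. z = cis \<theta>" if "cmod z = 1" for z
    using that by (metis cis_Arg sgn_eq div_by_1 norm_zero of_real_1 zero_neq_one)
  then show ?thesis
    by (force simp: SO2_def rot_e3 cyclic_axial_def axial_index_def)
qed

lemma subset_cyclic: "axial_index s z \<Longrightarrow> C s z \<Longrightarrow> {axial s z False} \<subseteq> cyclic_axial C"
  by (auto simp: cyclic_axial_def)

lemma cyclic_groups:
  "Triv = cyclic_axial (\<lambda>s z. s = 1 \<and> z = 1)"
  "Z 2 = cyclic_axial (\<lambda>s z. s = 1 \<and> z^2 = 1)"
  "Z 3 = cyclic_axial (\<lambda>s z. s = 1 \<and> z^3 = 1)"
  "Z2_minus = cyclic_axial (\<lambda>s z. z = of_real s)"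
  "Z2n_minus 2 = cyclic_axial (\<lambda>s z. z^2 = of_real s)"
proof -
  show "Triv = cyclic_axial (\<lambda>s z. s = 1 \<and> z = 1)"
    by (auto simp: Triv_def cyclic_axial_def axial_index_def axial_one)
  show "Z 2 = cyclic_axial (\<lambda>s z. s = 1 \<and> z^2 = 1)"
    unfolding Z_def generators
    by (rule generate_cyclic_axial[OF index_groups(2) subset_cyclic generate_half_turn])
       (auto simp: axial_index_def)
  show "Z 3 = cyclic_axial (\<lambda>s z. s = 1 \<and> z^3 = 1)"
    unfolding Z_def generators
    by (rule generate_cyclic_axial[OF index_groups(2) subset_cyclic generate_third_turn])
       (auto simp: axial_index_def \<omega>_power)
  show "Z2n_minus 2 = cyclic_axial (\<lambda>s z. z^2 = of_real s)"
    unfolding Z2n_minus_def generators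
    by (rule generate_cyclic_axial[OF index_groups(4) subset_cyclic generate_rotoreflection_4])
       (auto simp: axial_index_def)
  have o: "{axial (-1) (-1) False} \<subseteq> {g. orthogonal_matrix g}"
    by (auto intro!: orthogonal_axial simp: axial_index_def)
  show "Z2_minus = cyclic_axial (\<lambda>s z. z = of_real s)"
    unfolding Z2_minus_def reflection_e3
    by (rule generate_cyclic_axial[OF index_groups(3) subset_cyclic])
       (use generate_axial_closed(1)[OF o] in \<open>auto simp: axial_index_def intro: generate.incl\<close>)
qed

lemma dihedral_groups:
  "D 2 = dihedral_axial (\<lambda>s z. s = 1 \<and> z^2 = 1) 1"
  "D 3 = dihedral_axial (\<lambda>s z. s = 1 \<and> z^3 = 1) 1"
  "Dv 2 = dihedral_axial (\<lambda>s z. s = 1 \<and> z^2 = 1) (-1)"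
  "Dv 3 = dihedral_axial (\<lambda>s z. s = 1 \<and> z^3 = 1) (-1)"
  "D2n_h 2 = dihedral_axial (\<lambda>s z. z^2 = of_real s) 1"
  "D2n_h 3 = dihedral_axial (\<lambda>s z. z^3 = of_real s) 1"
  "O2 = dihedral_axial (\<lambda>s z. s = 1) 1"
  "O2_minus = dihedral_axial (\<lambda>s z. s = 1) (-1)"
proof -
  have w: "cmod \<omega> = 1" "\<omega>^3 = 1" by (simp_all add: \<omega>_power)
  have w6: "(- \<omega>\<^sup>2)^3 = -1"
  proof -
    have "(- \<omega>\<^sup>2)^3 = - ((\<omega>^3)^2)" by (simp flip: power_mult)
    then show ?thesis by (simp add: \<omega>_power)
  qed
  show "D 2 = dihedral_axial (\<lambda>s z. s = 1 \<and> z^2 = 1) 1"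
    unfolding D_def generators rot_e1_pi insert_commute[of "axial 1 (-1) False"]
    by (rule generate_dihedral_axial[OF index_groups(2) subset_cyclic _ generate_half_turn])
       (auto simp: axial_index_def)
  show "D 3 = dihedral_axial (\<lambda>s z. s = 1 \<and> z^3 = 1) 1"
    unfolding D_def generators rot_e1_pi insert_commute[of "axial 1 \<omega> False"]
    by (rule generate_dihedral_axial[OF index_groups(2) subset_cyclic _ generate_third_turn])
       (auto simp: axial_index_def w)
  show "Dv 2 = dihedral_axial (\<lambda>s z. s = 1 \<and> z^2 = 1) (-1)"
    unfolding Dv_def generators reflection_e1 insert_commute[of "axial 1 (-1) False"]
    by (rule generate_dihedral_axial[OF index_groups(2) subset_cyclic _ generate_half_turn])
       (auto simp: axial_index_def)
  show "Dv 3 = dihedral_axial (\<lambda>s z. s = 1 \<and> z^3 = 1) (-1)"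
    unfolding Dv_def generators reflection_e1 insert_commute[of "axial 1 \<omega> False"]
    by (rule generate_dihedral_axial[OF index_groups(2) subset_cyclic _ generate_third_turn])
       (auto simp: axial_index_def w)
  show "D2n_h 2 = dihedral_axial (\<lambda>s z. z^2 = of_real s) 1"
    unfolding D2n_h_def generators rot_e1_pi insert_commute[of "axial (-1) \<i> False"]
    by (rule generate_dihedral_axial[OF index_groups(4) subset_cyclic _ generate_rotoreflection_4])
       (auto simp: axial_index_def)
  show "D2n_h 3 = dihedral_axial (\<lambda>s z. z^3 = of_real s) 1"
    unfolding D2n_h_def generators rot_e1_pi insert_commute[of "axial (-1) (-\<omega>\<^sup>2) False"]
    by (rule generate_dihedral_axial[OF index_groups(4) subset_cyclic _ generate_rotoreflection_6])
       (auto simp: axial_index_def w w6 norm_power)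
  have gen: "axial s z False \<in> generate O3 SO2" if "axial_index s z" "s = 1" for s z
    using that by (auto simp: SO2_eq cyclic_axial_def intro: generate.incl)
  show "O2 = dihedral_axial (\<lambda>s z. s = 1) 1"
    unfolding O2_def rot_e1_pi
    using generate_dihedral_axial[OF index_groups(5) _ _ gen, of 1] by (simp add: SO2_eq)
  show "O2_minus = dihedral_axial (\<lambda>s z. s = 1) (-1)"
    unfolding O2_minus_def reflection_e1
    using generate_dihedral_axial[OF index_groups(5) _ _ gen, of "-1"] by (simp add: SO2_eq)
qed

section \<open>The group \<open>O_minus\<close>, and the profiles of all listed groups\<close>

definition swap_yz :: "real^3^3" where
  "swap_yz = vector [vector [1, 0, 0], vector [0, 0, 1], vector [0, 1, 0]]"

lemma swap_yz_nth:
  "swap_yz$1$1 = 1" "swap_yz$1$2 = 0" "swap_yz$1$3 = 0"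
  "swap_yz$2$1 = 0" "swap_yz$2$2 = 0" "swap_yz$2$3 = 1"
  "swap_yz$3$1 = 0" "swap_yz$3$2 = 1" "swap_yz$3$3 = 0"
  by (simp_all add: swap_yz_def)

lemma reflection_e2_e3: "reflection (e2 - e3) = swap_yz"
proof -
  have n: "norm (e2 - e3) = sqrt 2"
    by (simp add: norm_eq_sqrt_inner inner_vec_def sum_3 axis_def)
  have s: "inverse (sqrt 2) * inverse (sqrt 2) = 1/2"
    by (simp flip: inverse_mult_distrib)
  have "(e2 - e3) $ 1 = 0" "(e2 - e3) $ 2 = 1" "(e2 - e3) $ 3 = -1" by (simp_all add: axis_def)
  note c = this
  show ?thesis
    unfolding reflection_def rot_def Let_def n
    by (simp add: mat_eq_3 matrix_nth swap_yz_nth inner_vec_def sum_3 c axis_def)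
       (use s in \<open>simp add: mult.commute mult.left_commute\<close>)
qed

lemma orthogonal_swap_yz: "orthogonal_matrix swap_yz"
  unfolding orthogonal_matrix by (simp add: mat_eq_3 mult_3 swap_yz_nth transpose_def mat_def)

lemma O_minus_eq: "O_minus = generate O3 {axial (-1) \<i> False, swap_yz}"
  by (simp add: O_minus_def reflection_e2_e3 minus_rot_e3)

lemma subgroup_O_minus: "subgroup O_minus O3"
  unfolding O_minus_eq
  by (rule subgroup_generate) (auto simp: orthogonal_swap_yz axial_index_def intro!: orthogonal_axial)

lemma generators_O_minus: "axial (-1) \<i> False \<in> O_minus" "swap_yz \<in> O_minus"
  by (auto simp: O_minus_eq intro: generate.incl)

text \<open>Both generators are signed permutation matrices. Integrality is the trace of this fact
  that suffices, together with orthogonality, to exclude a sixth turn.\<close>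

lemma O_minus_Ints:
  assumes "g \<in> O_minus" shows "g$i$j \<in> \<int>"
proof -
  let ?W = "{g :: real^3^3. orthogonal_matrix g \<and> (\<forall>i j. g$i$j \<in> \<int>)}"
  have "subgroup ?W O3"
  proof (rule subgroup_O3I)
    have "(mat 1 :: real^3^3)$i$j \<in> \<int>" for i j by (simp add: mat_def)
    then show "mat 1 \<in> ?W" using orthogonal_matrix_id by simp
    show "transpose g \<in> ?W" if "g \<in> ?W" for g
      using that orthogonal_matrix_transpose[of g] by (simp add: transpose_def)
  qed (auto simp: orthogonal_matrix_mul mult_3)
  moreover have "{axial (-1) \<i> False, swap_yz} \<subseteq> ?W"
    by (auto simp: orthogonal_swap_yz forall_3 axial_nth swap_yz_nth axial_index_def intro!: orthogonal_axial)
  ultimately show ?thesis using generate_subset assms unfolding O_minus_eq by blast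
qed

lemma profile_O_minus: "profile O_minus = (True, True, True, True, False, True)"
proof -
  let ?a = "axial (-1) \<i> False"
  note g = generators_O_minus and D = subgroup_O3D[OF subgroup_O_minus]
  have a2: "?a ** ?a = axial 1 (-1) False" by (simp add: axial_mult)
  \<comment> \<open>The product of the two generators permutes the three axes cyclically up to
    signs, so it is a third turn.\<close>
  have "has_det_trace O_minus 1 0"
    unfolding has_det_trace_def
    by (rule bexI[OF _ D(3)[OF g]]) (simp add: det_3 trace_def sum_3 mult_3 axial_nth swap_yz_nth)
  moreover have "has_det_trace O_minus 1 (-1)"
    unfolding has_det_trace_def
    by (rule bexI[OF _ D(3)[OF g(1) g(1)]]) (simp add: det_3 trace_def sum_3 mult_3 axial_nth)
  moreover have "has_det_trace O_minus (-1) 1"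
    unfolding has_det_trace_def
    by (rule bexI[OF _ g(2)]) (simp add: det_3 trace_def sum_3 swap_yz_nth)
  moreover have "has_det_trace O_minus (-1) (-1)"
    unfolding has_det_trace_def
    by (rule bexI[OF _ g(1)]) (simp add: det_3 trace_def sum_3 axial_nth)
  \<comment> \<open>The square of \<open>?a\<close> is the half turn about \<open>e3\<close>;
    conjugating it by \<open>swap_yz\<close> gives the one about \<open>e2\<close>.\<close>
  moreover have "two_half_turns O_minus"
    unfolding two_half_turns_def
    by (rule bexI[OF _ D(3)[OF g(1) g(1)]], rule bexI[OF _ D(3)[OF D(3)[OF g(2) D(3)[OF g(1) g(1)]] g(2)]])
       (simp add: det_3 trace_def sum_3 mult_3 axial_nth swap_yz_nth mat_eq_3)
  moreover have "\<not> has_det_trace O_minus 1 2"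
  proof
    assume "has_det_trace O_minus 1 2"
    then obtain h where h: "h \<in> O_minus" "trace h = 2" by (auto simp: has_det_trace_def)
    have o: "transpose h ** h = mat 1" "h ** transpose h = mat 1"
      using orthogonal_cancel(1,2)[OF D(1)[OF h(1)]] by blast+
    have eq: "h$1$i * h$1$i + h$2$i * h$2$i + h$3$i * h$3$i = 1"
       "h$i$1 * h$i$1 + h$i$2 * h$i$2 + h$i$3 * h$i$3 = 1" for i
      using arg_cong[OF o(1), of "\<lambda>A. A$i$i"] arg_cong[OF o(2), of "\<lambda>A. A$i$i"]
      by (simp_all add: mult_3 transpose_def mat_def)
    have d: "h$i$i \<in> {-1,0,1}" if "h$i$i * h$i$i \<le> 1" for i
    proof -
      obtain k where k: "h$i$i = of_int k" using O_minus_Ints[OF h(1), of i i] by (elim Ints_cases)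
      have "k * k \<le> 1" using that unfolding k by (metis of_int_le_1_iff of_int_mult)
      then have "\<bar>k\<bar> \<le> 1" by (metis abs_le_square_iff abs_1 one_power2 power2_eq_square)
      then have "k \<in> {-1,0,1}" by auto
      then show ?thesis by (auto simp: k)
    qed
    have "h$1$1 * h$1$1 \<le> 1" "h$2$2 * h$2$2 \<le> 1" "h$3$3 * h$3$3 \<le> 1"
      using eq(1)[of 1] eq(1)[of 2] eq(1)[of 3] zero_le_square[of "h$1$2"] zero_le_square[of "h$1$3"]
        zero_le_square[of "h$2$1"] zero_le_square[of "h$2$3"]
        zero_le_square[of "h$3$1"] zero_le_square[of "h$3$2"] by linarith+
    note d = this[THEN d]
    have "h$1$1 + h$2$2 + h$3$3 = 2" using h by (simp add: trace_def sum_3)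
    \<comment> \<open>Two diagonal entries are 1, so their rows and columns vanish elsewhere. The
      row of the diagonal entry 0 is then zero, which contradicts its norm.\<close>
    then consider "h$1$1 = 1" "h$2$2 = 1" "h$3$3 = 0" | "h$1$1 = 1" "h$2$2 = 0" "h$3$3 = 1"
      | "h$1$1 = 0" "h$2$2 = 1" "h$3$3 = 1"
      using d by auto
    then show False
      using eq(1)[of 1] eq(1)[of 2] eq(1)[of 3] eq(2)[of 1] eq(2)[of 2] eq(2)[of 3]
      by cases (auto simp: add_nonneg_eq_0_iff)
  qed
  ultimately show ?thesis by (simp add: profile_def)
qed

lemma profile_O3: "profile (carrier O3) = (True, True, True, True, True, True)"
proof -
  have H: "has_det_trace (carrier O3) s (s * (1 + 2 * Re z))" if "axial_index s z" for s z
    by (rule has_det_traceI[of s z False]) (use that orthogonal_axial in auto)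
  have "two_half_turns (carrier O3)"
    by (rule two_half_turnsI[of 1 True _ "-1"]) (auto simp: axial_index_def intro!: orthogonal_axial)
  then show ?thesis
    using H[of 1 \<omega>] H[of 1 "-1"] H[of "-1" "-1"] H[of "-1" \<i>] H[of 1 "-\<omega>"]
    by (simp add: profile_def axial_index_def \<omega>_power Re_Im_\<omega>)
qed

lemma unit_Re_ex:
  "(\<exists>z. cmod z = 1 \<and> Re z = -1/2 \<and> z\<^sup>2 = 1) = False"
  "(\<exists>z. cmod z = 1 \<and> Re z = -1/2 \<and> z^3 = 1) = True"
  "(\<exists>z. cmod z = 1 \<and> Re z = 0 \<and> z\<^sup>2 = -1) = True"
  "(\<exists>z. cmod z = 1 \<and> Re z = 0 \<and> z^3 = -1) = False"
  "(\<exists>z. cmod z = 1 \<and> Re z = 1/2 \<and> z\<^sup>2 = 1) = False"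
  "(\<exists>z. cmod z = 1 \<and> Re z = 1/2 \<and> z^3 = 1) = False"
  "(\<exists>z. cmod z = 1 \<and> Re z = -1/2) = True"
  "(\<exists>z. cmod z = 1 \<and> Re z = 1/2) = True"
  "(\<exists>z. cmod z = 1 \<and> z\<^sup>2 = -1) = True"
  "(\<exists>z. cmod z = 1 \<and> z^3 = -1) = True"
  "(\<exists>z. cmod z = 1 \<and> z \<noteq> 1 \<and> z\<^sup>2 = 1) = True"
  "(\<exists>z. cmod z = 1 \<and> z \<noteq> 1 \<and> z^3 = 1) = True"
  "(\<exists>z. cmod z = 1 \<and> z \<noteq> 1) = True"
proof -
  have w: "cmod \<omega> = 1 \<and> Re \<omega> = -1/2 \<and> \<omega>^3 = 1 \<and> \<omega> \<noteq> 1"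
    using Re_Im_\<omega> by (auto simp: \<omega>_power)
  have v: "cmod (-\<omega>) = 1 \<and> Re (-\<omega>) = 1/2" by (simp add: \<omega>_power Re_Im_\<omega>)
  have i: "cmod \<i> = 1 \<and> Re \<i> = 0 \<and> \<i>\<^sup>2 = -1" by simp
  have m: "cmod (-1) = 1 \<and> (-1::complex) \<noteq> 1 \<and> (-1::complex)\<^sup>2 = 1 \<and> (-1::complex)^3 = -1" by simp
  show "(\<exists>z. cmod z = 1 \<and> Re z = -1/2 \<and> z\<^sup>2 = 1) = False"
    "(\<exists>z. cmod z = 1 \<and> Re z = 0 \<and> z^3 = -1) = False"
    "(\<exists>z. cmod z = 1 \<and> Re z = 1/2 \<and> z\<^sup>2 = 1) = False"
    using unit_Re_cases by blast+
  show "(\<exists>z. cmod z = 1 \<and> Re z = 1/2 \<and> z^3 = 1) = False"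
    using unit_Re_cases(8) by (metis one_neq_neg_one)
  show "(\<exists>z. cmod z = 1 \<and> Re z = -1/2 \<and> z^3 = 1) = True" "(\<exists>z. cmod z = 1 \<and> Re z = -1/2) = True"
    "(\<exists>z. cmod z = 1 \<and> z \<noteq> 1 \<and> z^3 = 1) = True" using w by blast+
  show "(\<exists>z. cmod z = 1 \<and> Re z = 1/2) = True" using v by blast
  show "(\<exists>z. cmod z = 1 \<and> Re z = 0 \<and> z\<^sup>2 = -1) = True" "(\<exists>z. cmod z = 1 \<and> z\<^sup>2 = -1) = True"
    using i by blast+
  show "(\<exists>z. cmod z = 1 \<and> z^3 = -1) = True" "(\<exists>z. cmod z = 1 \<and> z \<noteq> 1 \<and> z\<^sup>2 = 1) = True"
    "(\<exists>z. cmod z = 1 \<and> z \<noteq> 1) = True" using m by blast+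
qed

lemma profiles:
  "profile Triv = (False, False, False, False, False, False)"
  "profile (Z 2) = (False, True, False, False, False, False)"
  "profile (Z 3) = (True, False, False, False, False, False)"
  "profile (Dv 2) = (False, True, True, False, False, False)"
  "profile (Dv 3) = (True, False, True, False, False, False)"
  "profile Z2_minus = (False, False, True, False, False, False)"
  "profile (Z2n_minus 2) = (False, True, False, True, False, False)"
  "profile (D 2) = (False, True, False, False, False, True)"
  "profile (D 3) = (True, True, False, False, False, True)"
  "profile (D2n_h 2) = (False, True, True, True, False, True)"
  "profile (D2n_h 3) = (True, True, True, False, False, True)"
  "profile SO2 = (True, True, False, False, True, False)"
  "profile O2 = (True, True, False, False, True, True)"
  "profile O2_minus = (True, True, True, False, True, False)"
  unfolding cyclic_groups dihedral_groups SO2_eq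
  by (simp_all only: profile_cyclic_axial profile_dihedral_axial unit_Re_ex simp_thms of_real_1 of_real_minus
      power_one one_neq_neg_one one_neq_neg_one[symmetric] if_True if_False) (simp_all add: complex_eq_iff)

definition piez_groups :: "(real^3^3) set set" where
  "piez_groups = {Triv, Z 2, Z 3, Dv 2, Dv 3, Z2_minus, Z2n_minus 2, D 2, D 3, D2n_h 2, D2n_h 3,
     SO2, O2, O2_minus, O_minus, carrier O3}"

lemma profile_piez_groups:
  "profile ` piez_groups = {
     (False, False, False, False, False, False), (False, True, False, False, False, False),
     (True, False, False, False, False, False), (False, True, True, False, False, False),
     (True, False, True, False, False, False), (False, False, True, False, False, False),
     (False, True, False, True, False, False), (False, True, False, False, False, True),
     (True, True, False, False, False, True), (False, True, True, True, False, True),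
     (True, True, True, False, False, True), (True, True, False, False, True, False),
     (True, True, False, False, True, True), (True, True, True, False, True, False),
     (True, True, True, True, False, True), (True, True, True, True, True, True)}"
  unfolding piez_groups_def image_insert image_empty profiles profile_O_minus profile_O3 ..

lemma card_profile_piez_groups: "card (profile ` piez_groups) = 16"
  unfolding profile_piez_groups by simp

text \<open>Counting replaces the pairwise comparisons: at most sixteen groups have sixteen
  different profiles, so the groups are distinct and \<open>profile\<close> is injective on
  them.\<close>

lemma card_piez_groups: "finite piez_groups" "card piez_groups = 16"
proof -
  show f: "finite piez_groups" by (simp add: piez_groups_def)
  have "card piez_groups \<le> 16"
    using card_length[of "[Triv, Z 2, Z 3, Dv 2, Dv 3, Z2_minus, Z2n_minus 2, D 2, D 3, D2n_h 2, D2n_h 3,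
      SO2, O2, O2_minus, O_minus, carrier O3]"] unfolding piez_groups_def list.set by simp
  moreover have "16 \<le> card piez_groups"
    using card_image_le[OF f, of profile] card_profile_piez_groups by simp
  ultimately show "card piez_groups = 16" by simp
qed

lemma inj_on_profile: "inj_on profile piez_groups"
  by (rule eq_card_imp_inj_on) (simp_all add: card_piez_groups card_profile_piez_groups)

lemma conj_class_inj_on_piez_groups: "inj_on conj_class piez_groups"
  using inj_on_profile profile_eq_if_conj_class_eq unfolding inj_on_def by blast

subsection \<open>Normal forms\<close>

text \<open>\<open>tensor3\<close> is the general tensor with components of weight 0 (\<open>a\<close>, \<open>b\<close>, \<open>c\<close>, \<open>d\<close>) and \<open>\<plusminus>3\<close> (\<open>t\<close>)
  under rotations about \<open>e3\<close>, and \<open>tensor2\<close> the general one of weight \<open>\<plusminus>2\<close>.\<close>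

definition tensor3 :: "complex \<Rightarrow> real \<Rightarrow> real \<Rightarrow> real \<Rightarrow> real \<Rightarrow> real^3^3^3" where
  "tensor3 t a b c d = vector [
     vector [vector [Re t, Im t, c], vector [Im t, - Re t, d], vector [c, d, 0]],
     vector [vector [Im t, - Re t, - d], vector [- Re t, - Im t, c], vector [- d, c, 0]],
     vector [vector [b, 0, 0], vector [0, b, 0], vector [0, 0, a]]]"

definition tensor2 :: "complex \<Rightarrow> complex \<Rightarrow> real^3^3^3" where
  "tensor2 \<alpha> \<beta> = vector [
     vector [vector [0, 0, Re \<alpha>], vector [0, 0, Im \<alpha>], vector [Re \<alpha>, Im \<alpha>, 0]],
     vector [vector [0, 0, Im \<alpha>], vector [0, 0, - Re \<alpha>], vector [Im \<alpha>, - Re \<alpha>, 0]],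
     vector [vector [Re \<beta>, Im \<beta>, 0], vector [Im \<beta>, - Re \<beta>, 0], vector [0, 0, 0]]]"

lemma tensor_eq_3: "P = Q \<longleftrightarrow> (\<forall>i j k. P$i$j$k = Q$i$j$k)"
  by (simp add: vec_eq_iff)

lemma form_real_3:
  fixes x y w :: "real^3"
  shows "form P x y w = 
    x$1 * (y$1 * (w$1 * P$1$1$1 + w$2 * P$1$1$2 + w$3 * P$1$1$3) +
           y$2 * (w$1 * P$1$2$1 + w$2 * P$1$2$2 + w$3 * P$1$2$3) +
           y$3 * (w$1 * P$1$3$1 + w$2 * P$1$3$2 + w$3 * P$1$3$3)) +
    x$2 * (y$1 * (w$1 * P$2$1$1 + w$2 * P$2$1$2 + w$3 * P$2$1$3) +
           y$2 * (w$1 * P$2$2$1 + w$2 * P$2$2$2 + w$3 * P$2$2$3) +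
           y$3 * (w$1 * P$2$3$1 + w$2 * P$2$3$2 + w$3 * P$2$3$3)) +
    x$3 * (y$1 * (w$1 * P$3$1$1 + w$2 * P$3$1$2 + w$3 * P$3$1$3) +
           y$2 * (w$1 * P$3$2$1 + w$2 * P$3$2$2 + w$3 * P$3$2$3) +
           y$3 * (w$1 * P$3$3$1 + w$2 * P$3$3$2 + w$3 * P$3$3$3))"
  by (simp add: form_def sum_3)

lemma tensor3_nth:
  "tensor3 t a b c d$1$1$1 = Re t" "tensor3 t a b c d$1$1$2 = Im t" "tensor3 t a b c d$1$1$3 = c"
  "tensor3 t a b c d$1$2$1 = Im t" "tensor3 t a b c d$1$2$2 = - Re t" "tensor3 t a b c d$1$2$3 = d"
  "tensor3 t a b c d$1$3$1 = c" "tensor3 t a b c d$1$3$2 = d" "tensor3 t a b c d$1$3$3 = 0"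
  "tensor3 t a b c d$2$1$1 = Im t" "tensor3 t a b c d$2$1$2 = - Re t" "tensor3 t a b c d$2$1$3 = - d"
  "tensor3 t a b c d$2$2$1 = - Re t" "tensor3 t a b c d$2$2$2 = - Im t" "tensor3 t a b c d$2$2$3 = c"
  "tensor3 t a b c d$2$3$1 = - d" "tensor3 t a b c d$2$3$2 = c" "tensor3 t a b c d$2$3$3 = 0"
  "tensor3 t a b c d$3$1$1 = b" "tensor3 t a b c d$3$1$2 = 0" "tensor3 t a b c d$3$1$3 = 0"
  "tensor3 t a b c d$3$2$1 = 0" "tensor3 t a b c d$3$2$2 = b" "tensor3 t a b c d$3$2$3 = 0"
  "tensor3 t a b c d$3$3$1 = 0" "tensor3 t a b c d$3$3$2 = 0" "tensor3 t a b c d$3$3$3 = a"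
  by (simp_all add: tensor3_def)

lemma tensor2_nth:
  "tensor2 \<alpha> \<beta>$1$1$1 = 0" "tensor2 \<alpha> \<beta>$1$1$2 = 0" "tensor2 \<alpha> \<beta>$1$1$3 = Re \<alpha>"
  "tensor2 \<alpha> \<beta>$1$2$1 = 0" "tensor2 \<alpha> \<beta>$1$2$2 = 0" "tensor2 \<alpha> \<beta>$1$2$3 = Im \<alpha>"
  "tensor2 \<alpha> \<beta>$1$3$1 = Re \<alpha>" "tensor2 \<alpha> \<beta>$1$3$2 = Im \<alpha>" "tensor2 \<alpha> \<beta>$1$3$3 = 0"
  "tensor2 \<alpha> \<beta>$2$1$1 = 0" "tensor2 \<alpha> \<beta>$2$1$2 = 0" "tensor2 \<alpha> \<beta>$2$1$3 = Im \<alpha>"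
  "tensor2 \<alpha> \<beta>$2$2$1 = 0" "tensor2 \<alpha> \<beta>$2$2$2 = 0" "tensor2 \<alpha> \<beta>$2$2$3 = - Re \<alpha>"
  "tensor2 \<alpha> \<beta>$2$3$1 = Im \<alpha>" "tensor2 \<alpha> \<beta>$2$3$2 = - Re \<alpha>" "tensor2 \<alpha> \<beta>$2$3$3 = 0"
  "tensor2 \<alpha> \<beta>$3$1$1 = Re \<beta>" "tensor2 \<alpha> \<beta>$3$1$2 = Im \<beta>" "tensor2 \<alpha> \<beta>$3$1$3 = 0"
  "tensor2 \<alpha> \<beta>$3$2$1 = Im \<beta>" "tensor2 \<alpha> \<beta>$3$2$2 = - Re \<beta>" "tensor2 \<alpha> \<beta>$3$2$3 = 0"
  "tensor2 \<alpha> \<beta>$3$3$1 = 0" "tensor2 \<alpha> \<beta>$3$3$2 = 0" "tensor2 \<alpha> \<beta>$3$3$3 = 0"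
  by (simp_all add: tensor2_def)

lemma tensor3_Piez: "tensor3 t a b c d \<in> Piez"
  by (simp add: Piez_def forall_3 tensor3_nth)

lemma tensor2_Piez: "tensor2 \<alpha> \<beta> \<in> Piez"
  by (simp add: Piez_def forall_3 tensor2_nth)

lemma tensor3_eq_iff:
  "tensor3 t a b c d = tensor3 t' a' b' c' d' \<longleftrightarrow> t = t' \<and> a = a' \<and> b = b' \<and> c = c' \<and> d = d'"
  by (auto simp: tensor_eq_3 forall_3 tensor3_nth complex_eq_iff)

lemma tensor2_eq_iff: "tensor2 \<alpha> \<beta> = tensor2 \<alpha>' \<beta>' \<longleftrightarrow> \<alpha> = \<alpha>' \<and> \<beta> = \<beta>'"
  by (auto simp: tensor_eq_3 forall_3 tensor2_nth complex_eq_iff)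

lemma tensor3_zero: "tensor3 t a b c d = 0 \<longleftrightarrow> t = 0 \<and> a = 0 \<and> b = 0 \<and> c = 0 \<and> d = 0"
  by (auto simp: tensor_eq_3 forall_3 tensor3_nth complex_eq_iff)

lemma tensor2_zero: "tensor2 \<alpha> \<beta> = 0 \<longleftrightarrow> \<alpha> = 0 \<and> \<beta> = 0"
  by (auto simp: tensor_eq_3 forall_3 tensor2_nth complex_eq_iff)

lemma tensor3_scaleR: "r *\<^sub>R tensor3 t a b c d = tensor3 (r *\<^sub>R t) (r * a) (r * b) (r * c) (r * d)"
  by (simp add: tensor_eq_3 forall_3 tensor3_nth)

lemma tensor2_scaleR: "r *\<^sub>R tensor2 \<alpha> \<beta> = tensor2 (r *\<^sub>R \<alpha>) (r *\<^sub>R \<beta>)"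
  by (simp add: tensor_eq_3 forall_3 tensor2_nth)

section \<open>The action of axial matrices on the normal forms\<close>

lemma axial_decompose:
  "axial s z f = s *\<^sub>R (axial 1 z False ** (if f then axial 1 1 True else mat 1))"
  by (simp add: axial_mult) (simp add: mat_eq_3 axial_nth)

lemma tensor_act_axial:
  assumes "axial_index s z"
  shows "tensor_act (axial s z f) P =
    s *\<^sub>R tensor_act (axial 1 z False) (if f then tensor_act (axial 1 1 True) P else P)"
proof -
  have "s^3 = s" using assms by (auto simp: axial_index_def)
  then show ?thesis
    by (subst axial_decompose) (simp add: tensor_act_scaleR_left tensor_act_one flip: tensor_act_mult)
qed

lemma tensor_act_flip:
  "tensor_act (axial 1 1 True) (tensor3 t a b c d) = tensor3 (cnj t) (- a) (- b) (- c) d"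
  "tensor_act (axial 1 1 True) (tensor2 \<alpha> \<beta>) = tensor2 (- cnj \<alpha>) (- cnj \<beta>)"
  by (simp_all add: tensor_eq_3 forall_3 tensor_act_nth form_real_3 axial_nth tensor3_nth tensor2_nth)

lemma tensor_act_rot_z:
  assumes "cmod z = 1"
  shows "tensor_act (axial 1 z False) (tensor3 t a b c d) = tensor3 (z^3 * t) a b c d"
    "tensor_act (axial 1 z False) (tensor2 \<alpha> \<beta>) = tensor2 (z\<^sup>2 * \<alpha>) (z\<^sup>2 * \<beta>)"
proof -
  have n: "Re z * Re z + Im z * Im z = 1" using assms by (simp add: cmod_1_Re_Im power2_eq_square)
  show "tensor_act (axial 1 z False) (tensor3 t a b c d) = tensor3 (z^3 * t) a b c d"
    unfolding tensor_eq_3 forall_3 tensor_act_nth form_real_3 axial_nth tensor3_nth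
      power3_eq_cube times_complex.sel if_False
    by (intro conjI; (algebra | use n in algebra | simp))
  show "tensor_act (axial 1 z False) (tensor2 \<alpha> \<beta>) = tensor2 (z\<^sup>2 * \<alpha>) (z\<^sup>2 * \<beta>)"
    unfolding tensor_eq_3 forall_3 tensor_act_nth form_real_3 axial_nth tensor2_nth
      power2_eq_square times_complex.sel if_False
    by (intro conjI; (algebra | use n in algebra | simp))
qed

lemma axial_act_tensor3:
  assumes "axial_index s z"
  shows "tensor_act (axial s z f) (tensor3 t a b c d) =
    (let \<sigma> = if f then - s else s in
      tensor3 (s * z^3 * (if f then cnj t else t)) (\<sigma> * a) (\<sigma> * b) (\<sigma> * c) (s * d))"
proof -
  have "cmod z = 1" using assms by (simp add: axial_index_def)
  note rot = tensor_act_rot_z[OF this]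
  show ?thesis
    unfolding tensor_act_axial[OF assms]
    by (simp add: rot tensor_act_flip tensor3_scaleR scaleR_conv_of_real[where ?'a=complex] mult.assoc)
qed

lemma axial_act_tensor2:
  assumes "axial_index s z"
  shows "tensor_act (axial s z f) (tensor2 \<alpha> \<beta>) =
    tensor2 (s * z\<^sup>2 * (if f then - cnj \<alpha> else \<alpha>)) (s * z\<^sup>2 * (if f then - cnj \<beta> else \<beta>))"
proof -
  have "cmod z = 1" using assms by (simp add: axial_index_def)
  note rot = tensor_act_rot_z[OF this]
  show ?thesis
    unfolding tensor_act_axial[OF assms]
    by (simp add: rot tensor_act_flip tensor2_scaleR scaleR_conv_of_real[where ?'a=complex] mult.assoc)
qed

section \<open>Symmetries of the normal forms preserve the axis of \<open>e3\<close>\<close>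

lemma form_axis_real: "form P u (axis k 1) (axis l 1) = u$1 * P$1$k$l + u$2 * P$2$k$l + u$3 * P$3$k$l"
  "form P (axis k 1) u (axis l 1) = u$1 * P$k$1$l + u$2 * P$k$2$l + u$3 * P$k$3$l"
  for u :: "real^3"
proof -
  have *: "(\<Sum>i\<in>UNIV. axis k 1 $ i * X i) = X k" for X :: "3 \<Rightarrow> real" and k
  proof -
    have "(\<Sum>i\<in>UNIV. axis k 1 $ i * X i) = (\<Sum>i\<in>UNIV. if i = k then X i else 0)"
      by (intro sum.cong) (auto simp: axis_def)
    then show ?thesis by simp
  qed
  show "form P u (axis k 1) (axis l 1) = u$1 * P$1$k$l + u$2 * P$2$k$l + u$3 * P$3$k$l"
    "form P (axis k 1) u (axis l 1) = u$1 * P$k$1$l + u$2 * P$k$2$l + u$3 * P$k$3$l"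
    by (simp_all add: form_def * sum_3)
qed

text \<open>Subtracting p times the squared norm, which is invariant, leaves a nonzero multiple of
  the square of the third coordinate.\<close>

lemma axial_if_quadratic:
  assumes g: "orthogonal_matrix g" and ne: "p \<noteq> q"
    and inv: "\<And>u. F (pull g u) = F u" and F: "\<And>u :: real^3. F u = p * ((u$1)\<^sup>2 + (u$2)\<^sup>2) + q * (u$3)\<^sup>2"
  shows "\<exists>s z f. axial_index s z \<and> g = axial s z f"
proof -
  have F': "F u = p * ((u$1)\<^sup>2 + (u$2)\<^sup>2 + (u$3)\<^sup>2) + (q - p) * (u$3)\<^sup>2" for u
    by (simp add: F algebra_simps)
  have "(pull g u $ 3)\<^sup>2 = (u $ 3)\<^sup>2" for u :: "real^3"
    using inv[of u] ne unfolding F' norm_pull[OF g] by simp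
  then show ?thesis using axial_if_pull_preserves[OF g] by metis
qed

text \<open>The excluded nonzero tensors are octupoles with a threefold axis along \<open>e3\<close>: their symmetry group, a conjugate
  of \<open>O_minus\<close>, has no invariant axis.\<close>

lemma tensor3_axial:
  assumes ne: "\<not> (d = 0 \<and> b = - a / 2 \<and> c = - a / 2 \<and> 2 * (cmod t)\<^sup>2 = a\<^sup>2)"
    and g: "g \<in> symmetry_group (tensor3 t a b c d)"
  shows "\<exists>s z f. axial_index s z \<and> g = axial s z f"
proof -
  let ?P = "tensor3 t a b c d"
  have o: "orthogonal_matrix g" and inv: "tensor_act g ?P = ?P" using g by (auto simp: symmetry_group_eq)
  note tr = trace_form_invariant[OF o inv]
  have lin: ?thesis if "x \<noteq> 0" "\<And>u. x * (pull g u $ 3) = x * (u $ 3)" for x :: real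
    using that axial_if_pull_preserves[OF o] by (metis mult_left_cancel)
  have "(2 * b + a) * (pull g u $ 3) = (2 * b + a) * (u $ 3)" for u
    using tr(1)[of u] by (simp add: sum_3 form_axis_real tensor3_nth algebra_simps)
  note 1 = lin[OF _ this]
  have "(2 * c + a) * (pull g u $ 3) = (2 * c + a) * (u $ 3)" for u
    using tr(2)[of u] by (simp add: sum_3 form_axis_real tensor3_nth algebra_simps)
  note 2 = lin[OF _ this]
  have "gram ?P u = (2 * (cmod t)\<^sup>2 + 2 * c\<^sup>2 + 2 * d\<^sup>2) * ((u$1)\<^sup>2 + (u$2)\<^sup>2) + (2 * b\<^sup>2 + a\<^sup>2) * (u$3)\<^sup>2" for u
    unfolding gram_def sum_3 form_axis_real tensor3_nth cmod_power2 by algebra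
  note 3 = axial_if_quadratic[OF o _ gram_invariant(1)[OF o inv] this]
  have "gram' ?P u = (2 * (cmod t)\<^sup>2 + c\<^sup>2 - d\<^sup>2 + b * c) * ((u$1)\<^sup>2 + (u$2)\<^sup>2) + (2 * b * c + a\<^sup>2) * (u$3)\<^sup>2" for u
    unfolding gram'_def sum_3 form_axis_real tensor3_nth cmod_power2 by algebra
  note 4 = axial_if_quadratic[OF o _ gram_invariant(2)[OF o inv] this]
  show ?thesis
  proof (rule ccontr)
    assume "\<not> ?thesis"
    \<comment> \<open>Otherwise both trace vectors vanish and both quadratic forms are multiples of
      the squared norm. With b = c = -a/2 the last two equations read 2 |t|^2 + 2 d^2 = a^2 and 2
      |t|^2 - d^2 = a^2, so d = 0.\<close>
    then have e: "2 * b + a = 0" "2 * c + a = 0" "2 * (cmod t)\<^sup>2 + 2 * c\<^sup>2 + 2 * d\<^sup>2 = 2 * b\<^sup>2 + a\<^sup>2"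
      "2 * (cmod t)\<^sup>2 + c\<^sup>2 - d\<^sup>2 + b * c = 2 * b * c + a\<^sup>2"
      using 1 2 3 4 by blast+
    then have b: "b = - a / 2" "c = - a / 2" by auto
    have q: "(- a / 2)\<^sup>2 = a\<^sup>2 / 4" "- a / 2 * (- a / 2) = a\<^sup>2 / 4" "2 * (- a / 2) * (- a / 2) = a\<^sup>2 / 2"
      by (simp_all add: power2_eq_square)
    have "d\<^sup>2 = 0" "2 * (cmod t)\<^sup>2 = a\<^sup>2"
      using e(3,4) unfolding b q by linarith+
    then show False using ne b by simp
  qed
qed

text \<open>A vector has no component of weight 2, so the contractions to vectors say nothing here.
  If both quadratic forms are multiples of the squared norm, then |\<alpha>|^2 = |\<beta>|^2 = Re
  (\<alpha> * cnj \<beta>), and |\<alpha> - \<beta>|^2 = 0. The case \<alpha> = \<beta> is the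
  totally symmetric one, the octupole.\<close>

lemma tensor2_axial:
  assumes ne: "\<alpha> \<noteq> \<beta>" and g: "g \<in> symmetry_group (tensor2 \<alpha> \<beta>)"
  shows "\<exists>s z f. axial_index s z \<and> g = axial s z f"
proof -
  let ?P = "tensor2 \<alpha> \<beta>"
  have o: "orthogonal_matrix g" and inv: "tensor_act g ?P = ?P" using g by (auto simp: symmetry_group_eq)
  have "gram ?P u = (2 * (cmod \<alpha>)\<^sup>2) * ((u$1)\<^sup>2 + (u$2)\<^sup>2) + (2 * (cmod \<beta>)\<^sup>2) * (u$3)\<^sup>2" for u
    unfolding gram_def sum_3 form_axis_real tensor2_nth cmod_power2 by algebra
  note 3 = axial_if_quadratic[OF o _ gram_invariant(1)[OF o inv] this]
  have "gram' ?P u = ((cmod \<alpha>)\<^sup>2 + Re \<alpha> * Re \<beta> + Im \<alpha> * Im \<beta>) * ((u$1)\<^sup>2 + (u$2)\<^sup>2)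
      + (2 * Re \<alpha> * Re \<beta> + 2 * Im \<alpha> * Im \<beta>) * (u$3)\<^sup>2" for u
    unfolding gram'_def sum_3 form_axis_real tensor2_nth cmod_power2 by algebra
  note 4 = axial_if_quadratic[OF o _ gram_invariant(2)[OF o inv] this]
  show ?thesis
  proof (rule ccontr)
    assume "\<not> ?thesis"
    then have "2 * (cmod \<alpha>)\<^sup>2 = 2 * (cmod \<beta>)\<^sup>2"
      "(cmod \<alpha>)\<^sup>2 + Re \<alpha> * Re \<beta> + Im \<alpha> * Im \<beta> = 2 * Re \<alpha> * Re \<beta> + 2 * Im \<alpha> * Im \<beta>"
      using 3 4 by blast+
    then have "(Re \<alpha> - Re \<beta>)\<^sup>2 + (Im \<alpha> - Im \<beta>)\<^sup>2 = 0"
      unfolding cmod_power2 by (simp add: power2_eq_square algebra_simps)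
    then show False using ne by (simp add: sum_power2_eq_zero_iff complex_eq_iff)
  qed
qed

subsection \<open>Symmetry classes of the normal forms\<close>

lemma axial_symmetry_class_cyclic:
  assumes ax: "\<And>g. g \<in> symmetry_group P \<Longrightarrow> \<exists>s z f. axial_index s z \<and> g = axial s z f"
    and C: "\<And>s z. axial_index s z \<Longrightarrow> axial s z False \<in> symmetry_group P \<longleftrightarrow> C s z"
    and no: "\<And>s z. axial_index s z \<Longrightarrow> axial s z True \<notin> symmetry_group P"
  shows "symmetry_class P = conj_class (cyclic_axial C)"
proof -
  have "g \<in> cyclic_axial C" if g: "g \<in> symmetry_group P" for g
  proof -
    obtain s z f where *: "axial_index s z" "g = axial s z f" using ax[OF g] by blast
    then have "\<not> f" using no g by auto
    then show ?thesis using * C g unfolding cyclic_axial_def by auto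
  qed
  moreover have "cyclic_axial C \<subseteq> symmetry_group P" using C by (auto simp: cyclic_axial_def)
  ultimately have "symmetry_group P = cyclic_axial C" by blast
  then show ?thesis by (simp add: symmetry_class_def)
qed

text \<open>All unflipped symmetries are taken as generators in
  \<open>axial_subgroup_with_flip\<close>. Any single flip suffices: its phase disappears in the
  conjugacy class and only its sign stays.\<close>

lemma axial_symmetry_class_dihedral:
  assumes ax: "\<And>g. g \<in> symmetry_group P \<Longrightarrow> \<exists>s z f. axial_index s z \<and> g = axial s z f"
    and C: "\<And>s z. axial_index s z \<Longrightarrow> axial s z False \<in> symmetry_group P \<longleftrightarrow> C s z"
    and m: "axial_index s z" "axial s z True \<in> symmetry_group P" and ig: "index_group C"
  shows "symmetry_class P = conj_class (dihedral_axial C s)"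
proof -
  have gen: "axial t w False \<in> generate O3 (cyclic_axial C)" if "axial_index t w" "C t w" for t w
    using that by (auto simp: cyclic_axial_def intro!: generate.incl)
  have "conj_class (symmetry_group P) = conj_class (generate O3 (insert (axial s 1 True) (cyclic_axial C)))"
  proof (rule axial_subgroup_with_flip[OF subgroup_symmetry_group ax _ _ _ m])
    show "cyclic_axial C \<subseteq> symmetry_group P" using C by (auto simp: cyclic_axial_def)
    show "\<And>g. g \<in> cyclic_axial C \<Longrightarrow> \<exists>s z. axial_index s z \<and> g = axial s z False"
      by (auto simp: cyclic_axial_def)
    show "\<And>t w. axial_index t w \<Longrightarrow> axial t w False \<in> symmetry_group P \<Longrightarrow>
        axial t w False \<in> generate O3 (cyclic_axial C)"
      using gen C by blast
  qed
  also have "generate O3 (insert (axial s 1 True) (cyclic_axial C)) = dihedral_axial C s"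
    using m(1) gen by (intro generate_dihedral_axial[OF ig]) (auto simp: axial_index_def)
  finally show ?thesis by (simp add: symmetry_class_def)
qed

lemma mem_tensor3:
  assumes "axial_index s z"
  shows "axial s z f \<in> symmetry_group (tensor3 t a b c d) \<longleftrightarrow>
    s * z^3 * (if f then cnj t else t) = t \<and> (a = 0 \<and> b = 0 \<and> c = 0 \<or> (if f then - s else s) = 1) \<and> (d = 0 \<or> s = 1)"
  using assms
  by (auto simp: symmetry_group_eq axial_act_tensor3 orthogonal_axial tensor3_eq_iff Let_def axial_index_def)

lemma mem_tensor2:
  assumes "axial_index s z"
  shows "axial s z f \<in> symmetry_group (tensor2 \<alpha> \<beta>) \<longleftrightarrow>
    s * z\<^sup>2 * (if f then - cnj \<alpha> else \<alpha>) = \<alpha> \<and> s * z\<^sup>2 * (if f then - cnj \<beta> else \<beta>) = \<beta>"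
  using assms by (simp add: symmetry_group_eq axial_act_tensor2 orthogonal_axial tensor2_eq_iff)

lemma sign_mult_eq_1: "axial_index s z \<Longrightarrow> of_real s * w = (1::complex) \<longleftrightarrow> w = of_real s"
  by (auto simp: axial_index_def minus_equation_iff[of w])

lemma mem_tensor3_rotation:
  assumes "axial_index s z" and "\<not> (a = 0 \<and> b = 0 \<and> c = 0 \<and> d = 0)"
  shows "axial s z False \<in> symmetry_group (tensor3 0 a b c d) \<longleftrightarrow> s = 1"
    "t \<noteq> 0 \<Longrightarrow> axial s z False \<in> symmetry_group (tensor3 t a b c d) \<longleftrightarrow> s = 1 \<and> z^3 = 1"
  using assms by (auto simp: mem_tensor3)

lemma mem_tensor3_rotation':
  assumes "axial_index s z" "t \<noteq> 0"
  shows "axial s z False \<in> symmetry_group (tensor3 t 0 0 0 0) \<longleftrightarrow> z^3 = of_real s"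
  using assms sign_mult_eq_1[OF assms(1), of "z^3"] by (simp add: mem_tensor3)

lemma mem_tensor2_rotation:
  assumes "axial_index s z" "\<not> (\<alpha> = 0 \<and> \<beta> = 0)"
  shows "axial s z False \<in> symmetry_group (tensor2 \<alpha> \<beta>) \<longleftrightarrow> z\<^sup>2 = of_real s"
  using assms sign_mult_eq_1[OF assms(1), of "z\<^sup>2"] by (auto simp: mem_tensor2)

lemma unit_cube_root:
  assumes "cmod u = 1" obtains w where "cmod w = 1" "w^3 = u"
proof
  show "cis (Arg u / 3)^3 = u"
  proof -
    have "u \<noteq> 0" using assms by auto
    then have "cis (Arg u) = u" using assms by (simp add: cis_Arg sgn_div_norm)
    moreover have "cis (Arg u / 3)^3 = cis (real 3 * (Arg u / 3))" by (rule Complex.DeMoivre)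
    ultimately show ?thesis by simp
  qed
qed simp

text \<open>The unflipped symmetries depend only on which of the weights 0 and 3 occur. If weight 0
  occurs, the cyclic group and both dihedral extensions are in the list, so nothing need be known
  about the flips. If only weight 3 occurs, a half turn flip always exists, and the group is
  \<open>D2n_h 3\<close> up to conjugation.\<close>

lemma tensor3_symmetry_class:
  assumes ne: "\<not> (d = 0 \<and> b = - a / 2 \<and> c = - a / 2 \<and> 2 * (cmod t)\<^sup>2 = a\<^sup>2)"
  shows "\<exists>H\<in>piez_groups. symmetry_class (tensor3 t a b c d) = conj_class H"
proof -
  let ?P = "tensor3 t a b c d"
  note ax = tensor3_axial[OF ne]
  have gps: "SO2 \<in> piez_groups" "O2 \<in> piez_groups" "O2_minus \<in> piez_groups" "Z 3 \<in> piez_groups"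
    "D 3 \<in> piez_groups" "Dv 3 \<in> piez_groups" "D2n_h 3 \<in> piez_groups" by (simp_all add: piez_groups_def)
  have cases: "\<exists>H\<in>piez_groups. symmetry_class ?P = conj_class H"
    if C: "\<And>s z. axial_index s z \<Longrightarrow> axial s z False \<in> symmetry_group ?P \<longleftrightarrow> C s z" and ig: "index_group C"
      and H: "cyclic_axial C \<in> piez_groups" "dihedral_axial C 1 \<in> piez_groups" "dihedral_axial C (-1) \<in> piez_groups" for C
  proof (cases "\<exists>s z. axial_index s z \<and> axial s z True \<in> symmetry_group ?P")
    case True
    then obtain s z where m: "axial_index s z" "axial s z True \<in> symmetry_group ?P" by blast
    have "dihedral_axial C s \<in> piez_groups" using H m(1) by (auto simp: axial_index_def)
    then show ?thesis using axial_symmetry_class_dihedral[OF ax C m ig] by blast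
  next
    case False
    then show ?thesis using axial_symmetry_class_cyclic[OF ax C] H(1) by blast
  qed
  consider (W) "t = 0" "\<not> (a = 0 \<and> b = 0 \<and> c = 0 \<and> d = 0)" | (EW) "t \<noteq> 0" "\<not> (a = 0 \<and> b = 0 \<and> c = 0 \<and> d = 0)"
    | (E) "t \<noteq> 0" "a = 0" "b = 0" "c = 0" "d = 0" | (Z) "t = 0" "a = 0" "b = 0" "c = 0" "d = 0" by blast
  then show ?thesis
  proof cases
    case W
    then show ?thesis
      using cases[of "\<lambda>s z. s = 1"] mem_tensor3_rotation(1)[OF _ W(2)] index_groups(5) gps
      by (simp add: SO2_eq dihedral_groups)
  next
    case EW
    then show ?thesis
      using cases[of "\<lambda>s z. s = 1 \<and> z^3 = 1"] mem_tensor3_rotation(2)[OF _ EW(2) EW(1)] index_groups(2)[of 3] gps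
      by (simp add: cyclic_groups dihedral_groups)
  next
    case E
    \<comment> \<open>The flip \<open>axial 1 w True\<close> sends t to w^3 * cnj t, so w is a cube
      root of t / cnj t.\<close>
    have "cmod (t / cnj t) = 1" using E by (simp add: norm_divide)
    then obtain w where w: "cmod w = 1" "w^3 = t / cnj t" using unit_cube_root by blast
    have "axial_index 1 w" "axial 1 w True \<in> symmetry_group ?P"
      using w E by (simp_all add: axial_index_def mem_tensor3)
    then have "symmetry_class ?P = conj_class (dihedral_axial (\<lambda>s z. z^3 = of_real s) 1)"
      by (intro axial_symmetry_class_dihedral[OF ax _ _ _ index_groups(4)[of 3]])
         (use E mem_tensor3_rotation' in auto)
    then show ?thesis using gps by (auto simp: dihedral_groups)
  qed (use ne in simp)
qed

lemma tensor2_symmetry_class: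
  assumes ne: "\<alpha> \<noteq> \<beta>"
  shows "\<exists>H\<in>piez_groups. symmetry_class (tensor2 \<alpha> \<beta>) = conj_class H"
proof -
  let ?P = "tensor2 \<alpha> \<beta>" and ?C = "\<lambda>s z. z\<^sup>2 = of_real s"
  note ax = tensor2_axial[OF ne]
  have C: "axial s z False \<in> symmetry_group ?P \<longleftrightarrow> ?C s z" if "axial_index s z" for s z
    using that ne by (intro mem_tensor2_rotation) auto
  show ?thesis
  proof (cases "\<exists>s z. axial_index s z \<and> axial s z True \<in> symmetry_group ?P")
    case True
    then obtain s z where m: "axial_index s z" "axial s z True \<in> symmetry_group ?P" by blast
    \<comment> \<open>Multiplying the flip by the rotoreflection
      \<open>axial (-1) \<i> False\<close> reverses its sign, so a flip of sign 1 can always be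
      chosen. This is why only one dihedral extension has to be in the list.\<close>
    have ai: "axial_index (-s) (\<i> * z)" using m(1) by (auto simp: axial_index_def norm_mult)
    have m': "axial (-s) (\<i> * z) True \<in> symmetry_group ?P"
      using m(2) unfolding mem_tensor2[OF ai] mem_tensor2[OF m(1)] by (simp add: power_mult_distrib)
    obtain w where "axial_index 1 w" "axial 1 w True \<in> symmetry_group ?P"
    proof (cases "s = 1")
      case True
      then show ?thesis using m by (intro that[of z]) auto
    next
      case False
      then have "s = -1" using m(1) by (auto simp: axial_index_def)
      then show ?thesis using ai m' by (intro that[of "\<i> * z"]) auto
    qed
    then have "symmetry_class ?P = conj_class (dihedral_axial ?C 1)"
      by (intro axial_symmetry_class_dihedral[OF ax C _ _ index_groups(4)[of 2]])
    moreover have "dihedral_axial ?C 1 \<in> piez_groups"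
      by (simp add: piez_groups_def flip: dihedral_groups(5))
    ultimately show ?thesis by blast
  next
    case False
    then have "symmetry_class ?P = conj_class (cyclic_axial ?C)"
      by (intro axial_symmetry_class_cyclic[OF ax C]) auto
    moreover have "cyclic_axial ?C \<in> piez_groups"
      by (simp add: piez_groups_def flip: cyclic_groups(5))
    ultimately show ?thesis by blast
  qed
qed

text \<open>The symmetric tensor of the cubic form 6 * x * y * z; its three axes are the coordinate
  axes.\<close>

definition xyz :: "real^3^3^3" where "xyz = tensor2 \<i> \<i>"

lemma tensor2_diagonal_class:
  assumes "\<alpha> \<noteq> 0" shows "symmetry_class (tensor2 \<alpha> \<alpha>) = symmetry_class xyz"
proof -
  \<comment> \<open>The phase is chosen so that \<alpha> = |\<alpha>| * w^2 * \<i>: a rotation by w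
    followed by a scaling takes \<open>xyz\<close> to the given tensor.\<close>
  define w where "w = csqrt (\<alpha> / (\<i> * cmod \<alpha>))"
  have w2: "w\<^sup>2 = \<alpha> / (\<i> * cmod \<alpha>)" by (simp add: w_def)
  have "(cmod w)\<^sup>2 = 1" using assms w2 by (simp add: norm_divide norm_mult flip: norm_power)
  then have w: "cmod w = 1" using abs_square_eq_1[of "cmod w"] by simp
  have "tensor2 \<alpha> \<alpha> = cmod \<alpha> *\<^sub>R tensor_act (axial 1 w False) xyz"
    using w assms by (simp add: xyz_def tensor_act_rot_z tensor2_scaleR w2 scaleR_conv_of_real[where ?'a=complex])
  then show ?thesis
    using assms w by (simp add: symmetry_class_scaleR symmetry_class_tensor_act orthogonal_axial axial_index_def)
qed

lemma tensor3_special_class: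
  assumes "2 * (cmod t)\<^sup>2 = a\<^sup>2" "a \<noteq> 0"
  shows "symmetry_class (tensor3 t a (- a / 2) (- a / 2) 0) = symmetry_class xyz"
proof -
  \<comment> \<open>A unit vector making equal angles with three orthogonal axes has inner product A
    with each. So each axis has height A and horizontal length B, and G = B * sqrt 3 / 2 comes from
    spacing the horizontal parts by 120 degrees.\<close>
  define A B G :: real where "A = sqrt (1/3)" and "B = sqrt (2/3)" and "G = sqrt (1/2)"
  have sq: "A * A = 1/3" "B * B = 2/3" "G * G = 1/2" by (simp_all add: A_def B_def G_def)
  have nz: "A \<noteq> 0" "B \<noteq> 0" by (simp_all add: A_def B_def)
  \<comment> \<open>The columns are the three axes of the octupole \<open>xyz\<close>, placed symmetrically around \<open>e3\<close>.\<close>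
  define q :: "real^3^3" where "q = vector [vector [B, - B / 2, - B / 2], vector [0, G, - G], vector [A, A, A]]"
  have qn: "q$1$1 = B" "q$1$2 = - B/2" "q$1$3 = - B/2" "q$2$1 = 0" "q$2$2 = G" "q$2$3 = - G"
    "q$3$1 = A" "q$3$2 = A" "q$3$3 = A" by (simp_all add: q_def)
  have "q ** transpose q = mat 1"
    unfolding mat_eq_3 mult_3 transpose_def vec_lambda_beta qn mat_def
    by (simp add: sq)
  then have q: "orthogonal_matrix q" 
    unfolding orthogonal_matrix_def using matrix_left_right_inverse by blast
  have "tensor_act q xyz = tensor3 B (2 * A) (- A) (- A) 0"
    unfolding tensor_eq_3 forall_3 tensor_act_nth form_real_3 qn tensor3_nth tensor2_nth xyz_def complex.sel
      Re_complex_of_real Im_complex_of_real imaginary_unit.sel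
    by (intro conjI; (algebra | use sq in algebra | simp))
  note qX = this
  \<comment> \<open>The scale is read off from the coefficient 2 * A, which has to become a. The
    assumption then says |t| = |k| * B, so only the phase of t is left, and a rotation about
    \<open>e3\<close> adjusts it.\<close>
  define k where "k = a / (2 * A)"
  have "k \<noteq> 0" using assms nz by (simp add: k_def)
  have "k\<^sup>2 * B\<^sup>2 = (cmod t)\<^sup>2"
  proof -
    have "k\<^sup>2 = a\<^sup>2 / (4 * (A * A))" "B\<^sup>2 = 2/3" using sq by (simp_all add: k_def power2_eq_square)
    then have "k\<^sup>2 * B\<^sup>2 = a\<^sup>2 / (4 * (1/3)) * (2/3)" by (simp only: sq)
    then show ?thesis using assms by simp
  qed
  moreover from this have "t \<noteq> 0" using nz \<open>k \<noteq> 0\<close> by auto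
  ultimately have "(cmod (t / (k * B)))\<^sup>2 = 1"
    using nz \<open>k \<noteq> 0\<close> by (simp add: norm_divide norm_mult power_divide power_mult_distrib)
  then have "cmod (t / (k * B)) = 1"
    using abs_square_eq_1[of "cmod (t / (k * B))"] by (simp del: norm_divide)
  then obtain w where w: "cmod w = 1" "w^3 = t / (k * B)" using unit_cube_root by blast
  have "tensor3 t a (- a / 2) (- a / 2) 0 = k *\<^sub>R tensor_act (axial 1 w False) (tensor_act q xyz)"
    unfolding qX tensor_act_rot_z[OF w(1)] tensor3_scaleR tensor3_eq_iff w(2)
    using nz \<open>k \<noteq> 0\<close> assms by (simp add: k_def scaleR_conv_of_real[where ?'a=complex])
  then show ?thesis
    using \<open>k \<noteq> 0\<close> w q by (simp add: symmetry_class_scaleR symmetry_class_tensor_act orthogonal_axial axial_index_def)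
qed

text \<open>A rotation of order at least 3 leaves only the components of weight 0 and \<open>\<plusminus>3\<close>: a product of
  eigenvectors with eigenvalues \<open>z\<close>, \<open>cnj z\<close>, \<open>1\<close> is an eigenvector of the action.\<close>

lemma tensor3_if_rotation:
  assumes P: "P \<in> Piez" and g: "axial 1 z False \<in> symmetry_group P" and z: "cmod z = 1" "z \<noteq> 1" "z \<noteq> -1"
  shows "\<exists>t a b c d. P = tensor3 t a b c d"
proof -
  define u v w :: "complex^3" where "u = vector [1, \<i>, 0]" and "v = vector [1, - \<i>, 0]" and "w = vector [0, 0, 1]"
  let ?g = "axial 1 z False"
  have inv: "tensor_act ?g P = P" using g by (simp add: symmetry_group_eq)
  have pu: "pull ?g u = z *s u" and pv: "pull ?g v = cnj z *s v" and pw: "pull ?g w = 1 *s w"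
    by (simp_all add: vec_eq_iff forall_3 pull_def sum_3 axial_nth u_def v_def w_def complex_eq_iff)
  have wt: "form P x1 x2 x3 = 0" if "pull ?g x1 = l1 *s x1" "pull ?g x2 = l2 *s x2" "pull ?g x3 = l3 *s x3"
    "l1 * l2 * l3 \<noteq> 1" for x1 x2 x3 :: "complex^3" and l1 l2 l3
  proof -
    have "form P x1 x2 x3 = l1 * l2 * l3 * form P x1 x2 x3"
      using form_tensor_act[of ?g P x1 x2 x3] unfolding inv that(1-3) form_scale .
    then show ?thesis using that(4) mult_cancel_right1[of "form P x1 x2 x3" "l1 * l2 * l3"] by blast
  qed
  have z2: "z * z \<noteq> 1" using z(2,3) by (simp add: square_eq_1_iff)
  have zz: "z * cnj z = 1" "cnj z * z = 1" using z(1) by (simp_all add: cnj_mult_unit)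
  have zzz: "z * z * cnj z = z" "cnj z * z * z = z" using zz by (simp_all add: mult.assoc)
  \<comment> \<open>Up to the symmetry in the last two arguments, these are all six products of
    weight 1 or 2, with eigenvalues z and z^2. Since P is real, the weights -1 and -2 follow by
    complex conjugation, that is, from the real and imaginary parts below.\<close>
  have "form P w w u = 0" "form P u w w = 0" "form P u u w = 0" "form P w u u = 0"
    using z(2) z2 by (auto intro!: wt[OF pw pw pu] wt[OF pu pw pw] wt[OF pu pu pw] wt[OF pw pu pu])
  moreover have "form P u u v = 0"
    by (rule wt[OF pu pu pv]) (use z(2) in \<open>simp only: zzz not_False_eq_True\<close>)
  moreover have "form P v u u = 0"
    by (rule wt[OF pv pu pu]) (use z(2) in \<open>simp only: zzz not_False_eq_True\<close>)
  ultimately have "form P w w u = 0 \<and> form P u w w = 0 \<and> form P u u w = 0 \<and> form P w u u = 0 \<and>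
      form P u u v = 0 \<and> form P v u u = 0" by blast
  note eqs = this[unfolded form_def sum_3 u_def v_def w_def vector_3 complex_eq_iff, simplified]
  have sym: "P$i$2$1 = P$i$1$2" "P$i$3$1 = P$i$1$3" "P$i$3$2 = P$i$2$3" for i
    using P unfolding Piez_def by blast+
  have "P = tensor3 (Complex (P$1$1$1) (P$1$1$2)) (P$3$3$3) (P$3$1$1) (P$1$1$3) (P$1$2$3)"
    using eqs unfolding tensor_eq_3 forall_3 tensor3_nth sym by (auto simp: sym)
  then show ?thesis by blast
qed

text \<open>Weight k is multiplied by -(\<i>^k), which is 1 for |k| <= 3 only if k is 2 or -2. No
  eigenvectors are needed, since the matrix is a signed permutation and each condition relates two
  entries of P.\<close>

lemma tensor2_if_rotoreflection:
  assumes P: "P \<in> Piez" and g: "axial (-1) \<i> False \<in> symmetry_group P"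
  shows "\<exists>\<alpha> \<beta>. P = tensor2 \<alpha> \<beta>"
proof -
  have inv: "tensor_act (axial (-1) \<i> False) P = P" using g by (simp add: symmetry_group_eq)
  have eqs: "form P (axial (-1) \<i> False $ i) (axial (-1) \<i> False $ j) (axial (-1) \<i> False $ k) = P$i$j$k" for i j k
    using tensor_act_nth[of "axial (-1) \<i> False" P i j k] unfolding inv by simp
  have sym: "P$i$2$1 = P$i$1$2" "P$i$3$1 = P$i$1$3" "P$i$3$2 = P$i$2$3" for i
    using P unfolding Piez_def by blast+
  have rows: "axial (-1) \<i> False $ 1 = 1 *s axis 2 1" "axial (-1) \<i> False $ 2 = (-1) *s axis 1 1"
    "axial (-1) \<i> False $ 3 = (-1) *s axis 3 1"
    by (simp_all add: vec_eq_iff forall_3 axial_nth axis_def)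
  note e = eqs[of 1 1 1] eqs[of 1 1 2] eqs[of 1 1 3] eqs[of 1 2 2] eqs[of 1 2 3] eqs[of 1 3 3]
    eqs[of 2 1 1] eqs[of 2 1 2] eqs[of 2 1 3] eqs[of 2 2 2] eqs[of 2 2 3] eqs[of 2 3 3]
    eqs[of 3 1 1] eqs[of 3 1 2] eqs[of 3 1 3] eqs[of 3 2 2] eqs[of 3 2 3] eqs[of 3 3 3]
  note e = e[unfolded rows form_scale form_axis sym, simplified]
  have e: "P$1$1$1 = 0" "P$1$1$2 = 0" "P$1$2$2 = 0" "P$1$3$3 = 0" "P$2$1$1 = 0" "P$2$1$2 = 0" "P$2$2$2 = 0"
    "P$2$3$3 = 0" "P$3$1$3 = 0" "P$3$2$3 = 0" "P$3$3$3 = 0" "P$2$2$3 = - P$1$1$3" "P$2$1$3 = P$1$2$3" "P$3$2$2 = - P$3$1$1"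
    using e by linarith+
  have "P = tensor2 (Complex (P$1$1$3) (P$1$2$3)) (Complex (P$3$1$1) (P$3$1$2))"
    unfolding tensor_eq_3 forall_3 tensor2_nth sym by (simp add: e)
  then show ?thesis by blast
qed

subsection \<open>The symmetry group of the octupole\<close>

lemma form_xyz:
  fixes x y w :: "real^3"
  shows "form xyz x y w = x$1 * y$2 * w$3 + x$1 * y$3 * w$2 + x$2 * y$1 * w$3 + x$2 * y$3 * w$1
     + x$3 * y$1 * w$2 + x$3 * y$2 * w$1"
  by (simp add: form_real_3 xyz_def tensor2_nth algebra_simps)

lemma swap_yz_xyz: "swap_yz \<in> symmetry_group xyz"
  by (simp add: symmetry_group_eq orthogonal_swap_yz tensor_eq_3 forall_3 tensor_act_nth form_xyz swap_yz_nth)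
     (simp add: xyz_def tensor2_nth)

lemma O_minus_subset: "O_minus \<subseteq> symmetry_group xyz"
  unfolding O_minus_eq
proof (rule generate_subset[OF subgroup_symmetry_group])
  have "axial_index (-1) \<i>" by (simp add: axial_index_def)
  then have "axial (-1) \<i> False \<in> symmetry_group xyz" by (simp add: xyz_def mem_tensor2)
  then show "{axial (-1) \<i> False, swap_yz} \<subseteq> symmetry_group xyz" using swap_yz_xyz by simp
qed

text \<open>The axes are exactly the directions u with form xyz u u = 0, so a symmetry permutes
  them: each row of its matrix has a single nonzero entry.\<close>

lemma xyz_row_products:
  assumes g: "g \<in> symmetry_group xyz"
  shows "g$a$1 * g$a$2 = 0" "g$a$1 * g$a$3 = 0" "g$a$2 * g$a$3 = 0"
proof -
  have o: "orthogonal_matrix g" and inv: "tensor_act g xyz = xyz" using g by (auto simp: symmetry_group_eq)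
  have "form xyz (g$a) (g$a) w = 0" for w
  proof -
    have "pull g (g *v w) = w"
      using orthogonal_cancel(2)[OF o]
      by (simp add: pull_real matrix_vector_mul_assoc del: transpose_matrix_vector)
    then have "form xyz (g$a) (g$a) w = form xyz (axis a 1) (axis a 1) (g *v w)"
      using form_pull[OF inv, of "axis a 1" "axis a 1" "g *v w"] by (simp add: pull_axis)
    also have "\<dots> = 0" using exhaust_3[of a] by (auto simp: form_xyz axis_def)
    finally show ?thesis .
  qed
  from this[of "axis 3 1"] this[of "axis 2 1"] this[of "axis 1 1"]
  show "g$a$1 * g$a$2 = 0" "g$a$1 * g$a$3 = 0" "g$a$2 * g$a$3 = 0"
    by (auto simp: form_xyz axis_def)
qed

lemma O_minus_members:
  "axial 1 1 False \<in> O_minus" "axial 1 (-1) False \<in> O_minus" "axial (-1) (-\<i>) True \<in> O_minus" "axial (-1) \<i> True \<in> O_minus"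
proof -
  let ?a = "axial (-1) \<i> False" and ?b = swap_yz
  note D = subgroup_O3D[OF subgroup_O_minus] and a = generators_O_minus(1) and b = generators_O_minus(2)
  show "axial 1 1 False \<in> O_minus" using D(2) by (simp add: axial_one)
  show 2: "axial 1 (-1) False \<in> O_minus" using D(3)[OF a a] by (simp add: axial_mult)
  \<comment> \<open>Conjugating the exchange of y and z by a third turn gives the exchange of x and
    y, which in axial terms is \<open>axial (-1) (-\<i>) True\<close>.\<close>
  have "transpose (?a ** ?b) ** ?b ** (?a ** ?b) \<in> O_minus" by (intro D a b)
  moreover have "transpose (?a ** ?b) ** ?b ** (?a ** ?b) = axial (-1) (-\<i>) True"
    by (simp add: mat_eq_3 mult_3 transpose_def axial_nth swap_yz_nth)
  ultimately show 3: "axial (-1) (-\<i>) True \<in> O_minus" by simp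
  show "axial (-1) \<i> True \<in> O_minus" using D(3)[OF 2 3] by (simp add: axial_mult)
qed

lemma orthogonal_rows:
  fixes g :: "real^3^3"
  assumes "orthogonal_matrix g"
  shows "g$i$1 * g$j$1 + g$i$2 * g$j$2 + g$i$3 * g$j$3 = (if i = j then 1 else 0)"
  using arg_cong[OF orthogonal_cancel(1)[OF assms], of "\<lambda>A. A$i$j"] by (simp add: mult_3 transpose_def mat_def)

text \<open>The stabilizer of \<open>e3\<close>: the upper block is a signed permutation matrix, and
  the component P_123 forces its two nonzero entries to have equal signs. The four possibilities are
  those of \<open>O_minus_members\<close>.\<close>

lemma xyz_third_row:
  assumes g: "g \<in> symmetry_group xyz" and r: "g$3$1 = 0" "g$3$2 = 0" "g$3$3 = 1"
  shows "g \<in> O_minus"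
proof -
  have o: "orthogonal_matrix g" and inv: "tensor_act g xyz = xyz" using g by (auto simp: symmetry_group_eq)
  have z: "g$1$3 = 0" "g$2$3 = 0" using orthogonal_rows[OF o, of 1 3] orthogonal_rows[OF o, of 2 3] r by simp_all
  have n: "g$1$1 * g$1$1 + g$1$2 * g$1$2 = 1" using orthogonal_rows[OF o, of 1 1] z by simp
  have p: "g$1$1 * g$1$2 = 0" "g$2$1 * g$2$2 = 0" using xyz_row_products[OF g] by blast+
  have "tensor_act g xyz $1$2$3 = xyz$1$2$3" using inv by simp
  then have f: "g$1$1 * g$2$2 + g$1$2 * g$2$1 = 1"
    by (simp add: tensor_act_nth form_xyz r z) (simp add: xyz_def tensor2_nth)
  show ?thesis
  proof (cases "g$1$2 = 0")
    case True
    then have "g$1$1 = 1 \<or> g$1$1 = -1" using n by (simp add: square_eq_1_iff)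
    then have "g = axial 1 1 False \<or> g = axial 1 (-1) False"
      using True f p z r by (auto simp: mat_eq_3 axial_nth)
    then show ?thesis using O_minus_members by auto
  next
    case False
    then have 0: "g$1$1 = 0" using p by simp
    then have "g$1$2 = 1 \<or> g$1$2 = -1" using n by (simp add: square_eq_1_iff)
    then have "g = axial (-1) (-\<i>) True \<or> g = axial (-1) \<i> True"
      using 0 f p z r by (auto simp: mat_eq_3 axial_nth)
    then show ?thesis using O_minus_members by auto
  qed
qed

lemma symmetry_group_xyz: "symmetry_group xyz = O_minus"
proof
  show "O_minus \<subseteq> symmetry_group xyz" by (rule O_minus_subset)
  show "symmetry_group xyz \<subseteq> O_minus"
  proof
    fix g assume g: "g \<in> symmetry_group xyz"
    let ?a = "axial (-1) \<i> False" and ?b = swap_yz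
    note D = subgroup_O3D[OF subgroup_O_minus] and a = generators_O_minus(1) and b = generators_O_minus(2)
    have o: "orthogonal_matrix g" using g by (auto simp: symmetry_group_eq)
    have n: "g$3$1 * g$3$1 + g$3$2 * g$3$2 + g$3$3 * g$3$3 = 1" using orthogonal_rows[OF o, of 3 3] by simp
    note p = xyz_row_products[OF g, of 3]
    \<comment> \<open>The orbit half of an orbit-stabilizer argument. The third row of
      \<open>g\<close> is one of six signed basis vectors, and in each case below \<open>x\<close>
      is a word in the generators that moves it to \<open>e3\<close>.\<close>
    have thirdI: "g \<in> O_minus"
      if x: "x \<in> O_minus" and r: "(g ** x)$3$1 = 0" "(g ** x)$3$2 = 0" "(g ** x)$3$3 = 1" for x
    proof -
      have "g ** x \<in> symmetry_group xyz"
        using subgroup_O3D(3)[OF subgroup_symmetry_group g] x O_minus_subset by blast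
      then have "(g ** x) ** transpose x \<in> O_minus"
        using xyz_third_row r x D(3,4) by blast
      then show ?thesis using orthogonal_cancel(1)[OF D(1)[OF x]] by (simp flip: matrix_mul_assoc)
    qed
    consider "g$3$1 = 0" "g$3$2 = 0" "g$3$3 * g$3$3 = 1" | "g$3$1 = 0" "g$3$3 = 0" "g$3$2 * g$3$2 = 1"
      | "g$3$2 = 0" "g$3$3 = 0" "g$3$1 * g$3$1 = 1" using p n by fastforce
    then show "g \<in> O_minus"
    proof cases
      case 1
      then consider "g$3$3 = 1" | "g$3$3 = -1" by (auto simp: square_eq_1_iff)
      then show ?thesis
      proof cases
        case pos: 1
        with 1 show ?thesis by (intro thirdI[OF D(2)]) simp_all
      next
        case 2
        with 1 show ?thesis by (intro thirdI[OF a]) (simp_all add: mult_3 axial_nth)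
      qed
    next
      case 2
      then consider "g$3$2 = 1" | "g$3$2 = -1" by (auto simp: square_eq_1_iff)
      then show ?thesis
      proof cases
        case 1 with 2 show ?thesis by (intro thirdI[OF b]) (simp_all add: mult_3 swap_yz_nth)
      next
        case neg: 2
        with 2 show ?thesis by (intro thirdI[OF D(3)[OF b a]]) (simp_all add: mult_3 swap_yz_nth axial_nth)
      qed
    next
      case 3
      then consider "g$3$1 = 1" | "g$3$1 = -1" by (auto simp: square_eq_1_iff)
      then show ?thesis
      proof cases
        case 1 with 3 show ?thesis by (intro thirdI[OF D(3)[OF a b]]) (simp_all add: mult_3 swap_yz_nth axial_nth)
      next
        case 2
        with 3 show ?thesis by (intro thirdI[OF D(3)[OF D(3)[OF a b] a]]) (simp_all add: mult_3 swap_yz_nth axial_nth)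
      qed
    qed
  qed
qed

lemma symmetry_class_xyz: "symmetry_class xyz = conj_class O_minus"
  by (simp add: symmetry_class_def symmetry_group_xyz)

subsection \<open>Every symmetry class is in the list\<close>

lemma axial_minus_one: "axial (-1) 1 False = - mat 1"
  by (simp add: mat_eq_3 axial_nth mat_def)

lemma symmetry_class_zero: "symmetry_class 0 = conj_class (carrier O3)"
proof -
  have "symmetry_group 0 = carrier O3" by (auto simp: symmetry_group_eq tensor_act_def vec_eq_iff)
  then show ?thesis by (simp add: symmetry_class_def)
qed

text \<open>The rank is odd, so the inversion acts as multiplication by -1.\<close>

lemma no_inversion:
  assumes "P \<noteq> 0" shows "- mat 1 \<notin> symmetry_group P"
proof
  assume "- mat 1 \<in> symmetry_group P"
  then have "tensor_act ((-1) *\<^sub>R mat 1) P = P" by (simp add: symmetry_group_eq)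
  then have "- P = P" unfolding tensor_act_scaleR_left by (simp add: tensor_act_one)
  then show False using assms by (simp add: neg_eq_iff_add_eq_0 vec_eq_iff)
qed

lemma tensor3_in_list:
  assumes "tensor3 t a b c d \<noteq> 0"
  shows "\<exists>H\<in>piez_groups. symmetry_class (tensor3 t a b c d) = conj_class H"
proof (cases "d = 0 \<and> b = - a / 2 \<and> c = - a / 2 \<and> 2 * (cmod t)\<^sup>2 = a\<^sup>2")
  case True
  then have "a \<noteq> 0" using assms by (auto simp: tensor3_zero)
  then have "symmetry_class (tensor3 t a b c d) = conj_class O_minus"
    using tensor3_special_class[of t a] True by (simp add: symmetry_class_xyz)
  then show ?thesis by (auto simp: piez_groups_def)
qed (rule tensor3_symmetry_class)

lemma tensor2_in_list:
  assumes "tensor2 \<alpha> \<beta> \<noteq> 0"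
  shows "\<exists>H\<in>piez_groups. symmetry_class (tensor2 \<alpha> \<beta>) = conj_class H"
proof (cases "\<alpha> = \<beta>")
  case True
  then have "symmetry_class (tensor2 \<alpha> \<beta>) = conj_class O_minus"
    using assms tensor2_diagonal_class[of \<alpha>] by (auto simp: tensor2_zero symmetry_class_xyz)
  then show ?thesis by (auto simp: piez_groups_def)
qed (rule tensor2_symmetry_class)

lemma improper_conj_axial:
  assumes og: "orthogonal_matrix g" and dg: "det g = -1"
  obtains q z where "orthogonal_matrix q" "cmod z = 1" "transpose q ** g ** q = axial (-1) z False"
proof -
  have "det (- g) = 1" using dg by (simp add: det_3 algebra_simps)
  moreover have "orthogonal_matrix (- g)"
  proof -
    have "- g = - mat 1 ** g" by (simp add: mat_eq_3 mult_3 mat_def)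
    moreover have "orthogonal_matrix (- mat 1 :: real^3^3)"
      unfolding axial_minus_one[symmetric] by (rule orthogonal_axial) (simp add: axial_index_def)
    ultimately show ?thesis using og orthogonal_matrix_mul by metis
  qed
  ultimately obtain q z where q: "orthogonal_matrix q" "cmod z = 1" "transpose q ** (- g) ** q = axial 1 z False"
    using rotation_conj_axial by metis
  have "transpose q ** g ** q = - (transpose q ** (- g) ** q)"
    by (simp add: mat_eq_3 mult_3 algebra_simps)
  then show ?thesis using q by (intro that[of q z]) (simp_all add: axial_minus)
qed

lemma conj_square:
  fixes q g :: "real^3^3"
  assumes "orthogonal_matrix q"
  shows "(transpose q ** g ** q) ** (transpose q ** g ** q) = mat 1 \<longleftrightarrow> g ** g = mat 1"
proof
  assume "(transpose q ** g ** q) ** (transpose q ** g ** q) = mat 1"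
  then have "transpose q ** (g ** g) ** q = mat 1"
    by (simp add: orthogonal_cancel[OF assms] flip: matrix_mul_assoc)
  then have "q ** (transpose q ** (g ** g) ** q) ** transpose q = q ** mat 1 ** transpose q" by simp
  then show "g ** g = mat 1" using assms by (simp flip: matrix_mul_assoc)
next
  assume "g ** g = mat 1"
  have "(transpose q ** g ** q) ** (transpose q ** g ** q) = transpose q ** (g ** g) ** q"
    using assms by (simp flip: matrix_mul_assoc)
  then show "(transpose q ** g ** q) ** (transpose q ** g ** q) = mat 1"
    using assms by (simp add: \<open>g ** g = mat 1\<close>)
qed

lemma axial_square_eq_1: "axial_index s z \<Longrightarrow> axial s z False ** axial s z False = mat 1 \<longleftrightarrow> z = 1 \<or> z = -1"
proof -
  assume s: "axial_index s z"
  have "axial s z False ** axial s z False = axial 1 (z * z) False" using s by (auto simp: axial_mult axial_index_def)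
  moreover have "axial 1 (z * z) False = axial 1 1 False \<longleftrightarrow> z * z = 1"
    using s by (subst axial_eq_iff) (auto simp: axial_index_def norm_mult)
  ultimately show ?thesis by (simp add: axial_one square_eq_1_iff)
qed

text \<open>If the group has exponent 2, all its elements commute with a chosen half turn about \<open>e3\<close>.\<close>

lemma involutive_axial:
  assumes G: "subgroup G O3" and inv: "\<And>g. g \<in> G \<Longrightarrow> g ** g = mat 1"
    and r: "axial 1 (-1) False \<in> G" and g: "g \<in> G"
  shows "\<exists>s z f. axial_index s z \<and> g = axial s z f"
proof -
  let ?r = "axial 1 (-1) False"
  note D = subgroup_O3D[OF G]
  have rr: "?r ** ?r = mat 1" by (rule inv[OF r])
  have "(g ** ?r) ** (g ** ?r) = mat 1" by (rule inv[OF D(3)[OF g r]])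
  then have "g ** ((g ** ?r) ** (g ** ?r)) ** ?r = g ** ?r" by simp
  then have "((g ** g) ** ?r) ** g ** (?r ** ?r) = g ** ?r" by (simp add: matrix_mul_assoc)
  then have c: "?r ** g = g ** ?r" using inv[OF g] rr by simp
  have z: "g$1$3 = 0" "g$2$3 = 0"
    using arg_cong[OF c, of "\<lambda>A. A$1$3"] arg_cong[OF c, of "\<lambda>A. A$2$3"] by (simp_all add: mult_3 axial_nth)
  have "g$3$3 * g$3$3 = 1" using arg_cong[OF inv[OF g], of "\<lambda>A. A$3$3"] z by (simp add: mult_3 mat_def)
  then have "(pull g u $ 3)\<^sup>2 = (u$3)\<^sup>2" for u :: "real^3"
    using z by (simp add: pull_def sum_3 power_mult_distrib power2_eq_square)
  then show ?thesis using axial_if_pull_preserves[OF D(1)[OF g]] by metis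
qed

theorem symmetry_class_in_list:
  assumes P: "P \<in> Piez"
  shows "\<exists>H\<in>piez_groups. symmetry_class P = conj_class H"
proof (cases "P = 0")
  case True
  have "carrier O3 \<in> piez_groups" by (simp add: piez_groups_def)
  then show ?thesis using True symmetry_class_zero by blast
next
  case nz: False
  let ?G = "symmetry_group P"
  note D = subgroup_O3D[OF subgroup_symmetry_group]
  have move: "\<exists>Q. Q \<in> Piez \<and> Q \<noteq> 0 \<and> symmetry_class Q = symmetry_class P \<and> symmetry_group Q = conj_set (transpose q) ?G"
    if q: "orthogonal_matrix q" for q
  proof -
    let ?Q = "tensor_act (transpose q) P"
    have q': "orthogonal_matrix (transpose q)" using q by (simp add: orthogonal_matrix_transpose)
    have "tensor_act q ?Q = P" using q by (simp add: tensor_act_mult tensor_act_one)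
    moreover have "tensor_act q 0 = 0" by (simp add: tensor_act_def vec_eq_iff)
    ultimately have "?Q \<noteq> 0" using nz by auto
    then show ?thesis
      using tensor_act_Piez[OF P] symmetry_class_tensor_act[OF q'] symmetry_group_tensor_act[OF q'] by blast
  qed
  have conjI': "transpose q ** g ** q \<in> conj_set (transpose q) ?G" if "g \<in> ?G" for q g
    using that by (auto simp: conj_set_def)
  show ?thesis
  proof (cases "\<exists>g\<in>?G. det g = 1 \<and> g ** g \<noteq> mat 1")
    case True
    then obtain g where g: "g \<in> ?G" "det g = 1" "g ** g \<noteq> mat 1" by blast
    obtain q z where q: "orthogonal_matrix q" "cmod z = 1" "transpose q ** g ** q = axial 1 z False"
      using rotation_conj_axial[OF D(1)[OF g(1)] g(2)] .
    obtain Q where Q: "Q \<in> Piez" "Q \<noteq> 0" "symmetry_class Q = symmetry_class P" "symmetry_group Q = conj_set (transpose q) ?G"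
      using move[OF q(1)] by blast
    have "axial 1 z False \<in> symmetry_group Q" using conjI'[OF g(1), of q] q Q by simp
    moreover have "z \<noteq> 1" "z \<noteq> -1"
      using g(3) conj_square[OF q(1), of g] axial_square_eq_1[of 1 z] q by (auto simp: axial_index_def)
    ultimately obtain t a b c d where "Q = tensor3 t a b c d"
      using tensor3_if_rotation[OF Q(1) _ q(2)] by blast
    then show ?thesis using tensor3_in_list Q by metis
  next
    case no: False
    show ?thesis
    proof (cases "\<exists>g\<in>?G. g ** g \<noteq> mat 1")
      case True
      then obtain g where g: "g \<in> ?G" "g ** g \<noteq> mat 1" by blast
      have og: "orthogonal_matrix g" using D(1) g by blast
      have dg: "det g = -1" using det_orthogonal_matrix[OF og] no g by blast
      obtain q z where q: "orthogonal_matrix q" "cmod z = 1" and gq: "transpose q ** g ** q = axial (-1) z False"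
        using improper_conj_axial[OF og dg] .
      have iz: "axial_index (-1) z" using q by (simp add: axial_index_def)
      obtain Q where Q: "Q \<in> Piez" "Q \<noteq> 0" "symmetry_class Q = symmetry_class P" "symmetry_group Q = conj_set (transpose q) ?G"
        using move[OF q(1)] by blast
      have mQ: "axial (-1) z False \<in> symmetry_group Q" using conjI'[OF g(1), of q] gq Q by simp
      have z1: "z * z \<noteq> 1"
        using g(2) conj_square[OF q(1), of g] axial_square_eq_1[OF iz] by (simp add: gq square_eq_1_iff)
      \<comment> \<open>The square of \<open>g\<close> is a rotation in the group, and all of these
        are involutions by \<open>no\<close>. So z^4 = 1, and since z^2 is not 1, it is -1.\<close>
      have "det (g ** g) = 1" using dg by (simp add: det_mul)
      then have "(g ** g) ** (g ** g) = mat 1" using no D(3)[OF g(1) g(1)] by blast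
      then have "(transpose q ** (g ** g) ** q) ** (transpose q ** (g ** g) ** q) = mat 1"
        using conj_square[OF q(1)] by blast
      moreover have "transpose q ** (g ** g) ** q = (transpose q ** g ** q) ** (transpose q ** g ** q)"
        using q(1) by (simp flip: matrix_mul_assoc)
      then have "transpose q ** (g ** g) ** q = axial 1 (z * z) False" by (simp add: gq axial_mult)
      ultimately have "z * z = -1"
        using axial_square_eq_1[of 1 "z * z"] z1 q(2) by (simp add: axial_index_def norm_mult)
      then consider "z = \<i>" | "z = - \<i>" using square_eq_cases(2)[of z] by (auto simp: power2_eq_square)
      then have "axial (-1) \<i> False \<in> symmetry_group Q"
        by cases (use mQ D(4)[OF mQ] in \<open>simp_all add: axial_transpose\<close>)
      then obtain \<alpha> \<beta> where "Q = tensor2 \<alpha> \<beta>" using tensor2_if_rotoreflection[OF Q(1)] by blast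
      then show ?thesis using tensor2_in_list Q by metis
    next
      case inv: False
      show ?thesis
      proof (cases "\<exists>g\<in>?G. det g = 1 \<and> g \<noteq> mat 1")
        case True
        then obtain g where g: "g \<in> ?G" "det g = 1" "g \<noteq> mat 1" by blast
        obtain q z where q: "orthogonal_matrix q" "cmod z = 1" "transpose q ** g ** q = axial 1 z False"
          using rotation_conj_axial[OF D(1)[OF g(1)] g(2)] .
        obtain Q where Q: "Q \<in> Piez" "Q \<noteq> 0" "symmetry_class Q = symmetry_class P" "symmetry_group Q = conj_set (transpose q) ?G"
          using move[OF q(1)] by blast
        have mQ: "axial 1 z False \<in> symmetry_group Q" using conjI'[OF g(1), of q] q Q by simp
        have invQ: "h ** h = mat 1" if "h \<in> symmetry_group Q" for h
        proof -
          obtain k where k: "k \<in> ?G" "h = transpose q ** k ** q"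
            using \<open>h \<in> symmetry_group Q\<close> Q(4) by (auto simp: conj_set_def)
          then show ?thesis using inv conj_square[OF q(1)] by blast
        qed
        have "z = -1"
        proof -
          have "z \<noteq> 1"
          proof
            assume "z = 1"
            then have "q ** (transpose q ** g ** q) ** transpose q = q ** mat 1 ** transpose q"
              using q by (simp add: axial_one)
            then show False using g(3) q(1) by (simp flip: matrix_mul_assoc)
          qed
          then show ?thesis using invQ[OF mQ] axial_square_eq_1[of 1 z] q(2) by (auto simp: axial_index_def)
        qed
        then have r: "axial 1 (-1) False \<in> symmetry_group Q" using mQ by simp
        note ax = involutive_axial[OF subgroup_symmetry_group invQ r]
        have C: "axial s w False \<in> symmetry_group Q \<longleftrightarrow> s = 1 \<and> w^2 = 1" if "axial_index s w" for s w
        proof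
          assume m: "axial s w False \<in> symmetry_group Q"
          have w: "w = 1 \<or> w = -1" using invQ[OF m] axial_square_eq_1[OF that] by simp
          \<comment> \<open>Such an element would be the inversion itself, or would become it after
            multiplication by the half turn \<open>r\<close>.\<close>
          have "s \<noteq> -1"
          proof
            assume s: "s = -1"
            have "axial (-1) 1 False \<in> symmetry_group Q"
              using w m D(3)[OF m r] by (auto simp: s axial_mult)
            then show False using no_inversion[OF Q(2)] by (simp add: axial_minus_one)
          qed
          then show "s = 1 \<and> w^2 = 1" using w that by (auto simp: axial_index_def)
        next
          assume "s = 1 \<and> w^2 = 1"
          then show "axial s w False \<in> symmetry_group Q"
            using r D(2) by (auto simp: square_eq_cases axial_one)
        qed
        show ?thesis
        proof (cases "\<exists>s w. axial_index s w \<and> axial s w True \<in> symmetry_group Q")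
          case True
          then obtain s w where m: "axial_index s w" "axial s w True \<in> symmetry_group Q" by blast
          have "symmetry_class Q = conj_class (dihedral_axial (\<lambda>s z. s = 1 \<and> z^2 = 1) s)"
            by (rule axial_symmetry_class_dihedral[OF ax C m index_groups(2)])
          moreover have "D 2 \<in> piez_groups" "Dv 2 \<in> piez_groups" by (simp_all add: piez_groups_def)
          then have "dihedral_axial (\<lambda>s z. s = 1 \<and> z^2 = 1) s \<in> piez_groups"
            using m(1) unfolding dihedral_groups(1,3) by (auto simp: axial_index_def)
          ultimately show ?thesis using Q by metis
        next
          case False
          then have "symmetry_class Q = conj_class (Z 2)"
            unfolding cyclic_groups by (intro axial_symmetry_class_cyclic[OF ax C]) auto
          then show ?thesis using Q by (auto simp: piez_groups_def)
        qed
      next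
        case no1: False
        show ?thesis
        proof (cases "?G = {mat 1}")
          case True
          then have "symmetry_class P = conj_class Triv" by (simp add: symmetry_class_def Triv_def)
          then show ?thesis by (auto simp: piez_groups_def)
        next
          case False
          then obtain g where g: "g \<in> ?G" "g \<noteq> mat 1" using D(2) by blast
          have dm: "det h = -1" if "h \<in> ?G" "h \<noteq> mat 1" for h
            using that no1 det_orthogonal_matrix[OF D(1)[OF that(1)]] by blast
          \<comment> \<open>With no rotation but the identity, the determinant is injective on the
            group, which therefore has at most two elements.\<close>
          have two: "h = mat 1 \<or> h = g" if h: "h \<in> ?G" for h
          proof (cases "h = mat 1")
            case False
            have "det (h ** g) = 1" using dm h g False by (simp add: det_mul)
            then have hg: "h ** g = mat 1" using no1 D(3)[OF h g(1)] by blast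
            have gg: "g ** g = mat 1" using inv g(1) by blast
            have "h = h ** (g ** g)" by (simp add: gg)
            also have "\<dots> = g" by (simp add: matrix_mul_assoc hg)
            finally show ?thesis ..
          qed simp
          obtain q z where q: "orthogonal_matrix q" "cmod z = 1" and gq: "transpose q ** g ** q = axial (-1) z False"
            using improper_conj_axial[OF D(1)[OF g(1)] dm[OF g]] .
          have iz: "axial_index (-1) z" using q by (simp add: axial_index_def)
          obtain Q where Q: "Q \<in> Piez" "Q \<noteq> 0" "symmetry_class Q = symmetry_class P" "symmetry_group Q = conj_set (transpose q) ?G"
            using move[OF q(1)] by blast
          have mQ: "axial (-1) z False \<in> symmetry_group Q" using conjI'[OF g(1), of q] gq Q by simp
          have "z \<noteq> 1" using mQ no_inversion[OF Q(2)] by (auto simp: axial_minus_one)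
          moreover have "g ** g = mat 1" using inv g(1) by blast
          then have "z = 1 \<or> z = -1" using conj_square[OF q(1), of g] axial_square_eq_1[OF iz] by (simp add: gq)
          ultimately have z: "z = -1" by blast
          have "symmetry_group Q = {mat 1, axial (-1) (-1) False}"
          proof
            have "transpose q ** mat 1 ** q = mat 1" using q(1) by simp
            then show "symmetry_group Q \<subseteq> {mat 1, axial (-1) (-1) False}"
              using two gq z unfolding Q(4) conj_set_def by fastforce
            show "{mat 1, axial (-1) (-1) False} \<subseteq> symmetry_group Q" using mQ D(2) z by simp
          qed
          moreover have "Z2_minus = {mat 1, axial (-1) (-1) False}"
          proof
            show "Z2_minus \<subseteq> {mat 1, axial (-1) (-1) False}"
              unfolding cyclic_groups by (auto simp: cyclic_axial_def axial_index_def axial_one)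
            have "{axial 1 1 False} \<subseteq> Z2_minus" "{axial (-1) (-1) False} \<subseteq> Z2_minus"
              unfolding cyclic_groups by (rule subset_cyclic; simp add: axial_index_def)+
            then show "{mat 1, axial (-1) (-1) False} \<subseteq> Z2_minus" unfolding axial_one by blast
          qed
          ultimately have "symmetry_group Q = Z2_minus" by simp
          then have "symmetry_class Q = conj_class Z2_minus" unfolding symmetry_class_def by simp
          then have "symmetry_class P = conj_class Z2_minus" unfolding Q(3) .
          then show ?thesis by (auto simp: piez_groups_def)
        qed
      qed
    qed
  qed
qed

subsection \<open>Every class in the list occurs\<close>

text \<open>For \<open>w * y = 0\<close> the quadratic form \<open>gram\<close> of this tensor is diagonal.\<close>

definition tensor_diag :: "real \<Rightarrow> real \<Rightarrow> real \<Rightarrow> real \<Rightarrow> real \<Rightarrow> real \<Rightarrow> real^3^3^3" where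
  "tensor_diag p1 p2 p3 x y w = vector [
     vector [vector [p1, 0, w], vector [0, 0, x], vector [w, x, 0]],
     vector [vector [0, 0, y], vector [0, p2, 0], vector [y, 0, 0]],
     vector [vector [0, 0, 0], vector [0, 0, 0], vector [0, 0, p3]]]"

lemma tensor_diag_nth:
  "tensor_diag p1 p2 p3 x y w$1$1$1 = p1" "tensor_diag p1 p2 p3 x y w$1$1$2 = 0" "tensor_diag p1 p2 p3 x y w$1$1$3 = w"
  "tensor_diag p1 p2 p3 x y w$1$2$1 = 0" "tensor_diag p1 p2 p3 x y w$1$2$2 = 0" "tensor_diag p1 p2 p3 x y w$1$2$3 = x"
  "tensor_diag p1 p2 p3 x y w$1$3$1 = w" "tensor_diag p1 p2 p3 x y w$1$3$2 = x" "tensor_diag p1 p2 p3 x y w$1$3$3 = 0"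
  "tensor_diag p1 p2 p3 x y w$2$1$1 = 0" "tensor_diag p1 p2 p3 x y w$2$1$2 = 0" "tensor_diag p1 p2 p3 x y w$2$1$3 = y"
  "tensor_diag p1 p2 p3 x y w$2$2$1 = 0" "tensor_diag p1 p2 p3 x y w$2$2$2 = p2" "tensor_diag p1 p2 p3 x y w$2$2$3 = 0"
  "tensor_diag p1 p2 p3 x y w$2$3$1 = y" "tensor_diag p1 p2 p3 x y w$2$3$2 = 0" "tensor_diag p1 p2 p3 x y w$2$3$3 = 0"
  "tensor_diag p1 p2 p3 x y w$3$1$1 = 0" "tensor_diag p1 p2 p3 x y w$3$1$2 = 0" "tensor_diag p1 p2 p3 x y w$3$1$3 = 0"
  "tensor_diag p1 p2 p3 x y w$3$2$1 = 0" "tensor_diag p1 p2 p3 x y w$3$2$2 = 0" "tensor_diag p1 p2 p3 x y w$3$2$3 = 0"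
  "tensor_diag p1 p2 p3 x y w$3$3$1 = 0" "tensor_diag p1 p2 p3 x y w$3$3$2 = 0" "tensor_diag p1 p2 p3 x y w$3$3$3 = p3"
  by (simp_all add: tensor_diag_def)

lemma tensor_diag_eq_iff:
  "tensor_diag p1 p2 p3 x y w = tensor_diag q1 q2 q3 x' y' w' \<longleftrightarrow>
    p1 = q1 \<and> p2 = q2 \<and> p3 = q3 \<and> x = x' \<and> y = y' \<and> w = w'"
  by (auto simp: tensor_eq_3 forall_3 tensor_diag_nth)

lemma tensor_diag_Piez: "tensor_diag p1 p2 p3 x y w \<in> Piez"
  by (simp add: Piez_def forall_3 tensor_diag_nth)

text \<open>By polarization, \<open>g\<close> commutes with the diagonal matrix \<open>M\<close> of
  the form; as the diagonal entries are distinct, \<open>g\<close> is diagonal.\<close>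

lemma diagonal_if_quadratic:
  assumes g: "orthogonal_matrix g" and ne: "l1 \<noteq> l2" "l1 \<noteq> l3" "l2 \<noteq> l3"
    and inv: "\<And>u. F (pull g u) = F u"
    and F: "\<And>u :: real^3. F u = l1 * (u$1)\<^sup>2 + l2 * (u$2)\<^sup>2 + l3 * (u$3)\<^sup>2"
  shows "i \<noteq> j \<Longrightarrow> g$i$j = 0"
proof -
  define M :: "real^3^3" where "M = vector [vector [l1, 0, 0], vector [0, l2, 0], vector [0, 0, l3]]"
  have M: "M$1$1 = l1" "M$1$2 = 0" "M$1$3 = 0" "M$2$1 = 0" "M$2$2 = l2" "M$2$3 = 0" "M$3$1 = 0" "M$3$2 = 0" "M$3$3 = l3"
    by (simp_all add: M_def)
  have add: "pull g (u + v) = pull g u + pull g v" for u v :: "real^3"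
    by (simp add: pull_def vec_eq_iff sum.distrib algebra_simps)
  have d: "F (g$k) = F (axis k 1)" for k using inv[of "axis k 1"] by (simp add: pull_axis)
  have s: "F (g$k + g$l) = F (axis k 1 + axis l 1)" for k l
    using inv[of "axis k 1 + axis l 1"] by (simp add: add pull_axis)
  have c: "2 * (l1 * g$k$1 * g$l$1 + l2 * g$k$2 * g$l$2 + l3 * g$k$3 * g$l$3)
      = F (axis k 1 + axis l 1) - F (axis k 1) - F (axis l 1)" for k l
    unfolding s[symmetric] d[symmetric] unfolding F by (simp add: power2_eq_square algebra_simps)
  have "g ** M ** transpose g = M"
    unfolding mat_eq_3 mult_3 M transpose_def vec_lambda_beta
    using c[of 1 1] c[of 1 2] c[of 1 3] c[of 2 1] c[of 2 2] c[of 2 3] c[of 3 1] c[of 3 2] c[of 3 3]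
    by (simp add: F axis_def algebra_simps)
  then have "g ** M ** transpose g ** g = M ** g" by simp
  then have "g ** M = M ** g" using orthogonal_cancel(2)[OF g] by (simp flip: matrix_mul_assoc)
  then show "i \<noteq> j \<Longrightarrow> g$i$j = 0"
    using ne exhaust_3[of i] exhaust_3[of j] by (auto simp: mat_eq_3 mult_3 M)
qed

lemma tensor_diag_diagonal:
  assumes g: "g \<in> symmetry_group (tensor_diag p1 p2 p3 x y w)"
    and wy: "w * y = 0"
    and ne: "p1\<^sup>2 + 2 * x\<^sup>2 + 2 * w\<^sup>2 \<noteq> p2\<^sup>2 + 2 * y\<^sup>2" "p1\<^sup>2 + 2 * x\<^sup>2 + 2 * w\<^sup>2 \<noteq> p3\<^sup>2" "p2\<^sup>2 + 2 * y\<^sup>2 \<noteq> p3\<^sup>2"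
  shows "i \<noteq> j \<Longrightarrow> g$i$j = 0" "\<exists>s z f. axial_index s z \<and> g = axial s z f"
proof -
  let ?P = "tensor_diag p1 p2 p3 x y w"
  have o: "orthogonal_matrix g" and inv: "tensor_act g ?P = ?P" using g by (auto simp: symmetry_group_eq)
  have "gram ?P u = (p1\<^sup>2 + 2 * x\<^sup>2 + 2 * w\<^sup>2) * (u$1)\<^sup>2 + (p2\<^sup>2 + 2 * y\<^sup>2) * (u$2)\<^sup>2 + p3\<^sup>2 * (u$3)\<^sup>2" for u
    unfolding gram_def sum_3 form_axis_real tensor_diag_nth using wy by algebra
  note off = diagonal_if_quadratic[OF o ne gram_invariant(1)[OF o inv] this]
  then show "i \<noteq> j \<Longrightarrow> g$i$j = 0" by blast
  have "g$1$3 = 0" "g$2$3 = 0" using off by simp_all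
  moreover from this have "(g$3$3)\<^sup>2 = 1"
    using arg_cong[OF orthogonal_cancel(2)[OF o], of "\<lambda>A. A$3$3"]
    by (simp add: mult_3 transpose_def mat_def power2_eq_square)
  ultimately have "(pull g u $ 3)\<^sup>2 = (u$3)\<^sup>2" for u :: "real^3"
    by (simp add: pull_def sum_3 power_mult_distrib)
  then show "\<exists>s z f. axial_index s z \<and> g = axial s z f" using axial_if_pull_preserves[OF o] by metis
qed

text \<open>A sign matrix with diagonal (e1, e2, e3) multiplies each p_i by e_i, both x and y by e1
  * e2 * e3 = s, and w by e3. Hence the set of nonzero parameters carves the symmetry group out of
  the eight sign matrices.\<close>

lemma mem_tensor_diag:
  assumes ai: "axial_index s z" and wy: "w * y = 0"
    and ne: "p1\<^sup>2 + 2 * x\<^sup>2 + 2 * w\<^sup>2 \<noteq> p2\<^sup>2 + 2 * y\<^sup>2" "p1\<^sup>2 + 2 * x\<^sup>2 + 2 * w\<^sup>2 \<noteq> p3\<^sup>2" "p2\<^sup>2 + 2 * y\<^sup>2 \<noteq> p3\<^sup>2"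
  shows "axial s z f \<in> symmetry_group (tensor_diag p1 p2 p3 x y w) \<longleftrightarrow> (z = 1 \<or> z = -1) \<and>
    (p1 = 0 \<or> s * Re z = 1) \<and> (p2 = 0 \<or> s * Re z = (if f then -1 else 1)) \<and>
    (p3 = 0 \<or> s = (if f then -1 else 1)) \<and> (x = 0 \<or> s = 1) \<and> (y = 0 \<or> s = 1) \<and> (w = 0 \<or> s = (if f then -1 else 1))"
proof -
  have "z = 1 \<or> z = -1" if "axial s z f \<in> symmetry_group (tensor_diag p1 p2 p3 x y w)"
  proof -
    have "axial s z f$2$1 = 0" by (rule tensor_diag_diagonal(1)[OF that wy ne]) simp
    then have "Im z = 0" using ai by (auto simp: axial_nth axial_index_def)
    then have "Re z = 1 \<or> Re z = -1" using ai by (simp add: axial_index_def cmod_1_Re_Im power2_eq_1_iff)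
    then show ?thesis using \<open>Im z = 0\<close> by (auto simp: complex_eq_iff)
  qed
  moreover have "s = 1 \<or> s = -1" using ai by (auto simp: axial_index_def)
  moreover have "axial s z f \<in> symmetry_group (tensor_diag p1 p2 p3 x y w) \<longleftrightarrow>
    (p1 = 0 \<or> s * Re z = 1) \<and> (p2 = 0 \<or> s * Re z = (if f then -1 else 1)) \<and>
    (p3 = 0 \<or> s = (if f then -1 else 1)) \<and> (x = 0 \<or> s = 1) \<and> (y = 0 \<or> s = 1) \<and> (w = 0 \<or> s = (if f then -1 else 1))"
    if z: "z = 1 \<or> z = -1" and s: "s = 1 \<or> s = -1"
  proof -
    define e where "e = (if f then -1 else 1 :: real)"
    have "e = 1 \<or> e = -1" by (simp add: e_def)
    have "tensor_act (axial s z f) (tensor_diag p1 p2 p3 x y w) =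
        tensor_diag (s * Re z * p1) (e * (s * Re z) * p2) (e * s * p3) (s * x) (s * y) (e * s * w)"
    proof -
      define e1 e2 e3 where "e1 = s * Re z" and "e2 = e * (s * Re z)" and "e3 = e * s"
      have A: "axial s z f$1$1 = e1" "axial s z f$2$2 = e2" "axial s z f$3$3 = e3" "axial s z f$1$2 = 0" "axial s z f$2$1 = 0"
        using z by (auto simp: axial_nth e1_def e2_def e3_def e_def)
      have "e1 * e1 = 1" "e2 * e2 = 1" "e3 * e3 = 1" "e1 * e2 * e3 = s"
        using z s \<open>e = 1 \<or> e = -1\<close> by (auto simp: e1_def e2_def e3_def)
      then have B: "e1 * (e1 * r) = r" "e2 * (e2 * r) = r" "e3 * (e3 * r) = r" "e1 * (e2 * (e3 * r)) = s * r"
        "e1 * (e3 * (e2 * r)) = s * r" "e2 * (e1 * (e3 * r)) = s * r" "e2 * (e3 * (e1 * r)) = s * r"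
        "e1 * (e3 * (e1 * r)) = e3 * r" for r
        by algebra+
      show ?thesis
        unfolding tensor_eq_3 forall_3 tensor_act_nth form_real_3 A axial_nth(3,6,7,8) tensor_diag_nth
          e2_def[symmetric] e3_def[symmetric]
        unfolding e1_def[symmetric] by (simp add: B)
    qed
    moreover have "e * r = 1 \<longleftrightarrow> r = e" for r using \<open>e = 1 \<or> e = -1\<close> by auto
    ultimately have "tensor_act (axial s z f) (tensor_diag p1 p2 p3 x y w) = tensor_diag p1 p2 p3 x y w \<longleftrightarrow>
        (p1 = 0 \<or> s * Re z = 1) \<and> (p2 = 0 \<or> s * Re z = e) \<and> (p3 = 0 \<or> s = e) \<and>
        (x = 0 \<or> s = 1) \<and> (y = 0 \<or> s = 1) \<and> (w = 0 \<or> s = e)"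
      by (simp only: tensor_diag_eq_iff mult_cancel_right2)
    then show ?thesis
      using orthogonal_axial[OF ai, of f] unfolding symmetry_group_eq mem_Collect_eq e_def by blast
  qed
  ultimately show ?thesis by blast
qed

text \<open>The nonzero parameters impose the conditions wanted on the signs, and their sizes keep
  the eigenvalues of \<open>gram\<close> distinct: they are (1, 4, 9), (2, 0, 9), (1, 4, 0), (2, 8,
  0) and (2, 0, 9). In the last two tensors \<open>y\<close> and \<open>w\<close> repeat the
  conditions of \<open>x\<close> and \<open>p3\<close> and are there to separate
  eigenvalues.\<close>

lemma realize_finite:
  "symmetry_class (tensor_diag 1 2 3 0 0 0) = conj_class Triv"
  "symmetry_class (tensor_diag 0 0 3 1 0 0) = conj_class (Z 2)"
  "symmetry_class (tensor_diag 1 2 0 0 0 0) = conj_class Z2_minus"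
  "symmetry_class (tensor_diag 0 0 0 1 2 0) = conj_class (D 2)"
  "symmetry_class (tensor_diag 0 0 3 0 0 1) = conj_class (Dv 2)"
proof -
  have cyc: "symmetry_class (tensor_diag p1 p2 p3 x y w) = conj_class (cyclic_axial C)"
    if "w * y = 0" "p1\<^sup>2 + 2 * x\<^sup>2 + 2 * w\<^sup>2 \<noteq> p2\<^sup>2 + 2 * y\<^sup>2" "p1\<^sup>2 + 2 * x\<^sup>2 + 2 * w\<^sup>2 \<noteq> p3\<^sup>2" "p2\<^sup>2 + 2 * y\<^sup>2 \<noteq> p3\<^sup>2"
      "\<And>s z. axial_index s z \<Longrightarrow> axial s z False \<in> symmetry_group (tensor_diag p1 p2 p3 x y w) \<longleftrightarrow> C s z"
      "\<And>s z. axial_index s z \<Longrightarrow> axial s z True \<notin> symmetry_group (tensor_diag p1 p2 p3 x y w)"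
    for p1 p2 p3 x y w C
    using tensor_diag_diagonal(2)[OF _ that(1-4)] that(5,6) by (rule axial_symmetry_class_cyclic)
  have dih: "symmetry_class (tensor_diag p1 p2 p3 x y w) = conj_class (dihedral_axial (\<lambda>s z. s = 1 \<and> z\<^sup>2 = 1) s)"
    if "w * y = 0" "p1\<^sup>2 + 2 * x\<^sup>2 + 2 * w\<^sup>2 \<noteq> p2\<^sup>2 + 2 * y\<^sup>2" "p1\<^sup>2 + 2 * x\<^sup>2 + 2 * w\<^sup>2 \<noteq> p3\<^sup>2" "p2\<^sup>2 + 2 * y\<^sup>2 \<noteq> p3\<^sup>2"
      "\<And>s z. axial_index s z \<Longrightarrow> axial s z False \<in> symmetry_group (tensor_diag p1 p2 p3 x y w) \<longleftrightarrow> s = 1 \<and> z\<^sup>2 = 1"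
      "axial_index s z" "axial s z True \<in> symmetry_group (tensor_diag p1 p2 p3 x y w)"
    for p1 p2 p3 x y w s z
    using tensor_diag_diagonal(2)[OF _ that(1-4)] that(5-7) index_groups(2)[of 2]
    by (rule axial_symmetry_class_dihedral)
  show "symmetry_class (tensor_diag 1 2 3 0 0 0) = conj_class Triv"
    unfolding cyclic_groups by (rule cyc) (auto simp: mem_tensor_diag)
  show "symmetry_class (tensor_diag 0 0 3 1 0 0) = conj_class (Z 2)"
    unfolding cyclic_groups by (rule cyc) (auto simp: mem_tensor_diag square_eq_cases)
  show "symmetry_class (tensor_diag 1 2 0 0 0 0) = conj_class Z2_minus"
    unfolding cyclic_groups by (rule cyc) (auto simp: mem_tensor_diag axial_index_def)
  show "symmetry_class (tensor_diag 0 0 0 1 2 0) = conj_class (D 2)"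
    unfolding dihedral_groups by (rule dih[where z = 1]) (auto simp: mem_tensor_diag square_eq_cases axial_index_def)
  show "symmetry_class (tensor_diag 0 0 3 0 0 1) = conj_class (Dv 2)"
    unfolding dihedral_groups by (rule dih[where z = 1]) (auto simp: mem_tensor_diag square_eq_cases axial_index_def)
qed

text \<open>In \<open>mem_tensor3\<close>, a nonzero a demands that \<open>e3\<close> be fixed, a
  nonzero d that the determinant be 1, and a nonzero t couples the phase to the sign by a cubic
  equation. The seven nonempty subsets of these three parameters give the seven groups.\<close>

lemma realize_tensor3:
  "symmetry_class (tensor3 0 1 0 0 1) = conj_class SO2"
  "symmetry_class (tensor3 0 0 0 0 1) = conj_class O2"
  "symmetry_class (tensor3 0 1 0 0 0) = conj_class O2_minus"
  "symmetry_class (tensor3 1 1 0 0 1) = conj_class (Z 3)"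
  "symmetry_class (tensor3 1 0 0 0 1) = conj_class (D 3)"
  "symmetry_class (tensor3 1 1 0 0 0) = conj_class (Dv 3)"
  "symmetry_class (tensor3 1 0 0 0 0) = conj_class (D2n_h 3)"
proof -
  have ax: "\<exists>s z f. axial_index s z \<and> g = axial s z f"
    if "a \<noteq> 0 \<or> d \<noteq> 0 \<or> t \<noteq> 0" "g \<in> symmetry_group (tensor3 t a 0 0 d)" for t a d g
    by (rule tensor3_axial[OF _ that(2)]) (use that(1) in auto)
  show "symmetry_class (tensor3 0 1 0 0 1) = conj_class SO2"
    unfolding SO2_eq by (rule axial_symmetry_class_cyclic[OF ax]) (auto simp: mem_tensor3)
  show "symmetry_class (tensor3 0 0 0 0 1) = conj_class O2"
    unfolding dihedral_groups
    by (rule axial_symmetry_class_dihedral[where z = 1, OF ax]) (auto simp: mem_tensor3 axial_index_def index_groups)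
  show "symmetry_class (tensor3 0 1 0 0 0) = conj_class O2_minus"
    unfolding dihedral_groups
    by (rule axial_symmetry_class_dihedral[where z = 1, OF ax]) (auto simp: mem_tensor3 axial_index_def index_groups)
  show "symmetry_class (tensor3 1 1 0 0 1) = conj_class (Z 3)"
    unfolding cyclic_groups by (rule axial_symmetry_class_cyclic[OF ax]) (auto simp: mem_tensor3)
  show "symmetry_class (tensor3 1 0 0 0 1) = conj_class (D 3)"
    unfolding dihedral_groups
    by (rule axial_symmetry_class_dihedral[where z = 1, OF ax]) (auto simp: mem_tensor3 axial_index_def index_groups)
  \<comment> \<open>Here a forces the flip to have sign -1, and t = 1 then requires z^3 = -1; hence
    the phase -1 in place of 1.\<close>
  show "symmetry_class (tensor3 1 1 0 0 0) = conj_class (Dv 3)"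
    unfolding dihedral_groups
    by (rule axial_symmetry_class_dihedral[where z = "-1", OF ax]) (auto simp: mem_tensor3 axial_index_def index_groups)
  show "symmetry_class (tensor3 1 0 0 0 0) = conj_class (D2n_h 3)"
    unfolding dihedral_groups
    by (rule axial_symmetry_class_dihedral[where z = 1, OF ax])
       (auto simp: mem_tensor3_rotation' mem_tensor3[of _ _ True] axial_index_def index_groups)
qed

text \<open>A flip requires that \<alpha> and \<beta> lie on a common real line through 0. The
  numbers 1 and \<i> violate this, while 1 and 0 satisfy it.\<close>

lemma realize_tensor2:
  "symmetry_class (tensor2 1 \<i>) = conj_class (Z2n_minus 2)"
  "symmetry_class (tensor2 1 0) = conj_class (D2n_h 2)"
proof -
  have ne: "1 \<noteq> \<i>" "1 \<noteq> (0::complex)" by (simp_all add: complex_eq_iff)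
  show "symmetry_class (tensor2 1 \<i>) = conj_class (Z2n_minus 2)"
    unfolding cyclic_groups
  proof (rule axial_symmetry_class_cyclic[OF tensor2_axial[OF ne(1)]])
    show "axial s z False \<in> symmetry_group (tensor2 1 \<i>) \<longleftrightarrow> z\<^sup>2 = of_real s" if "axial_index s z" for s z
      by (rule mem_tensor2_rotation[OF that]) simp
    show "axial s z True \<notin> symmetry_group (tensor2 1 \<i>)" if "axial_index s z" for s z
    proof
      assume "axial s z True \<in> symmetry_group (tensor2 1 \<i>)"
      then have "of_real s * z\<^sup>2 * - cnj 1 = 1" and b: "of_real s * z\<^sup>2 * \<i> = \<i>"
        unfolding mem_tensor2[OF that] by (simp_all only: if_True complex_cnj_i minus_minus)
      moreover from b have "of_real s * z\<^sup>2 = 1" by simp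
      ultimately show False by (simp only:) simp
    qed
  qed
  show "symmetry_class (tensor2 1 0) = conj_class (D2n_h 2)"
    unfolding dihedral_groups
  proof (rule axial_symmetry_class_dihedral[OF tensor2_axial[OF ne(2)]])
    show "axial s z False \<in> symmetry_group (tensor2 1 0) \<longleftrightarrow> z\<^sup>2 = of_real s" if "axial_index s z" for s z
      by (rule mem_tensor2_rotation[OF that]) simp
    show "axial_index 1 \<i>" by (simp add: axial_index_def)
    then show "axial 1 \<i> True \<in> symmetry_group (tensor2 1 0)" by (simp add: mem_tensor2)
  qed (auto intro: index_groups)
qed

lemma realizedI: "P \<in> Piez \<Longrightarrow> symmetry_class P = conj_class H \<Longrightarrow> \<exists>P\<in>Piez. symmetry_class P = conj_class H"
  by blast

theorem list_realized: "\<forall>H\<in>piez_groups. \<exists>P\<in>Piez. symmetry_class P = conj_class H"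
proof -
  have 0: "0 \<in> Piez" by (simp add: Piez_def)
  have xyz: "xyz \<in> Piez" by (simp add: xyz_def tensor2_Piez)
  show ?thesis
    unfolding piez_groups_def ball_simps
    by (intro conjI TrueI;
      rule realizedI[OF _ realize_finite(1)] realizedI[OF _ realize_finite(2)]
        realizedI[OF _ realize_finite(3)] realizedI[OF _ realize_finite(4)]
        realizedI[OF _ realize_finite(5)] realizedI[OF _ realize_tensor3(1)]
        realizedI[OF _ realize_tensor3(2)] realizedI[OF _ realize_tensor3(3)]
        realizedI[OF _ realize_tensor3(4)] realizedI[OF _ realize_tensor3(5)]
        realizedI[OF _ realize_tensor3(6)] realizedI[OF _ realize_tensor3(7)]
        realizedI[OF _ realize_tensor2(1)] realizedI[OF _ realize_tensor2(2)]
        realizedI[OF _ symmetry_class_zero] realizedI[OF _ symmetry_class_xyz];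
      simp only: tensor_diag_Piez tensor3_Piez tensor2_Piez 0 xyz)
qed

thm_deps list_realized symmetry_class_in_list card_piez_groups conj_class_inj_on_piez_groups

theorem theorem3p1:
  shows "let \<C> = {conj_class Triv, conj_class (Z 2), conj_class (Z 3),
             conj_class (Dv 2), conj_class (Dv 3), conj_class Z2_minus,
             conj_class (Z2n_minus 2), conj_class (D 2), conj_class (D 3),
             conj_class (D2n_h 2), conj_class (D2n_h 3), conj_class SO2,
             conj_class O2, conj_class O2_minus, conj_class O_minus,
             conj_class (carrier O3)}
         in card \<C> = 16 \<and>
            (\<forall>H. subgroup H O3 \<and> closed H \<longrightarrow>
               ((\<exists>P\<in>Piez. conj_class H = symmetry_class P) \<longleftrightarrow> conj_class H \<in> \<C>))"
proof -
  let ?C = "conj_class ` piez_groups"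
  have "card ?C = 16"
    using card_image[OF conj_class_inj_on_piez_groups] card_piez_groups by simp
  moreover have "(\<exists>P\<in>Piez. conj_class H = symmetry_class P) \<longleftrightarrow> conj_class H \<in> ?C" for H
  proof
    assume "\<exists>P\<in>Piez. conj_class H = symmetry_class P"
    then obtain P where "P \<in> Piez" "conj_class H = symmetry_class P" by blast
    then show "conj_class H \<in> ?C" using symmetry_class_in_list[of P] by (simp only:) blast
  next
    assume "conj_class H \<in> ?C"
    then obtain K where "K \<in> piez_groups" "conj_class H = conj_class K" by blast
    then show "\<exists>P\<in>Piez. conj_class H = symmetry_class P" using list_realized by metis
  qed
  ultimately have "card ?C = 16 \<and> (\<forall>H. subgroup H O3 \<and> closed H \<longrightarrow>
      ((\<exists>P\<in>Piez. conj_class H = symmetry_class P) \<longleftrightarrow> conj_class H \<in> ?C))"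
    by (simp only: simp_thms)
  then show ?thesis
    unfolding Let_def piez_groups_def image_insert image_empty .
qed

end
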